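(* Let $P=\mathrm{UT}_n(k)$, let $\sigma$ be one of the canonical involutions on $M_n(k)$ listed in the context (each of which leaves $P$ invariant), and let $\mathfrak{D}$ denote the set of all $\sigma$-invariant basic pairs for $P$. Then the sets $\mathcal{X}=\{\varsigma_D(\varphi):(D,\varphi)\in\mathfrak{D}\}$ and $\mathcal{Y}=\{K_D(\varphi):(D,\varphi)\in\mathfrak{D}\}$ form a supercharacter theory for $C_P(\sigma)$.
   Context: Supercharacter theory: for a finite group $G$, a pair $(\mathcal{X},\mathcal{K})$, with $\mathcal{K}$ a partition of $G$ (non-empty parts) and $\mathcal{X}$ a collection of complex characters of $G$, is a supercharacter theory if (i) $|\mathcal{X}|=|\mathcal{K}|$; (ii) every irreducible character of $G$ is a constituent of a unique $\chi\in\mathcal{X}$; (iii) every $\chi\in\mathcal{X}$ is constant on each member of $\mathcal{K}$. Let $k$ be a finite field of odd characteristic. The involution on $M_n(k)$ is $\sigma(a)=u^{-1}a^{*}u$. Here, for an involution of the first kind ($\sigma$ fixes $k$ pointwise), $a^*=a^{T}$; for one of the second kind, $k$ has a subfield $k^\sigma$ with $[k:k^\sigma]=2$, $|k^\sigma|=q$, and $a^*$ is the transpose of $(a_{ij}^q)$. In all cases $k^\sigma$ is the $\sigma$-fixed subfield of $k$ and $q=|k^\sigma|$. With $J_m$ the $m\times m$ matrix with $1$'s on the antidiagonal and $0$ elsewhere, the canonical involutions considered are: $n=2m$, $u=\begin{pmatrix}0&J_m\\-J_m&0\end{pmatrix}$, first kind (symplectic group $Sp_{2m}(k)$); $n=2m$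 or $n=2m+1$, $u=J_n$, first kind (orthogonal groups $O^+_{2m}(k)$, $O_{2m+1}(k)$); $u=J_n$, second kind (unitary group $U_n(k)$). $P=\mathrm{UT}_n(k)=1+J$ is the group of upper unitriangular matrices, with $J$ the algebra of strictly upper triangular matrices. $\sigma$ acts on $P$ by $x^\sigma=\sigma(x^{-1})$ and on $J$ by $a^\sigma=-\sigma(a)$; $C_P(\sigma)=\{x\in P:x^\sigma=x\}$. The Cayley transform $\Phi:J\to P$, $\Phi(a)=(1+a)(1-a)^{-1}$, is a bijection with inverse $\Psi(x)=(x-1)(x+1)^{-1}$. A basic subset is a set $D\subseteq\{(i,j):1\le i<j\le n\}$ (possibly empty) with at most one entry in each row and at most one in each column; a basic pair is $(D,\varphi)$ with $D$ basic and $\varphi:D\to k^\times$ a map. Put $e_D(\varphi)=\sum_{(i,j)\in D}\varphi(i,j)e_{i,j}\in J$, with $e_{i,j}$ the matrix units. One has $e_D(\varphi)^\sigma=e_{D^\sigma}(\varphi^\sigma)$ for a basic pair $(D^\sigma,\varphi^\sigma)$, and $(D,\varphi)$ is $\sigma$-invariant if $(D^\sigma,\varphi^\sigma)=(D,\varphi)$, i.e. $e_D(\varphi)^\sigma=e_D(\varphi)$. Put $K_D(\varphi)=\Phi(P\,e_D(\varphi)\,P)\cap C_P(\sigma)$. $J^\circ$ is the group of linear characters of the additive group $J^+$, with left and right actions of $P$: $(x\lambda)(a)=\lambda(x^{-1}a)$, $(\lambda x)(a)=\lambda(ax^{-1})$. Fix a non-trivial linear character $\vartheta:k^+\to\mathbb{C}^\times$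 with $\vartheta(\alpha^q)=\vartheta(\alpha)$ for all $\alpha\in k$. Put $\lambda_D(\varphi)(a)=\prod_{(i,j)\in D}\vartheta(\varphi(i,j)a_{ij})$ for $a\in J$. For a $\sigma$-invariant basic pair let $\Omega_D(\varphi)=\{x^{-1}\lambda_D(\varphi)x^\sigma:x\in P\}$, and define $\varsigma_D(\varphi):C_P(\sigma)\to\mathbb{C}$ by $\varsigma_D(\varphi)(x)=\sum_{\mu\in\Omega_D(\varphi)}\mu(\Psi(x))$. *)

theory Defs
  imports
    "Jordan_Normal_Form.VS_Connect"
    "HOL-Algebra.Embedded_Algebras"
    "HOL-Library.Disjoint_Sets"
    "HOL.Complex"
begin

section \<open>Complex characters and supercharacter theories of a finite group\<close>

text \<open>The units of the matrix ring form the group \<open>GL\<^sub>d(\<complex>)\<close>.\<close>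

definition representation :: "('a, 'b) monoid_scheme \<Rightarrow> nat \<Rightarrow> ('a \<Rightarrow> complex mat) \<Rightarrow> bool" where
  "representation G d \<rho> \<longleftrightarrow> 0 < d \<and> \<rho> \<in> hom G (units_of (ring_mat TYPE(complex) d ()))"

definition irreducible_representation ::
    "('a, 'b) monoid_scheme \<Rightarrow> nat \<Rightarrow> ('a \<Rightarrow> complex mat) \<Rightarrow> bool" where
  "irreducible_representation G d \<rho> \<longleftrightarrow>
     representation G d \<rho> \<and>
     (\<forall>W. VectorSpace.subspace class_ring W (module_vec TYPE(complex) d) \<longrightarrow>
          (\<forall>g\<in>carrier G. \<forall>w\<in>W. \<rho> g *\<^sub>v w \<in> W) \<longrightarrow>
          W = {0\<^sub>v d} \<or> W = carrier_vec d)"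

text \<open>Functions on a group are taken to be extensional on its carrier, so that equality of
  characters is equality on the group.\<close>

definition character_of ::
    "('a, 'b) monoid_scheme \<Rightarrow> nat \<Rightarrow> ('a \<Rightarrow> complex mat) \<Rightarrow> 'a \<Rightarrow> complex" where
  "character_of G d \<rho> = (\<lambda>g\<in>carrier G. \<Sum>i<d. \<rho> g $$ (i, i))"

definition characters :: "('a, 'b) monoid_scheme \<Rightarrow> ('a \<Rightarrow> complex) set" where
  "characters G = {character_of G d \<rho> | d \<rho>. representation G d \<rho>}"

definition irreducible_characters :: "('a, 'b) monoid_scheme \<Rightarrow> ('a \<Rightarrow> complex) set" where
  "irreducible_characters G = {character_of G d \<rho> | d \<rho>. irreducible_representation G d \<rho>}"

text \<open>\<open>\<psi>\<close> is a constituent of \<open>\<chi>\<close> if \<open>\<chi> - \<psi>\<close> is zero or again a character.\<close>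

definition constituent ::
    "('a, 'b) monoid_scheme \<Rightarrow> ('a \<Rightarrow> complex) \<Rightarrow> ('a \<Rightarrow> complex) \<Rightarrow> bool" where
  "constituent G \<psi> \<chi> \<longleftrightarrow>
     \<psi> \<in> characters G \<and> \<chi> \<in> characters G \<and>
     (\<chi> = \<psi> \<or> (\<exists>\<chi>'\<in>characters G. \<forall>g\<in>carrier G. \<chi> g = \<psi> g + \<chi>' g))"

definition supercharacter_theory ::
    "('a, 'b) monoid_scheme \<Rightarrow> ('a \<Rightarrow> complex) set \<Rightarrow> 'a set set \<Rightarrow> bool" where
  "supercharacter_theory G \<X> \<K> \<longleftrightarrow>
     group G \<and> finite (carrier G) \<and>
     partition_on (carrier G) \<K> \<and>
     \<X> \<subseteq> characters G \<and>
     card \<X> = card \<K> \<and>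
     (\<forall>\<psi>\<in>irreducible_characters G. \<exists>!\<chi>. \<chi> \<in> \<X> \<and> constituent G \<psi> \<chi>) \<and>
     (\<forall>\<chi>\<in>\<X>. \<forall>A\<in>\<K>. \<forall>x\<in>A. \<forall>y\<in>A. \<chi> x = \<chi> y)"


section \<open>Canonical involutions of the matrix algebra\<close>

text \<open>Matrix indices start at \<open>0\<close>.\<close>

abbreviation mat_inv :: "nat \<Rightarrow> 'k::field mat \<Rightarrow> 'k mat" where
  "mat_inv n a \<equiv> inv\<^bsub>ring_mat TYPE('k) n ()\<^esub> a"

datatype involution_kind = Symplectic | Orthogonal | Unitary

text \<open>\<open>F\<close> is the subfield of scalars fixed by the involution.\<close>

fun canonical_data :: "involution_kind \<Rightarrow> nat \<Rightarrow> 'k::field set \<Rightarrow> bool" where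
  "canonical_data Symplectic n F \<longleftrightarrow> even n \<and> F = UNIV"
| "canonical_data Orthogonal n F \<longleftrightarrow> F = UNIV"
| "canonical_data Unitary n F \<longleftrightarrow>
     subfield F class_ring \<and> ring.dimension class_ring 2 F UNIV"

definition antidiag :: "nat \<Rightarrow> 'k::field mat" where
  "antidiag m = mat m m (\<lambda>(i, j). if i + j + 1 = m then 1 else 0)"

fun form_mat :: "involution_kind \<Rightarrow> nat \<Rightarrow> 'k::field mat" where
  "form_mat Symplectic n =
     (let m = n div 2
      in four_block_mat (0\<^sub>m m m) (antidiag m) (- antidiag m) (0\<^sub>m m m))"
| "form_mat Orthogonal n = antidiag n"
| "form_mat Unitary n = antidiag n"

fun star :: "involution_kind \<Rightarrow> 'k::field set \<Rightarrow> 'k mat \<Rightarrow> 'k mat" where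
  "star Symplectic F a = transpose_mat a"
| "star Orthogonal F a = transpose_mat a"
| "star Unitary F a = transpose_mat (map_mat (\<lambda>\<alpha>. \<alpha> ^ card F) a)"

definition invol :: "involution_kind \<Rightarrow> nat \<Rightarrow> 'k::field set \<Rightarrow> 'k mat \<Rightarrow> 'k mat" where
  "invol t n F a = mat_inv n (form_mat t n) * star t F a * form_mat t n"


section \<open>The unitriangular group and the fixed points of the involution\<close>

definition strict_upper :: "nat \<Rightarrow> 'k::field mat set" where
  "strict_upper n = {a \<in> carrier_mat n n. \<forall>i<n. \<forall>j<n. j \<le> i \<longrightarrow> a $$ (i, j) = 0}"

definition UT :: "nat \<Rightarrow> 'k::field mat set" where
  "UT n = (\<lambda>a. 1\<^sub>m n + a) ` strict_upper n"

definition act_P :: "involution_kind \<Rightarrow> nat \<Rightarrow> 'k::field set \<Rightarrow> 'k mat \<Rightarrow> 'k mat" where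
  "act_P t n F x = invol t n F (mat_inv n x)"

definition act_J :: "involution_kind \<Rightarrow> nat \<Rightarrow> 'k::field set \<Rightarrow> 'k mat \<Rightarrow> 'k mat" where
  "act_J t n F a = - invol t n F a"

definition fixed_group :: "involution_kind \<Rightarrow> nat \<Rightarrow> 'k::field set \<Rightarrow> 'k mat monoid" where
  "fixed_group t n F =
     \<lparr>carrier = {x \<in> UT n. act_P t n F x = x}, mult = (*), one = 1\<^sub>m n\<rparr>"

definition cayley :: "nat \<Rightarrow> 'k::field mat \<Rightarrow> 'k mat" where
  "cayley n a = (1\<^sub>m n + a) * mat_inv n (1\<^sub>m n - a)"

definition cayley_inv :: "nat \<Rightarrow> 'k::field mat \<Rightarrow> 'k mat" where
  "cayley_inv n x = (x - 1\<^sub>m n) * mat_inv n (x + 1\<^sub>m n)"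


section \<open>Basic pairs\<close>

definition basic_subset :: "nat \<Rightarrow> (nat \<times> nat) set \<Rightarrow> bool" where
  "basic_subset n D \<longleftrightarrow>
     D \<subseteq> {(i, j). i < j \<and> j < n} \<and>
     (\<forall>i j j'. (i, j) \<in> D \<longrightarrow> (i, j') \<in> D \<longrightarrow> j = j') \<and>
     (\<forall>i i' j. (i, j) \<in> D \<longrightarrow> (i', j) \<in> D \<longrightarrow> i = i')"

definition basic_pairs :: "nat \<Rightarrow> ((nat \<times> nat) set \<times> (nat \<times> nat \<Rightarrow> 'k::field)) set" where
  "basic_pairs n = {(D, \<phi>). basic_subset n D \<and> \<phi> \<in> D \<rightarrow>\<^sub>E (UNIV - {0})}"

definition basic_elem ::
    "nat \<Rightarrow> (nat \<times> nat) set \<Rightarrow> (nat \<times> nat \<Rightarrow> 'k::field) \<Rightarrow> 'k mat" where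
  "basic_elem n D \<phi> = mat n n (\<lambda>ij. if ij \<in> D then \<phi> ij else 0)"

definition invariant_basic_pairs ::
    "involution_kind \<Rightarrow> nat \<Rightarrow> 'k::field set \<Rightarrow>
     ((nat \<times> nat) set \<times> (nat \<times> nat \<Rightarrow> 'k)) set" where
  "invariant_basic_pairs t n F =
     {(D, \<phi>) \<in> basic_pairs n. act_J t n F (basic_elem n D \<phi>) = basic_elem n D \<phi>}"


section \<open>Superclasses and supercharacters\<close>

definition superclass ::
    "involution_kind \<Rightarrow> nat \<Rightarrow> 'k::field set \<Rightarrow> (nat \<times> nat) set \<Rightarrow>
     (nat \<times> nat \<Rightarrow> 'k) \<Rightarrow> 'k mat set" where
  "superclass t n F D \<phi> =
     cayley n ` {x * basic_elem n D \<phi> * y | x y. x \<in> UT n \<and> y \<in> UT n}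
       \<inter> carrier (fixed_group t n F)"

definition nontrivial_additive_character :: "('k::field \<Rightarrow> complex) \<Rightarrow> bool" where
  "nontrivial_additive_character \<theta> \<longleftrightarrow>
     (\<forall>\<alpha>. \<theta> \<alpha> \<noteq> 0) \<and> (\<forall>\<alpha> \<beta>. \<theta> (\<alpha> + \<beta>) = \<theta> \<alpha> * \<theta> \<beta>) \<and> (\<exists>\<alpha>. \<theta> \<alpha> \<noteq> 1)"

text \<open>Linear characters of the additive group of strictly upper triangular matrices are
  extensional on that set; this makes the orbit below a set of functions on it, over which
  one can sum.\<close>

definition left_act ::
    "nat \<Rightarrow> 'k::field mat \<Rightarrow> ('k mat \<Rightarrow> complex) \<Rightarrow> 'k mat \<Rightarrow> complex" where
  "left_act n x \<mu> = (\<lambda>a\<in>strict_upper n. \<mu> (mat_inv n x * a))"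

definition right_act ::
    "nat \<Rightarrow> ('k::field mat \<Rightarrow> complex) \<Rightarrow> 'k mat \<Rightarrow> 'k mat \<Rightarrow> complex" where
  "right_act n \<mu> x = (\<lambda>a\<in>strict_upper n. \<mu> (a * mat_inv n x))"

definition basic_lin_char ::
    "nat \<Rightarrow> ('k::field \<Rightarrow> complex) \<Rightarrow> (nat \<times> nat) set \<Rightarrow> (nat \<times> nat \<Rightarrow> 'k) \<Rightarrow>
     'k mat \<Rightarrow> complex" where
  "basic_lin_char n \<theta> D \<phi> = (\<lambda>a\<in>strict_upper n. \<Prod>ij\<in>D. \<theta> (\<phi> ij * a $$ ij))"

definition twisted_orbit ::
    "involution_kind \<Rightarrow> nat \<Rightarrow> 'k::field set \<Rightarrow> ('k \<Rightarrow> complex) \<Rightarrow> (nat \<times> nat) set \<Rightarrow>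
     (nat \<times> nat \<Rightarrow> 'k) \<Rightarrow> ('k mat \<Rightarrow> complex) set" where
  "twisted_orbit t n F \<theta> D \<phi> =
     {right_act n (left_act n (mat_inv n x) (basic_lin_char n \<theta> D \<phi>)) (act_P t n F x) | x.
        x \<in> UT n}"

definition supercharacter ::
    "involution_kind \<Rightarrow> nat \<Rightarrow> 'k::field set \<Rightarrow> ('k \<Rightarrow> complex) \<Rightarrow> (nat \<times> nat) set \<Rightarrow>
     (nat \<times> nat \<Rightarrow> 'k) \<Rightarrow> 'k mat \<Rightarrow> complex" where
  "supercharacter t n F \<theta> D \<phi> =
     (\<lambda>x\<in>carrier (fixed_group t n F). \<Sum>\<mu>\<in>twisted_orbit t n F \<theta> D \<phi>. \<mu> (cayley_inv n x))"

end

theory Submission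
  imports Defs "Jordan_Normal_Form.Schur_Decomposition" "Jordan_Normal_Form.Matrix_Kernel" "HOL-Algebra.Sylow"
begin

text \<open>The group \<open>P = 1 + J\<close> acts on the skew elements \<open>{c \<in> J. \<sigma> c = - c}\<close> by \<open>c \<mapsto> x c \<sigma>(x)\<close>, and dually on
  the \<open>\<sigma>\<close>-invariant characters of \<open>J\<close>. Since every element of \<open>P\<close> has a square root (the order of \<open>P\<close> is
  odd), two skew elements, or two invariant characters, in the same two-sided \<open>P\<close>-orbit are already
  in the same twisted orbit. By the Bruhat decomposition the invariant basic pairs therefore
  parametrise both kinds of twisted orbits, and the Cayley transform carries the former onto the sets
  \<open>K\<^sub>D(\<phi>)\<close>.

  For an invariant character \<open>l\<close> of \<open>J\<close> let \<open>I \<subseteq> J\<close> be a right ideal that is maximal isotropic for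
  \<open>(a, b) \<mapsto> l(a \<sigma>(b))\<close>. A representation of the fixed group on functions on the cosets of \<open>I\<close> has as its trace a
  positive multiple of the orbit sum of \<open>l\<close>; as \<open>J\<close> has prime power order, the comparison of the
  two sizes shows that the orbit sum is an integral multiple of this trace, hence a character.
  Sums over different orbits are orthogonal, and the sum over all orbits vanishes off the identity, which
  forces every irreducible character to occur in exactly one of them.\<close>

section \<open>Characters of finite groups\<close>

text \<open>A single linear character of J, composed with the inverse Cayley transform, is in
  general not multiplicative on the fixed group. The representation that carries the orbit sum
  consists of the functions f on P with f(z + b) = l(h b \<sigma>(z)) f(z) for b in I, where h =
  1/2; the fixed group acts by right translation. Isotropy of I makes this rule consistent, and x
  \<sigma>(x) = 1 makes translation by x respect it. When the orbit sum at x is split along the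
  cosets z + I, a coset contributes nothing unless x fixes it, and then it contributes |I| times the
  phase by which x acts there; the factor 1/2 is what makes that phase agree with the Cayley
  transform. With L the radical of the form, |I|^2 = |J| |L|, while the orbit has at least |I| / |L|
  elements. Hence the stabilizer has order at most |I|. What depends on the matrix group is the
  choice of I. The delicate place is the middle column for odd n in the unitary case, where only a
  half of the scalars may be used.\<close>

lemma representation_mat:
  assumes "group G" and "representation G d \<rho>"
  shows "0 < d"
    and "g \<in> carrier G \<Longrightarrow> \<rho> g \<in> carrier_mat d d"
    and "g \<in> carrier G \<Longrightarrow> h \<in> carrier G \<Longrightarrow> \<rho> (g \<otimes>\<^bsub>G\<^esub> h) = \<rho> g * \<rho> h"
    and "\<rho> \<one>\<^bsub>G\<^esub> = 1\<^sub>m d"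
proof -
  interpret ring "ring_mat TYPE(complex) d ()" by (rule ring_mat)
  have hom: "\<rho> \<in> hom G (units_of (ring_mat TYPE(complex) d ()))"
    using assms(2) by (simp add: representation_def)
  show "0 < d"
    using assms(2) by (simp add: representation_def)
  show "\<rho> g \<in> carrier_mat d d" if "g \<in> carrier G"
    using hom_in_carrier[OF hom that] Units_closed
    by (auto simp: units_of_carrier ring_mat_simps)
  show "\<rho> (g \<otimes>\<^bsub>G\<^esub> h) = \<rho> g * \<rho> h" if "g \<in> carrier G" "h \<in> carrier G"
    using hom_mult[OF hom that] by (simp add: units_of_mult ring_mat_simps)
  have "group_hom G (units_of (ring_mat TYPE(complex) d ())) \<rho>"
    using assms(1) hom units_group by (simp add: group_hom_def group_hom_axioms_def)
  then show "\<rho> \<one>\<^bsub>G\<^esub> = 1\<^sub>m d"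
    using group_hom.hom_one by (fastforce simp: units_of_one ring_mat_simps)
qed

text \<open>Invertibility of \<open>\<rho> g\<close> comes from the other hypotheses: the inverse
  group element gives the inverse matrix.\<close>

lemma representation_matI:
  assumes "group G" and "0 < d"
    and closed: "\<And>g. g \<in> carrier G \<Longrightarrow> \<rho> g \<in> carrier_mat d d"
    and mult: "\<And>g h. g \<in> carrier G \<Longrightarrow> h \<in> carrier G \<Longrightarrow> \<rho> (g \<otimes>\<^bsub>G\<^esub> h) = \<rho> g * \<rho> h"
    and one: "\<rho> \<one>\<^bsub>G\<^esub> = 1\<^sub>m d"
  shows "representation G d \<rho>"
proof -
  interpret G: group G by fact
  interpret ring "ring_mat TYPE(complex) d ()" by (rule ring_mat)
  have "\<rho> g \<in> Units (ring_mat TYPE(complex) d ())" if g: "g \<in> carrier G" for g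
  proof -
    have "\<rho> g * \<rho> (inv\<^bsub>G\<^esub> g) = 1\<^sub>m d" "\<rho> (inv\<^bsub>G\<^esub> g) * \<rho> g = 1\<^sub>m d"
      using mult[of g "inv\<^bsub>G\<^esub> g"] mult[of "inv\<^bsub>G\<^esub> g" g] g one by simp_all
    then show ?thesis
      using closed[OF g] closed[of "inv\<^bsub>G\<^esub> g"] g
      by (auto simp: Units_def ring_mat_simps)
  qed
  then show ?thesis
    using assms(2) mult by (auto simp: representation_def hom_def units_of_carrier units_of_mult ring_mat_simps)
qed

text \<open>A representation on \<open>\<complex>\<^sup>X\<close> for an arbitrary finite index set \<open>X\<close>, given by its matrix entries.\<close>

definition kernel_rep ::
    "('a, 'b) monoid_scheme \<Rightarrow> 'x set \<Rightarrow> ('a \<Rightarrow> 'x \<Rightarrow> 'x \<Rightarrow> complex) \<Rightarrow> bool" where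
  "kernel_rep G X r \<longleftrightarrow>
     finite X \<and> X \<noteq> {} \<and>
     (\<forall>g\<in>carrier G. \<forall>h\<in>carrier G. \<forall>A\<in>X. \<forall>E\<in>X. (\<Sum>B\<in>X. r g A B * r h B E) = r (g \<otimes>\<^bsub>G\<^esub> h) A E) \<and>
     (\<forall>A\<in>X. \<forall>B\<in>X. r \<one>\<^bsub>G\<^esub> A B = (if A = B then 1 else 0))"

lemma kernel_rep_representation:
  assumes "group G" and r: "kernel_rep G X r"
  obtains d f \<rho> where "bij_betw f {..<d} X" and "representation G d \<rho>"
    and "\<And>g. \<rho> g = mat d d (\<lambda>(i, j). r g (f i) (f j))"
proof -
  have fin: "finite X" and ne: "X \<noteq> {}"
    and mult: "\<And>g h A E. \<lbrakk>g \<in> carrier G; h \<in> carrier G; A \<in> X; E \<in> X\<rbrakk> \<Longrightarrow>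
      (\<Sum>B\<in>X. r g A B * r h B E) = r (g \<otimes>\<^bsub>G\<^esub> h) A E"
    and one: "\<And>A B. \<lbrakk>A \<in> X; B \<in> X\<rbrakk> \<Longrightarrow> r \<one>\<^bsub>G\<^esub> A B = (if A = B then 1 else 0)"
    using r by (auto simp: kernel_rep_def)
  obtain f where f: "bij_betw f {..<card X} X"
    using ex_bij_betw_nat_finite[OF fin] by (auto simp: atLeast0LessThan)
  then have fX: "f i \<in> X" if "i < card X" for i
    using that by (auto simp: bij_betw_def)
  have finj: "f i = f j \<longleftrightarrow> i = j" if "i < card X" "j < card X" for i j
    using that f by (auto simp: bij_betw_def inj_on_def)
  define \<rho> where "\<rho> g = mat (card X) (card X) (\<lambda>(i, j). r g (f i) (f j))" for g
  have "\<rho> (g \<otimes>\<^bsub>G\<^esub> h) = \<rho> g * \<rho> h" if g: "g \<in> carrier G" and h: "h \<in> carrier G" for g h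
  proof (rule eq_matI)
    fix i j assume "i < dim_row (\<rho> g * \<rho> h)" "j < dim_col (\<rho> g * \<rho> h)"
    then have i: "i < card X" and j: "j < card X" by (auto simp: \<rho>_def)
    have "(\<rho> g * \<rho> h) $$ (i, j) = (\<Sum>k<card X. r g (f i) (f k) * r h (f k) (f j))"
      using i j by (simp add: \<rho>_def scalar_prod_def atLeast0LessThan)
    also have "\<dots> = (\<Sum>B\<in>X. r g (f i) B * r h B (f j))"
      using sum.reindex_bij_betw[OF f, of "\<lambda>B. r g (f i) B * r h B (f j)"] .
    also have "\<dots> = r (g \<otimes>\<^bsub>G\<^esub> h) (f i) (f j)"
      using mult g h i j fX by simp
    finally show "\<rho> (g \<otimes>\<^bsub>G\<^esub> h) $$ (i, j) = (\<rho> g * \<rho> h) $$ (i, j)"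
      using i j by (simp add: \<rho>_def)
  qed (auto simp: \<rho>_def)
  moreover have "\<rho> \<one>\<^bsub>G\<^esub> = 1\<^sub>m (card X)"
    by (rule eq_matI) (auto simp: \<rho>_def one fX finj)
  moreover have "0 < card X"
    using fin ne by (simp add: card_gt_0_iff)
  ultimately have "representation G (card X) \<rho>"
    using assms(1) by (intro representation_matI) (auto simp: \<rho>_def)
  then show thesis
    using f \<rho>_def that by blast
qed

lemma kernel_rep_character:
  assumes "group G" and "kernel_rep G X r"
  shows "(\<lambda>g\<in>carrier G. \<Sum>A\<in>X. r g A A) \<in> characters G"
proof -
  obtain d f \<rho> where f: "bij_betw f {..<d} X" and rep: "representation G d \<rho>"
    and \<rho>: "\<And>g. \<rho> g = mat d d (\<lambda>(i, j). r g (f i) (f j))"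
    using kernel_rep_representation[OF assms] by metis
  have "character_of G d \<rho> = (\<lambda>g\<in>carrier G. \<Sum>A\<in>X. r g A A)"
    using sum.reindex_bij_betw[OF f, of "\<lambda>A. r g A A" for g] \<rho>
    by (simp add: character_of_def fun_eq_iff restrict_def)
  then show ?thesis
    using rep unfolding characters_def by (metis (mono_tags, lifting) mem_Collect_eq)
qed

lemma representation_kernel_rep:
  assumes "group G" and "representation G d \<rho>"
  shows "kernel_rep G {..<d} (\<lambda>g i j. \<rho> g $$ (i, j))"
proof -
  note \<rho> = representation_mat[OF assms]
  have "(\<Sum>k<d. \<rho> g $$ (i, k) * \<rho> h $$ (k, j)) = \<rho> (g \<otimes>\<^bsub>G\<^esub> h) $$ (i, j)"
    if "g \<in> carrier G" "h \<in> carrier G" "i < d" "j < d" for g h i j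
    using that \<rho>(3)[of g h] \<rho>(2)[of g] \<rho>(2)[of h]
    by (auto simp: scalar_prod_def atLeast0LessThan)
  then show ?thesis
    using \<rho>(1) by (auto simp: kernel_rep_def \<rho>(4) lessThan_empty_iff)
qed

section \<open>Traces of idempotents and averages over the group\<close>

lemma trace_mult_commute:
  fixes A B :: "'c::comm_semiring_0 mat"
  assumes "A \<in> carrier_mat m n" and "B \<in> carrier_mat n m"
  shows "(\<Sum>i<m. (A * B) $$ (i, i)) = (\<Sum>i<n. (B * A) $$ (i, i))"
proof -
  have "(\<Sum>i<m. (A * B) $$ (i, i)) = (\<Sum>i<m. \<Sum>k<n. A $$ (i, k) * B $$ (k, i))"
    using assms by (auto simp: scalar_prod_def atLeast0LessThan intro!: sum.cong)
  also have "\<dots> = (\<Sum>k<n. \<Sum>i<m. B $$ (k, i) * A $$ (i, k))"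
    by (subst sum.swap) (simp add: mult.commute)
  also have "\<dots> = (\<Sum>k<n. (B * A) $$ (k, k))"
    using assms by (auto simp: scalar_prod_def atLeast0LessThan intro!: sum.cong)
  finally show ?thesis .
qed

text \<open>The trace is the sum of the eigenvalues, read off a Schur triangular form, and an
  eigenvalue of an idempotent is 0 or 1; so k is the multiplicity of the eigenvalue 1. A nonzero
  column of A is fixed by A, hence 1 occurs as soon as A is not zero.\<close>

lemma idempotent_trace:
  fixes A :: "complex mat"
  assumes A: "A \<in> carrier_mat n n" and idem: "A * A = A"
  obtains k :: nat where "(\<Sum>i<n. A $$ (i, i)) = of_nat k" and "A \<noteq> 0\<^sub>m n n \<Longrightarrow> 0 < k"
proof -
  obtain es where es: "char_poly A = (\<Prod>a\<leftarrow>es. [:- a, 1:])"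
    using char_poly_factorized[OF A] by blast
  obtain B P Q where "schur_decomposition A es = (B, P, Q)"
    by (cases "schur_decomposition A es")
  then have sim: "similar_mat_wit A B P Q" and ut: "upper_triangular B" and diag: "diag_mat B = es"
    using schur_decomposition[OF A es] by auto
  note w = similar_mat_witD2[OF A sim]
  have "(\<Sum>i<n. A $$ (i, i)) = (\<Sum>i<n. (P * (B * Q)) $$ (i, i))"
    using w by (simp add: assoc_mult_mat[of P n n B n Q n])
  also have "\<dots> = (\<Sum>i<n. ((B * Q) * P) $$ (i, i))"
    using w by (intro trace_mult_commute) auto
  also have "(B * Q) * P = B"
    using w by (simp add: assoc_mult_mat[of B n n Q n P n])
  also have "(\<Sum>i<n. B $$ (i, i)) = sum_list es"
    using w by (simp add: diag[symmetric] diag_mat_def sum_list_sum_nth atLeast0LessThan)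
  finally have tr: "(\<Sum>i<n. A $$ (i, i)) = sum_list es" .
  have ev: "eigenvalue A e \<longleftrightarrow> e \<in> set es" for e
    unfolding eigenvalue_root_char_poly[OF A] es by (induction es) auto
  have sub: "set es \<subseteq> {0, 1}"
  proof
    fix e assume "e \<in> set es"
    then obtain v where v: "v \<in> carrier_vec n" "v \<noteq> 0\<^sub>v n" "A *\<^sub>v v = e \<cdot>\<^sub>v v"
      using ev A unfolding eigenvalue_def eigenvector_def by auto
    have "e \<cdot>\<^sub>v v = (A * A) *\<^sub>v v" using v idem by simp
    also have "\<dots> = A *\<^sub>v (e \<cdot>\<^sub>v v)" using v A by simp
    also have "\<dots> = (e * e) \<cdot>\<^sub>v v" using v A by (simp add: mult_mat_vec[OF A v(1)] smult_smult_assoc)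
    finally have eq: "e \<cdot>\<^sub>v v = (e * e) \<cdot>\<^sub>v v" .
    obtain i where i: "i < n" "v $ i \<noteq> 0"
      using v by (metis carrier_vecD eq_vecI index_zero_vec(1,2))
    have "e * v $ i = e * e * v $ i"
      using arg_cong[OF eq, of "\<lambda>w. w $ i"] i v by simp
    then show "e \<in> {0, 1}" using i by auto
  qed
  then have "sum_list es = of_nat (count_list es 1)"
    by (induction es) auto
  moreover have "0 < count_list es 1" if "A \<noteq> 0\<^sub>m n n"
  proof -
    have "\<exists>i j. i < n \<and> j < n \<and> A $$ (i, j) \<noteq> 0"
      using that A eq_matI[of "0\<^sub>m n n" A] by force
    then obtain i j where ij: "i < n" "j < n" "A $$ (i, j) \<noteq> 0"
      by blast
    define v where "v = A *\<^sub>v unit_vec n j"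
    have "v $ i = A $$ (i, j)"
      using ij A by (simp add: v_def)
    then have "v \<noteq> 0\<^sub>v n" using ij by auto
    moreover have "A *\<^sub>v v = v"
      unfolding v_def using assoc_mult_mat_vec[OF A A unit_vec_carrier[of n j]] idem by simp
    moreover have "v \<in> carrier_vec n" using A by (simp add: v_def)
    ultimately have "eigenvalue A 1"
      using A unfolding eigenvalue_def eigenvector_def by auto
    then have "1 \<in> set es" using ev by simp
    then show ?thesis by (induction es) auto
  qed
  ultimately show thesis using tr that by metis
qed

lemma (in group) sum_translate:
  assumes "x \<in> carrier G"
  shows "(\<Sum>g\<in>carrier G. f (x \<otimes> g)) = (\<Sum>g\<in>carrier G. f g)"
proof -
  have "bij_betw (\<lambda>g. x \<otimes> g) (carrier G) (carrier G)"
    using assms by (intro bij_betw_byWitness[where f' = "\<lambda>g. inv x \<otimes> g"]) (auto simp: m_assoc[symmetric])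
  then show ?thesis by (rule sum.reindex_bij_betw)
qed

text \<open>The average of a representation is the projection onto its fixed vectors.\<close>

lemma kernel_rep_sum:
  fixes G (structure)
  assumes G: "group G" "finite (carrier G)" and r: "kernel_rep G X r"
  obtains k :: nat where "(\<Sum>g\<in>carrier G. \<Sum>A\<in>X. r g A A) = of_nat (card (carrier G) * k)"
    and "\<And>A B. \<lbrakk>A \<in> X; B \<in> X; (\<Sum>g\<in>carrier G. r g A B) \<noteq> 0\<rbrakk> \<Longrightarrow> 0 < k"
proof -
  interpret group G by fact
  let ?N = "of_nat (card (carrier G)) :: complex"
  have N: "?N \<noteq> 0" using G(2) by (auto simp: card_eq_0_iff)
  obtain d f \<rho> where f: "bij_betw f {..<d} X" and rep: "representation G d \<rho>"
    and \<rho>: "\<And>g. \<rho> g = mat d d (\<lambda>(i, j). r g (f i) (f j))"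
    using kernel_rep_representation[OF G(1) r] by metis
  have mult: "(\<Sum>k<d. \<rho> g $$ (i, k) * \<rho> h $$ (k, j)) = \<rho> (g \<otimes> h) $$ (i, j)"
    if "g \<in> carrier G" "h \<in> carrier G" "i < d" "j < d" for g h i j
    using representation_kernel_rep[OF G(1) rep] that by (auto simp: kernel_rep_def)
  define E where "E = mat d d (\<lambda>ij. (\<Sum>g\<in>carrier G. \<rho> g $$ ij) / ?N)"
  have "E * E = E"
  proof (rule eq_matI)
    fix i j assume "i < dim_row E" "j < dim_col E"
    then have ij: "i < d" "j < d" by (auto simp: E_def)
    have "(E * E) $$ (i, j) =
      (\<Sum>k<d. (\<Sum>g\<in>carrier G. \<rho> g $$ (i, k)) / ?N * ((\<Sum>h\<in>carrier G. \<rho> h $$ (k, j)) / ?N))"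
      using ij by (simp add: E_def scalar_prod_def atLeast0LessThan)
    also have "\<dots> = (\<Sum>k<d. \<Sum>g\<in>carrier G. \<Sum>h\<in>carrier G. \<rho> g $$ (i, k) * \<rho> h $$ (k, j)) / ?N / ?N"
      by (simp add: sum_product sum_divide_distrib)
    also have "(\<Sum>k<d. \<Sum>g\<in>carrier G. \<Sum>h\<in>carrier G. \<rho> g $$ (i, k) * \<rho> h $$ (k, j)) =
      (\<Sum>g\<in>carrier G. \<Sum>h\<in>carrier G. \<Sum>k<d. \<rho> g $$ (i, k) * \<rho> h $$ (k, j))"
      by (subst sum.swap, intro sum.cong refl, subst sum.swap) simp
    also have "\<dots> = (\<Sum>g\<in>carrier G. \<Sum>h\<in>carrier G. \<rho> (g \<otimes> h) $$ (i, j))"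
      using ij by (intro sum.cong refl mult) auto
    \<comment> \<open>For each g, translation by g permutes the group, so the sum over g only
      contributes the factor |G|.\<close>
    also have "\<dots> = (\<Sum>g\<in>carrier G. \<Sum>h\<in>carrier G. \<rho> h $$ (i, j))"
      by (intro sum.cong refl sum_translate) auto
    also have "\<dots> / ?N / ?N = E $$ (i, j)"
      using ij N by (simp add: E_def)
    finally show "(E * E) $$ (i, j) = E $$ (i, j)" .
  qed (auto simp: E_def)
  moreover have Ec: "E \<in> carrier_mat d d" by (simp add: E_def)
  ultimately obtain k where k: "(\<Sum>i<d. E $$ (i, i)) = of_nat k" "E \<noteq> 0\<^sub>m d d \<Longrightarrow> 0 < k"
    using idempotent_trace by metis
  have "(\<Sum>g\<in>carrier G. \<Sum>A\<in>X. r g A A) = (\<Sum>g\<in>carrier G. \<Sum>i<d. \<rho> g $$ (i, i))"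
    using sum.reindex_bij_betw[OF f, of "\<lambda>A. r g A A" for g] by (simp add: \<rho>)
  also have "\<dots> = ?N * (\<Sum>i<d. E $$ (i, i))"
    using N by (subst sum.swap) (simp add: E_def sum_divide_distrib[symmetric])
  finally have 1: "(\<Sum>g\<in>carrier G. \<Sum>A\<in>X. r g A A) = of_nat (card (carrier G) * k)"
    using k by simp
  have 2: "0 < k" if AB: "A \<in> X" "B \<in> X" "(\<Sum>g\<in>carrier G. r g A B) \<noteq> 0" for A B
  proof -
    obtain i j where ij: "i < d" "j < d" "f i = A" "f j = B"
      using AB f by (auto simp: bij_betw_def)
    then have "E $$ (i, j) \<noteq> 0"
      using AB N by (simp add: E_def \<rho>)
    then have "E \<noteq> 0\<^sub>m d d" using ij by auto
    then show ?thesis using k by blast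
  qed
  show thesis using that[OF 1 2] .
qed

text \<open>The second factor is the contragredient of s: the inverse group element together with
  exchanged indices. The trace at g is the product of the trace of r at g and that of s at the
  inverse of g, so that averaging computes pairings of characters.\<close>

lemma kernel_rep_tensor_dual:
  fixes G (structure)
  assumes G: "group G" and r: "kernel_rep G X r" and s: "kernel_rep G Y s"
  shows "kernel_rep G (X \<times> Y) (\<lambda>g (i, j) (k, l). r g i k * s (inv\<^bsub>G\<^esub> g) l j)"
proof -
  interpret group G by fact
  have r1: "(\<Sum>B\<in>X. r g A B * r h B E) = r (g \<otimes> h) A E"
    if "g \<in> carrier G" "h \<in> carrier G" "A \<in> X" "E \<in> X" for g h A E
    using r that unfolding kernel_rep_def by blast
  have s1: "(\<Sum>B\<in>Y. s g A B * s h B E) = s (g \<otimes> h) A E"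
    if "g \<in> carrier G" "h \<in> carrier G" "A \<in> Y" "E \<in> Y" for g h A E
    using s that unfolding kernel_rep_def by blast
  have "(\<Sum>(k, l)\<in>X \<times> Y. (r g i k * s (inv g) l j) * (r h k m * s (inv h) n l)) =
      r (g \<otimes> h) i m * s (inv (g \<otimes> h)) n j"
    if "g \<in> carrier G" "h \<in> carrier G" "i \<in> X" "j \<in> Y" "m \<in> X" "n \<in> Y" for g h i j m n
  proof -
    have "(\<Sum>(k, l)\<in>X \<times> Y. (r g i k * s (inv g) l j) * (r h k m * s (inv h) n l)) =
      (\<Sum>k\<in>X. r g i k * r h k m) * (\<Sum>l\<in>Y. s (inv h) n l * s (inv g) l j)"
      unfolding sum_product sum.cartesian_product by (intro sum.cong refl) (auto simp: mult_ac)
    also have "\<dots> = r (g \<otimes> h) i m * s (inv h \<otimes> inv g) n j"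
      using that by (simp only: r1 s1 inv_closed)
    finally show ?thesis
      using that by (simp only: inv_mult_group)
  qed
  note mult = this
  show ?thesis
    unfolding kernel_rep_def
  proof (intro conjI ballI)
    show "finite (X \<times> Y)" "X \<times> Y \<noteq> {}" using r s by (auto simp: kernel_rep_def)
  next
    fix g h A E assume "g \<in> carrier G" "h \<in> carrier G" "A \<in> X \<times> Y" "E \<in> X \<times> Y"
    then show "(\<Sum>B\<in>X \<times> Y. (case A of (i, j) \<Rightarrow> \<lambda>(k, l). r g i k * s (inv g) l j) B *
        (case B of (i, j) \<Rightarrow> \<lambda>(k, l). r h i k * s (inv h) l j) E) =
      (case A of (i, j) \<Rightarrow> \<lambda>(k, l). r (g \<otimes> h) i k * s (inv (g \<otimes> h)) l j) E"
      using mult[of g h "fst A" "snd A" "fst E" "snd E"] by (auto simp: case_prod_unfold)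
  next
    fix A B assume "A \<in> X \<times> Y" "B \<in> X \<times> Y"
    moreover have "r \<one> i k = (if i = k then 1 else 0)" if "i \<in> X" "k \<in> X" for i k
      using r that unfolding kernel_rep_def by blast
    moreover have "s \<one> j l = (if j = l then 1 else 0)" if "j \<in> Y" "l \<in> Y" for j l
      using s that unfolding kernel_rep_def by blast
    ultimately show "(case A of (i, j) \<Rightarrow> \<lambda>(k, l). r \<one> i k * s (inv \<one>) l j) B = (if A = B then 1 else 0)"
      by (auto split: if_splits)
  qed
qed

text \<open>For characters of a finite group this is |G| times the usual inner product: the value of
  \<psi> at the inverse is the complex conjugate.\<close>

definition char_inner :: "('a, 'b) monoid_scheme \<Rightarrow> ('a \<Rightarrow> complex) \<Rightarrow> ('a \<Rightarrow> complex) \<Rightarrow> complex" where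
  "char_inner G \<chi> \<psi> = (\<Sum>g\<in>carrier G. \<chi> g * \<psi> (inv\<^bsub>G\<^esub> g))"

lemma char_inner_kernel_rep:
  fixes G (structure)
  assumes G: "group G" "finite (carrier G)" and r: "kernel_rep G X r" and s: "kernel_rep G Y s"
  shows "char_inner G (\<lambda>g\<in>carrier G. \<Sum>A\<in>X. r g A A) (\<lambda>g\<in>carrier G. \<Sum>A\<in>Y. s g A A) =
    (\<Sum>g\<in>carrier G. \<Sum>A\<in>X \<times> Y. (\<lambda>(i, j) (k, l). r g i k * s (inv\<^bsub>G\<^esub> g) l j) A A)"
proof -
  interpret group G by fact
  show ?thesis
    unfolding char_inner_def
    by (intro sum.cong refl)
      (simp add: sum_product sum.cartesian_product' case_prod_unfold)
qed

lemma characters_kernel_rep: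
  assumes "group G" and "\<chi> \<in> characters G"
  obtains d \<rho> where "representation G d \<rho>" and "kernel_rep G {..<d} (\<lambda>g i j. \<rho> g $$ (i, j))"
    and "\<chi> = (\<lambda>g\<in>carrier G. \<Sum>i<d. \<rho> g $$ (i, i))"
proof -
  obtain d \<rho> where "\<chi> = character_of G d \<rho>" "representation G d \<rho>"
    using assms(2) unfolding characters_def by auto
  then show thesis
    using that[of d \<rho>] representation_kernel_rep[OF assms(1)] by (simp add: character_of_def)
qed

text \<open>Up to the factor |G| the value is the trace of the averaged product with the dual, which
  is a projection; so it is a natural number.\<close>

lemma char_inner_nonneg:
  assumes G: "group G" "finite (carrier G)" and "\<chi> \<in> characters G" "\<psi> \<in> characters G"
  shows "0 \<le> Re (char_inner G \<chi> \<psi>)"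
proof -
  obtain d \<rho> where "representation G d \<rho>" and \<rho>: "kernel_rep G {..<d} (\<lambda>g i j. \<rho> g $$ (i, j))"
      "\<chi> = (\<lambda>g\<in>carrier G. \<Sum>i<d. \<rho> g $$ (i, i))"
    by (rule characters_kernel_rep[OF G(1) assms(3)])
  obtain e \<tau> where "representation G e \<tau>" and \<tau>: "kernel_rep G {..<e} (\<lambda>g i j. \<tau> g $$ (i, j))"
      "\<psi> = (\<lambda>g\<in>carrier G. \<Sum>i<e. \<tau> g $$ (i, i))"
    by (rule characters_kernel_rep[OF G(1) assms(4)])
  have "\<exists>k :: nat. char_inner G \<chi> \<psi> = of_nat (card (carrier G) * k)"
    unfolding \<rho>(2) \<tau>(2) char_inner_kernel_rep[OF G \<rho>(1) \<tau>(1)]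
    by (rule kernel_rep_sum[OF G kernel_rep_tensor_dual[OF G(1) \<rho>(1) \<tau>(1)]], rule exI)
  then show ?thesis by auto
qed

text \<open>The identity matrix is a fixed vector of the representation on d by d matrices, so the
  averaged projection does not vanish.\<close>

lemma char_inner_self_pos:
  fixes G (structure)
  assumes G: "group G" "finite (carrier G)" and "\<chi> \<in> characters G"
  shows "0 < Re (char_inner G \<chi> \<chi>)"
proof -
  interpret group G by fact
  obtain d \<rho> where rep: "representation G d \<rho>" and \<rho>: "kernel_rep G {..<d} (\<lambda>g i j. \<rho> g $$ (i, j))"
      "\<chi> = (\<lambda>g\<in>carrier G. \<Sum>i<d. \<rho> g $$ (i, i))"
    by (rule characters_kernel_rep[OF G(1) assms(3)])
  have d: "0 < d" using rep by (simp add: representation_def)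
  let ?r = "\<lambda>g (i, j) (k, l). \<rho> g $$ (i, k) * \<rho> (inv g) $$ (l, j)"
  obtain k :: nat where k: "(\<Sum>g\<in>carrier G. \<Sum>A\<in>{..<d} \<times> {..<d}. ?r g A A) = of_nat (card (carrier G) * k)"
      "\<And>A B. \<lbrakk>A \<in> {..<d} \<times> {..<d}; B \<in> {..<d} \<times> {..<d}; (\<Sum>g\<in>carrier G. ?r g A B) \<noteq> 0\<rbrakk> \<Longrightarrow> 0 < k"
    by (rule kernel_rep_sum[OF G kernel_rep_tensor_dual[OF G(1) \<rho>(1) \<rho>(1)]], rule that)
  \<comment> \<open>Row (0, 0) of the operator, applied to the identity matrix. Every g contributes
    the entry (0, 0) of \<rho>(g) \<rho>(inv g), which is 1.\<close>
  have "(\<Sum>l<d. \<Sum>g\<in>carrier G. ?r g (0, 0) (l, l)) =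
    (\<Sum>g\<in>carrier G. \<Sum>l<d. \<rho> g $$ (0, l) * \<rho> (inv g) $$ (l, 0))"
    by (subst sum.swap) simp
  also have "\<dots> = (\<Sum>g\<in>carrier G. 1)"
    using \<rho>(1) d by (intro sum.cong refl) (auto simp: kernel_rep_def)
  also have "\<dots> \<noteq> 0" using G(2) by (auto simp: card_eq_0_iff)
  finally obtain l where "l < d" "(\<Sum>g\<in>carrier G. ?r g (0, 0) (l, l)) \<noteq> 0"
    by (metis (no_types, lifting) sum.not_neutral_contains_not_neutral lessThan_iff)
  then have "0 < k" using k(2)[of "(0, 0)" "(l, l)"] d by simp
  moreover have "0 < card (carrier G)" using G(2) by (auto simp: card_gt_0_iff)
  moreover have "char_inner G \<chi> \<chi> = of_nat (card (carrier G) * k)"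
    using char_inner_kernel_rep[OF G \<rho>(1) \<rho>(1)] k(1) \<rho>(2) by simp
  ultimately show ?thesis by simp
qed

lemma char_inner_add:
  fixes G (structure)
  assumes "group G" and "\<And>g. g \<in> carrier G \<Longrightarrow> \<chi> g = \<chi>\<^sub>1 g + \<chi>\<^sub>2 g"
    and "\<And>g. g \<in> carrier G \<Longrightarrow> \<psi> g = \<psi>\<^sub>1 g + \<psi>\<^sub>2 g"
  shows "char_inner G \<chi> \<psi> = char_inner G \<chi>\<^sub>1 \<psi>\<^sub>1 + char_inner G \<chi>\<^sub>1 \<psi>\<^sub>2 + char_inner G \<chi>\<^sub>2 \<psi>\<^sub>1 + char_inner G \<chi>\<^sub>2 \<psi>\<^sub>2"
proof -
  interpret group G by fact
  have "char_inner G \<chi> \<psi> = (\<Sum>g\<in>carrier G. (\<chi>\<^sub>1 g + \<chi>\<^sub>2 g) * (\<psi>\<^sub>1 (inv g) + \<psi>\<^sub>2 (inv g)))"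
    unfolding char_inner_def by (intro sum.cong refl) (simp add: assms)
  then show ?thesis
    by (simp add: char_inner_def algebra_simps sum.distrib)
qed

text \<open>What remains of each character after removing \<psi> is a character or the zero
  function. Bilinear expansion leaves the positive pairing of \<psi> with itself and three
  nonnegative terms.\<close>

lemma common_constituent_inner:
  assumes G: "group G" "finite (carrier G)"
    and "constituent G \<psi> \<chi>\<^sub>1" and "constituent G \<psi> \<chi>\<^sub>2"
  shows "char_inner G \<chi>\<^sub>1 \<chi>\<^sub>2 \<noteq> 0"
proof -
  have \<psi>: "\<psi> \<in> characters G" using assms by (simp add: constituent_def)
  obtain \<chi>' where 1: "\<And>g. g \<in> carrier G \<Longrightarrow> \<chi>\<^sub>1 g = \<psi> g + \<chi>' g" "\<chi>' = (\<lambda>_. 0) \<or> \<chi>' \<in> characters G"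
    using assms(3) unfolding constituent_def by (metis add.right_neutral)
  obtain \<chi>'' where 2: "\<And>g. g \<in> carrier G \<Longrightarrow> \<chi>\<^sub>2 g = \<psi> g + \<chi>'' g" "\<chi>'' = (\<lambda>_. 0) \<or> \<chi>'' \<in> characters G"
    using assms(4) unfolding constituent_def by (metis add.right_neutral)
  have nonneg: "0 \<le> Re (char_inner G \<alpha> \<beta>)"
    if "\<alpha> = (\<lambda>_. 0) \<or> \<alpha> \<in> characters G" "\<beta> = (\<lambda>_. 0) \<or> \<beta> \<in> characters G" for \<alpha> \<beta>
    using that char_inner_nonneg[OF G] by (auto simp: char_inner_def)
  have "char_inner G \<chi>\<^sub>1 \<chi>\<^sub>2 = char_inner G \<psi> \<psi> + char_inner G \<psi> \<chi>'' + char_inner G \<chi>' \<psi> + char_inner G \<chi>' \<chi>''"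
    using char_inner_add[OF G(1) 1(1) 2(1)] .
  then have "0 < Re (char_inner G \<chi>\<^sub>1 \<chi>\<^sub>2)"
    using char_inner_self_pos[OF G \<psi>] nonneg[of \<psi> \<chi>''] nonneg[of \<chi>' \<psi>] nonneg[of \<chi>' \<chi>''] 1(2) 2(2) \<psi>
    by simp
  then show ?thesis by auto
qed

section \<open>Constituents from intertwining matrices\<close>

lemma mat_kernel_subspace:
  fixes A :: "'f::field mat"
  assumes "A \<in> carrier_mat nr nc"
  shows "VectorSpace.subspace class_ring (mat_kernel A) (module_vec TYPE('f) nc)"
proof -
  interpret vec_space "TYPE('f)" nc .
  have "submodule class_ring (mat_kernel A) (module_vec TYPE('f) nc)"
    using assms
    by unfold_locales
      (auto simp: mat_kernel[OF assms] mult_add_distrib_mat_vec[OF assms] mult_mat_vec[OF assms] module_vec_simps)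
  then show ?thesis
    using vectorspace_axioms by (simp add: VectorSpace.subspace_def)
qed

text \<open>A column without pivot in the row echelon form would produce a nonzero kernel vector, so
  all d columns carry pivots. As pivots move strictly to the right, the pivot of row j sits in
  column j.\<close>

lemma injective_mat_reduce:
  fixes T :: "'f::field mat"
  assumes T: "T \<in> carrier_mat e d" and inj: "mat_kernel T = {0\<^sub>v d}"
  obtains P Q where "d \<le> e" "P \<in> carrier_mat e e" "Q \<in> carrier_mat e e"
    "P * Q = 1\<^sub>m e" "Q * P = 1\<^sub>m e" "P * T = mat e d (\<lambda>(i, j). if i = j then 1 else 0)"
proof -
  define C where "C = gauss_jordan_single T"
  note gj = gauss_jordan_single[OF T C_def[symmetric]]
  have C: "C \<in> carrier_mat e d" and dim: "dim_row C = e" using gj by auto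
  obtain P Q where PQ: "C = P * T" "P \<in> carrier_mat e e" "Q \<in> carrier_mat e e"
    "P * Q = 1\<^sub>m e" "Q * P = 1\<^sub>m e" using gj(4) by blast
  obtain f where f: "pivot_fun C f d"
    using gj(3) C unfolding row_echelon_form_def by auto
  note piv = pivot_funD[OF dim f]
  have all: "snd ` set (pivot_positions C) = {0..<d}"
  proof (rule ccontr)
    assume *: "snd ` set (pivot_positions C) \<noteq> {0..<d}"
    note v = find_base_vector[OF gj(3) C *]
    have "find_base_vector C \<in> mat_kernel T"
      using v gj(1)[OF v(1)] T by (intro mat_kernelI) auto
    then show False using inj v by auto
  qed
  have onto: "\<exists>i<e. f i = j" if "j < d" for j
  proof -
    have "j \<in> snd ` set (pivot_positions C)" using that all by auto
    then show ?thesis using pivot_positions(1)[OF C f] by auto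
  qed
  have lt: "f i < f i' \<or> f i' = d" if "i < i'" "i' < e" for i i'
    using that
  proof (induction i')
    case (Suc k)
    show ?case
    proof (cases "i = k")
      case True
      then show ?thesis using piv(3)[of k] Suc.prems by auto
    next
      case False
      then have "f i < f k \<or> f k = d" using Suc by auto
      moreover have "f (Suc k) > f k \<or> f (Suc k) = d" using piv(3)[of k] Suc.prems by auto
      moreover have "f (Suc k) \<le> d" using piv(1) Suc.prems by auto
      ultimately show ?thesis by auto
    qed
  qed simp
  have fj: "j < e \<and> f j = j" if "j < d" for j
    using that
  proof (induction j rule: less_induct)
    case (less j)
    obtain i where i: "i < e" "f i = j" using onto less.prems by blast
    have "\<not> i < j" using less.IH[of i] less.prems i by auto
    moreover have "\<not> j < i"
    proof
      assume "j < i"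
      then have "f j < j" using lt[of j i] i less.prems by auto
      moreover have "f (f j) = f j" using less.IH[of "f j"] calculation less.prems by auto
      ultimately show False using lt[of "f j" j] \<open>j < i\<close> i less.prems by auto
    qed
    ultimately show ?case using i by auto
  qed
  have "C $$ (i, j) = (if i = j then 1 else 0)" if "i < e" "j < d" for i j
    using piv(4)[of j] piv(5)[of j i] fj[OF that(2)] that by auto
  then have "C = mat e d (\<lambda>(i, j). if i = j then 1 else 0)"
    using C by (intro eq_matI) auto
  moreover have "d \<le> e"
    using fj[of "d - 1"] by (cases d) auto
  ultimately show thesis using that PQ by metis
qed

text \<open>A nonzero pairing yields a nonzero intertwining matrix T. Its kernel is invariant, hence
  zero by irreducibility, and a change of basis turns T into the inclusion of the first d
  coordinates. Then \<tau> is block triangular with \<rho> as upper left block and a quotient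
  representation as lower right block, and the traces add.\<close>

lemma irreducible_constituent:
  fixes G (structure)
  assumes G: "group G" "finite (carrier G)"
    and irr: "irreducible_representation G d \<rho>" and \<chi>: "\<chi> \<in> characters G"
    and inner: "char_inner G \<chi> (character_of G d \<rho>) \<noteq> 0"
  shows "constituent G (character_of G d \<rho>) \<chi>"
proof -
  interpret group G by fact
  have rep: "representation G d \<rho>" using irr by (simp add: irreducible_representation_def)
  obtain e \<tau> where rep': "representation G e \<tau>" and \<chi>_def: "\<chi> = character_of G e \<tau>"
    using \<chi> by (auto simp: characters_def)
  note \<rho> = representation_mat[OF G(1) rep] and \<tau> = representation_mat[OF G(1) rep']
  have \<rho>m: "(\<Sum>k<d. \<rho> g $$ (i, k) * \<rho> h $$ (k, j)) = \<rho> (g \<otimes> h) $$ (i, j)"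
    if "g \<in> carrier G" "h \<in> carrier G" "i < d" "j < d" for g h i j
    using representation_kernel_rep[OF G(1) rep] that by (auto simp: kernel_rep_def)
  have \<tau>m: "(\<Sum>k<e. \<tau> g $$ (i, k) * \<tau> h $$ (k, j)) = \<tau> (g \<otimes> h) $$ (i, j)"
    if "g \<in> carrier G" "h \<in> carrier G" "i < e" "j < e" for g h i j
    using representation_kernel_rep[OF G(1) rep'] that by (auto simp: kernel_rep_def)
  have "char_inner G \<chi> (character_of G d \<rho>) =
    (\<Sum>g\<in>carrier G. \<Sum>a<e. \<Sum>b<d. \<tau> g $$ (a, a) * \<rho> (inv g) $$ (b, b))"
    unfolding char_inner_def \<chi>_def character_of_def
    by (intro sum.cong refl) (simp add: sum_product)
  also have "\<dots> = (\<Sum>a<e. \<Sum>b<d. \<Sum>g\<in>carrier G. \<tau> g $$ (a, a) * \<rho> (inv g) $$ (b, b))"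
    by (subst sum.swap, intro sum.cong refl, subst sum.swap) simp
  finally obtain a b where ab: "a < e" "b < d" "(\<Sum>g\<in>carrier G. \<tau> g $$ (a, a) * \<rho> (inv g) $$ (b, b)) \<noteq> 0"
    using inner by (metis (no_types, lifting) sum.not_neutral_contains_not_neutral lessThan_iff)
  \<comment> \<open>T is the sum of \<tau>(g) E \<rho>(inv g) with E the matrix unit at (a, b). The
    indices are chosen so that the entry (a, b) of T survives.\<close>
  define T where "T = mat e d (\<lambda>(i, j). \<Sum>g\<in>carrier G. \<tau> g $$ (i, a) * \<rho> (inv g) $$ (b, j))"
  have T: "T \<in> carrier_mat e d" by (simp add: T_def)
  have inter: "\<tau> h * T = T * \<rho> h" if h: "h \<in> carrier G" for h
  proof (rule eq_matI)
    fix i j assume "i < dim_row (T * \<rho> h)" "j < dim_col (T * \<rho> h)"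
    then have ij: "i < e" "j < d" using T \<rho>(2)[OF h] by auto
    have "(\<tau> h * T) $$ (i, j) = (\<Sum>k<e. \<tau> h $$ (i, k) * (\<Sum>g\<in>carrier G. \<tau> g $$ (k, a) * \<rho> (inv g) $$ (b, j)))"
      using ij \<tau>(2)[OF h] by (simp add: T_def scalar_prod_def atLeast0LessThan)
    also have "\<dots> = (\<Sum>g\<in>carrier G. (\<Sum>k<e. \<tau> h $$ (i, k) * \<tau> g $$ (k, a)) * \<rho> (inv g) $$ (b, j))"
      by (simp add: sum_distrib_left sum_distrib_right mult.assoc) (rule sum.swap)
    also have "\<dots> = (\<Sum>g\<in>carrier G. \<tau> (h \<otimes> g) $$ (i, a) * \<rho> (inv g) $$ (b, j))"
      using ij ab h by (intro sum.cong refl) (simp add: \<tau>m)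
    \<comment> \<open>Rewriting inv g as inv (h g) h makes the summand a function of h g, ready for
      translation.\<close>
    also have "\<dots> = (\<Sum>g\<in>carrier G. \<tau> (h \<otimes> g) $$ (i, a) * \<rho> (inv (h \<otimes> g) \<otimes> h) $$ (b, j))"
      using h by (intro sum.cong refl) (simp add: inv_mult_group m_assoc)
    also have "\<dots> = (\<Sum>g\<in>carrier G. \<tau> g $$ (i, a) * \<rho> (inv g \<otimes> h) $$ (b, j))"
      using sum_translate[OF h, of "\<lambda>g. \<tau> g $$ (i, a) * \<rho> (inv g \<otimes> h) $$ (b, j)"] .
    also have "\<dots> = (\<Sum>g\<in>carrier G. \<tau> g $$ (i, a) * (\<Sum>k<d. \<rho> (inv g) $$ (b, k) * \<rho> h $$ (k, j)))"
      using ij ab h by (intro sum.cong refl) (simp add: \<rho>m)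
    also have "\<dots> = (\<Sum>k<d. (\<Sum>g\<in>carrier G. \<tau> g $$ (i, a) * \<rho> (inv g) $$ (b, k)) * \<rho> h $$ (k, j))"
      by (simp add: sum_distrib_left sum_distrib_right mult.assoc) (rule sum.swap)
    also have "\<dots> = (T * \<rho> h) $$ (i, j)"
      using ij \<rho>(2)[OF h] by (simp add: T_def scalar_prod_def atLeast0LessThan)
    finally show "(\<tau> h * T) $$ (i, j) = (T * \<rho> h) $$ (i, j)" .
  qed (use T \<rho>(2)[OF h] \<tau>(2)[OF h] in auto)
  have inv: "\<rho> g *\<^sub>v w \<in> mat_kernel T" if g: "g \<in> carrier G" and w: "w \<in> mat_kernel T" for g w
  proof -
    note w' = mat_kernelD[OF T w]
    have "T *\<^sub>v (\<rho> g *\<^sub>v w) = (T * \<rho> g) *\<^sub>v w"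
      using w' T \<rho>(2)[OF g] by simp
    also have "\<dots> = \<tau> g *\<^sub>v (T *\<^sub>v w)"
      using w' T \<tau>(2)[OF g] by (simp add: inter[OF g, symmetric])
    also have "\<dots> = 0\<^sub>v e" using w' \<tau>(2)[OF g] by (intro eq_vecI) auto
    finally show ?thesis using w' \<rho>(2)[OF g] T by (intro mat_kernelI) auto
  qed
  have "T $$ (a, b) \<noteq> 0" using ab by (simp add: T_def)
  moreover have "(T *\<^sub>v unit_vec d b) $ a = T $$ (a, b)"
    using ab T by simp
  ultimately have "T *\<^sub>v unit_vec d b \<noteq> 0\<^sub>v e"
    using ab(1) by auto
  then have "mat_kernel T \<noteq> carrier_vec d"
    using mat_kernelD(2)[OF T, of "unit_vec d b"] by auto
  moreover have "mat_kernel T = {0\<^sub>v d} \<or> mat_kernel T = carrier_vec d"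
    using irr mat_kernel_subspace[OF T] inv unfolding irreducible_representation_def by simp
  ultimately have ker: "mat_kernel T = {0\<^sub>v d}"
    by simp
  obtain P Q where de: "d \<le> e" and PQ: "P \<in> carrier_mat e e" "Q \<in> carrier_mat e e"
    "P * Q = 1\<^sub>m e" "Q * P = 1\<^sub>m e" and PT: "P * T = mat e d (\<lambda>(i, j). if i = j then 1 else 0)"
    using injective_mat_reduce[OF T ker] by metis
  define N where "N g = P * \<tau> g * Q" for g
  have Nc: "N g \<in> carrier_mat e e" if "g \<in> carrier G" for g
    using PQ \<tau>(2)[OF that] by (simp add: N_def)
  have Nm: "N (g \<otimes> h) = N g * N h" if g: "g \<in> carrier G" and h: "h \<in> carrier G" for g h
  proof -
    note c = PQ(1,2) \<tau>(2)[OF g] \<tau>(2)[OF h]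
    have "N g * N h = P * \<tau> g * (Q * (P * \<tau> h * Q))"
      unfolding N_def using c by (intro assoc_mult_mat[of _ e e _ e]) auto
    also have "Q * (P * \<tau> h * Q) = (Q * P) * (\<tau> h * Q)"
      using c by (simp add: assoc_mult_mat[of P e e "\<tau> h" e Q e] assoc_mult_mat[of Q e e P e "\<tau> h * Q" e])
    also have "\<dots> = \<tau> h * Q" using c PQ by simp
    finally show ?thesis
      using c g h by (simp add: N_def \<tau>(3) assoc_mult_mat[of _ e e _ e _ e])
  qed
  have N1: "N \<one> = 1\<^sub>m e" using PQ \<tau>(4) by (simp add: N_def)
  have Ntr: "(\<Sum>i<e. N g $$ (i, i)) = (\<Sum>i<e. \<tau> g $$ (i, i))" if g: "g \<in> carrier G" for g
  proof -
    note c = PQ(1,2) \<tau>(2)[OF g]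
    have "(\<Sum>i<e. N g $$ (i, i)) = (\<Sum>i<e. (Q * (P * \<tau> g)) $$ (i, i))"
      unfolding N_def using c by (intro trace_mult_commute) auto
    also have "Q * (P * \<tau> g) = \<tau> g"
      using c PQ by (simp add: assoc_mult_mat[of Q e e P e "\<tau> g" e, symmetric])
    finally show ?thesis .
  qed
  \<comment> \<open>The block shape: N g (P T) = (P T) \<rho>(g), where P T selects the first d
    columns when multiplied from the right and appends zero rows when multiplied from the
    left.\<close>
  have Nj: "N g $$ (i, j) = (if i < d then \<rho> g $$ (i, j) else 0)"
    if g: "g \<in> carrier G" and ij: "i < e" "j < d" for g i j
  proof -
    note c = PQ(1,2) \<tau>(2)[OF g] \<rho>(2)[OF g] T
    have "N g * (P * T) = P * \<tau> g * (Q * (P * T))"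
      unfolding N_def using c by (intro assoc_mult_mat[of _ e e _ e _ d]) auto
    also have "Q * (P * T) = Q * P * T"
      using c by (intro assoc_mult_mat[symmetric, of _ e e _ e _ d]) auto
    also have "\<dots> = T" using c PQ by simp
    also have "P * \<tau> g * T = P * (\<tau> g * T)"
      using c by (intro assoc_mult_mat[of _ e e _ e _ d]) auto
    also have "\<dots> = P * T * \<rho> g"
      unfolding inter[OF g] using c by (intro assoc_mult_mat[symmetric, of _ e e _ d _ d]) auto
    finally have eq: "N g * (P * T) = P * T * \<rho> g" .
    have "(N g * (P * T)) $$ (i, j) = (\<Sum>k<e. N g $$ (i, k) * (if k = j then 1 else 0))"
      using ij Nc[OF g] by (simp add: PT scalar_prod_def atLeast0LessThan)
    also have "\<dots> = N g $$ (i, j)"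
      using ij de by (simp add: if_distrib[of "(*) _"] sum.delta cong: if_cong)
    finally have 1: "(N g * (P * T)) $$ (i, j) = N g $$ (i, j)" .
    have "(P * T * \<rho> g) $$ (i, j) = (\<Sum>k<d. (if i = k then 1 else 0) * \<rho> g $$ (k, j))"
      using ij \<rho>(2)[OF g] by (simp add: PT scalar_prod_def atLeast0LessThan)
    also have "\<dots> = (if i < d then \<rho> g $$ (i, j) else 0)"
      by (simp add: if_distrib[of "\<lambda>x. x * _"] sum.delta' cong: if_cong)
    finally show ?thesis using eq 1 by simp
  qed
  have split: "(\<Sum>i<e. f i) = (\<Sum>i<d. f i) + (\<Sum>i\<in>{d..<e}. f i)" for f :: "nat \<Rightarrow> complex"
    using sum.atLeastLessThan_concat[of 0 d e f] de by (simp add: atLeast0LessThan)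
  have dec: "\<chi> g = character_of G d \<rho> g + (\<Sum>i\<in>{d..<e}. N g $$ (i, i))" if g: "g \<in> carrier G" for g
    using Ntr[OF g] split[of "\<lambda>i. N g $$ (i, i)"] Nj[OF g] de g
    by (simp add: \<chi>_def character_of_def)
  have \<psi>: "character_of G d \<rho> \<in> characters G"
    using rep by (auto simp: characters_def)
  show ?thesis
  proof (cases "d = e")
    case True
    then have "\<chi> = character_of G d \<rho>"
      using dec by (auto simp: \<chi>_def character_of_def fun_eq_iff restrict_def)
    then show ?thesis using \<psi> by (simp add: constituent_def)
  next
    case False
    \<comment> \<open>The lower left block is zero, so the indices below d drop out and the lower
      right blocks multiply among themselves.\<close>
    have "(\<Sum>B\<in>{d..<e}. N g $$ (i, B) * N h $$ (B, j)) = N (g \<otimes> h) $$ (i, j)"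
      if g: "g \<in> carrier G" and h: "h \<in> carrier G" and ij: "i \<in> {d..<e}" "j \<in> {d..<e}" for g h i j
    proof -
      have "N (g \<otimes> h) $$ (i, j) = (\<Sum>k<e. N g $$ (i, k) * N h $$ (k, j))"
        using Nc[OF g] Nc[OF h] ij by (simp add: Nm[OF g h] scalar_prod_def atLeast0LessThan)
      then show ?thesis
        using Nj[OF g, of i] ij by (simp add: split)
    qed
    then have "kernel_rep G {d..<e} (\<lambda>g i j. N g $$ (i, j))"
      using False de by (auto simp: kernel_rep_def N1)
    from kernel_rep_character[OF G(1) this] show ?thesis
      using \<psi> \<chi> dec unfolding constituent_def
      by (intro conjI disjI2 bexI[of _ "\<lambda>g\<in>carrier G. \<Sum>A\<in>{d..<e}. N g $$ (A, A)"]) auto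
  qed
qed

text \<open>The family need not be normalised: only orthogonality and the vanishing of the sum of the
  family off the identity are needed.\<close>

lemma supercharacter_theoryI:
  fixes G (structure) and \<sigma> :: "'i \<Rightarrow> 'a \<Rightarrow> complex" and K :: "'i \<Rightarrow> 'a set"
  assumes G: "group G" "finite (carrier G)" and I: "finite I"
    and part: "partition_on (carrier G) (K ` I)" and K: "inj_on K I"
    and char: "\<And>i. i \<in> I \<Longrightarrow> \<sigma> i \<in> characters G"
    and orth: "\<And>i j. \<lbrakk>i \<in> I; j \<in> I; i \<noteq> j\<rbrakk> \<Longrightarrow> char_inner G (\<sigma> i) (\<sigma> j) = 0"
    and sum0: "\<And>g. \<lbrakk>g \<in> carrier G; g \<noteq> \<one>\<^bsub>G\<^esub>\<rbrakk> \<Longrightarrow> (\<Sum>i\<in>I. \<sigma> i g) = 0"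
    and sum1: "(\<Sum>i\<in>I. \<sigma> i \<one>\<^bsub>G\<^esub>) \<noteq> 0"
    and const: "\<And>i j x y. \<lbrakk>i \<in> I; j \<in> I; x \<in> K j; y \<in> K j\<rbrakk> \<Longrightarrow> \<sigma> i x = \<sigma> i y"
  shows "supercharacter_theory G (\<sigma> ` I) (K ` I)"
proof -
  interpret group G by fact
  have inj: "inj_on \<sigma> I"
  proof
    fix i j assume ij: "i \<in> I" "j \<in> I" "\<sigma> i = \<sigma> j"
    then show "i = j"
      using orth[of i j] char_inner_self_pos[OF G char[of i]] by fastforce
  qed
  have ex: "\<exists>i\<in>I. constituent G \<psi> (\<sigma> i)" if "\<psi> \<in> irreducible_characters G" for \<psi>
  proof -
    obtain d \<rho> where irr: "irreducible_representation G d \<rho>" and \<psi>: "\<psi> = character_of G d \<rho>"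
      using \<open>\<psi> \<in> _\<close> by (auto simp: irreducible_characters_def)
    have rep: "representation G d \<rho>" using irr by (simp add: irreducible_representation_def)
    have "\<psi> \<one> = of_nat d" "0 < d"
      using representation_mat[OF G(1) rep] by (auto simp: \<psi> character_of_def)
    then have \<psi>1: "\<psi> \<one> \<noteq> 0" by simp
    \<comment> \<open>The sum of the family is supported at the identity, so pairing it with \<psi>
      leaves a product of two nonzero values; some member must pair nontrivially with
      \<psi>.\<close>
    have "(\<Sum>i\<in>I. char_inner G (\<sigma> i) \<psi>) = (\<Sum>g\<in>carrier G. (\<Sum>i\<in>I. \<sigma> i g) * \<psi> (inv g))"
      unfolding char_inner_def by (subst sum.swap) (simp add: sum_distrib_right)
    also have "\<dots> = (\<Sum>g\<in>{\<one>}. (\<Sum>i\<in>I. \<sigma> i g) * \<psi> (inv g))"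
      using G(2) sum0 by (intro sum.mono_neutral_right) auto
    also have "\<dots> \<noteq> 0" using sum1 \<psi>1 by simp
    finally obtain i where "i \<in> I" "char_inner G (\<sigma> i) \<psi> \<noteq> 0"
      by (metis (no_types, lifting) sum.not_neutral_contains_not_neutral)
    then show ?thesis
      using irreducible_constituent[OF G irr char] \<psi> by blast
  qed
  have "\<exists>!\<chi>. \<chi> \<in> \<sigma> ` I \<and> constituent G \<psi> \<chi>" if "\<psi> \<in> irreducible_characters G" for \<psi>
    using ex[OF that] common_constituent_inner[OF G, of \<psi>] orth by (metis (no_types, lifting) imageE imageI)
  then show ?thesis
    unfolding supercharacter_theory_def
  proof (intro conjI ballI)
    show "\<sigma> ` I \<subseteq> characters G" using char by auto
    show "card (\<sigma> ` I) = card (K ` I)" by (simp add: card_image inj K)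
    fix \<chi> A x y assume "\<chi> \<in> \<sigma> ` I" "A \<in> K ` I" "x \<in> A" "y \<in> A"
    then show "\<chi> x = \<chi> y" using const by blast
  qed (use G part in blast)+
qed

section \<open>Rings with involution and the Cayley transform\<close>

text \<open>The model has for R all matrices and for J the strictly upper triangular ones, a subring
  and in general no ideal. \<open>h\<close> is one half, and \<open>J_quasi_inverse\<close> is the
  consequence of nilpotency that makes 1 + J a group.\<close>

locale involutive_algebra_group = ring R for R (structure) +
  fixes J :: "'a set" and \<sigma> :: "'a \<Rightarrow> 'a" and h :: 'a and p N :: nat
  assumes finite_carrier: "finite (carrier R)"
    and J_carrier: "a \<in> J \<Longrightarrow> a \<in> carrier R"
    and J_zero: "\<zero> \<in> J"
    and J_add: "\<lbrakk>a \<in> J; b \<in> J\<rbrakk> \<Longrightarrow> a \<oplus> b \<in> J"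
    and J_neg: "a \<in> J \<Longrightarrow> \<ominus> a \<in> J"
    and J_mult: "\<lbrakk>a \<in> J; b \<in> J\<rbrakk> \<Longrightarrow> a \<otimes> b \<in> J"
    and J_quasi_inverse: "a \<in> J \<Longrightarrow> \<exists>b\<in>J. (\<one> \<oplus> a) \<otimes> (\<one> \<oplus> b) = \<one>"
    and half_closed: "h \<in> carrier R" and half: "h \<oplus> h = \<one>"
    and J_half: "a \<in> J \<Longrightarrow> h \<otimes> a \<in> J"
    and invol_closed: "a \<in> carrier R \<Longrightarrow> \<sigma> a \<in> carrier R"
    and invol_add: "\<lbrakk>a \<in> carrier R; b \<in> carrier R\<rbrakk> \<Longrightarrow> \<sigma> (a \<oplus> b) = \<sigma> a \<oplus> \<sigma> b"
    and invol_mult: "\<lbrakk>a \<in> carrier R; b \<in> carrier R\<rbrakk> \<Longrightarrow> \<sigma> (a \<otimes> b) = \<sigma> b \<otimes> \<sigma> a"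
    and invol_invol: "a \<in> carrier R \<Longrightarrow> \<sigma> (\<sigma> a) = a"
    and J_invol: "a \<in> J \<Longrightarrow> \<sigma> a \<in> J"
    and prime_p: "prime p" and odd_p: "odd p" and card_J: "card J = p ^ N"
begin

definition "P = {\<one> \<oplus> a | a. a \<in> J}"

definition "skew = {a \<in> J. \<sigma> a = \<ominus> a}"

definition "fixed = {x \<in> P. \<sigma> (inv x) = x}"

definition "C = \<lparr>carrier = fixed, monoid.mult = (\<otimes>), one = \<one>\<rparr>"

definition "cay a = (\<one> \<oplus> a) \<otimes> inv (\<one> \<ominus> a)"

definition "cay_inv x = (x \<ominus> \<one>) \<otimes> inv (x \<oplus> \<one>)"

lemma finite_J: "finite J"
  using finite_carrier J_carrier by (meson finite_subset subsetI)

lemma invol_zero: "\<sigma> \<zero> = \<zero>"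
proof -
  have "\<sigma> \<zero> \<oplus> \<sigma> \<zero> = \<sigma> \<zero>" using invol_add[of \<zero> \<zero>] by simp
  then show ?thesis using invol_closed[of \<zero>] by (metis add.l_cancel_one zero_closed)
qed

lemma invol_neg: assumes "a \<in> carrier R" shows "\<sigma> (\<ominus> a) = \<ominus> \<sigma> a"
proof -
  have "\<sigma> (\<ominus> a) \<oplus> \<sigma> a = \<zero>"
    using invol_add[of "\<ominus> a" a] assms invol_zero by (simp add: l_neg)
  then show ?thesis using assms invol_closed by (metis a_inv_closed minus_equality)
qed

lemma invol_one: "\<sigma> \<one> = \<one>"
proof -
  have "\<sigma> \<one> = \<sigma> \<one> \<otimes> \<sigma> (\<sigma> \<one>)" using invol_closed[of \<one>] by (simp add: invol_invol)
  also have "\<dots> = \<sigma> (\<sigma> \<one> \<otimes> \<one>)" using invol_closed[of \<one>] by (intro invol_mult[symmetric]) auto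
  also have "\<dots> = \<one>" using invol_closed[of \<one>] by (simp add: invol_invol)
  finally show ?thesis .
qed

lemma half_add: "a \<in> carrier R \<Longrightarrow> h \<otimes> a \<oplus> h \<otimes> a = a"
  using l_distr[of h h a] half half_closed by simp

lemma half_add': "a \<in> carrier R \<Longrightarrow> a \<otimes> h \<oplus> a \<otimes> h = a"
  using r_distr[of h h a] half half_closed by simp

text \<open>Writing a as a h + a h gives h a = h a h + h a h, and the right side adds up to a h. So
  h is central.\<close>

lemma half_comm: assumes "a \<in> carrier R" shows "h \<otimes> a = a \<otimes> h"
proof -
  have "h \<otimes> a = h \<otimes> (a \<otimes> h \<oplus> a \<otimes> h)"
    using assms by (simp add: half_add')
  also have "\<dots> = h \<otimes> (a \<otimes> h) \<oplus> h \<otimes> (a \<otimes> h)"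
    using assms half_closed by (simp add: r_distr)
  finally show ?thesis
    using assms half_closed by (simp add: half_add)
qed

lemma invol_half: "\<sigma> h = h"
proof -
  have *: "\<sigma> h \<in> carrier R" "\<sigma> h \<oplus> \<sigma> h = \<one>"
    using invol_add[of h h] half half_closed invol_one invol_closed by auto
  have "\<sigma> h = h \<otimes> \<sigma> h \<oplus> h \<otimes> \<sigma> h" using * by (simp add: half_add)
  also have "\<dots> = h \<otimes> (\<sigma> h \<oplus> \<sigma> h)" using * half_closed by (intro r_distr[symmetric]) auto
  finally show ?thesis using * half_closed by simp
qed

lemma P_I: "a \<in> J \<Longrightarrow> \<one> \<oplus> a \<in> P"
  by (auto simp: P_def)

lemma P_carrier: "x \<in> P \<Longrightarrow> x \<in> carrier R"
  using J_carrier by (auto simp: P_def)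

lemma one_P: "\<one> \<in> P"
  using P_I[OF J_zero] by simp

lemma P_minus_one: "x \<in> P \<Longrightarrow> x \<ominus> \<one> \<in> J"
  using J_carrier by (auto simp: P_def minus_eq a_ac r_neg)

lemma P_right_inverse: "x \<in> P \<Longrightarrow> \<exists>y\<in>P. x \<otimes> y = \<one>"
  using J_quasi_inverse by (auto simp: P_def)

text \<open>The right inverse y has itself a right inverse z, and associativity forces z =
  x.\<close>

lemma P_inverse: assumes "x \<in> P" shows "\<exists>y\<in>P. x \<otimes> y = \<one> \<and> y \<otimes> x = \<one>"
proof -
  obtain y where y: "y \<in> P" "x \<otimes> y = \<one>" using P_right_inverse assms by blast
  obtain z where z: "z \<in> P" "y \<otimes> z = \<one>" using P_right_inverse y(1) by blast
  have "z = x \<otimes> y \<otimes> z" using y z P_carrier by simp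
  also have "\<dots> = x \<otimes> (y \<otimes> z)" using y z P_carrier assms by (intro m_assoc) auto
  also have "\<dots> = x" using y z P_carrier assms by simp
  finally show ?thesis using y z by auto
qed

lemma P_Units: "x \<in> P \<Longrightarrow> x \<in> Units R"
  using P_inverse[of x] P_carrier by (auto simp: Units_def)

lemma P_inv: assumes "x \<in> P" shows "inv x \<in> P"
proof -
  obtain y where "y \<in> P" "x \<otimes> y = \<one>" "y \<otimes> x = \<one>" using P_inverse assms by blast
  then show ?thesis using inv_unique'[of x y] P_carrier assms by auto
qed

lemma P_r_inv: "x \<in> P \<Longrightarrow> x \<otimes> inv x = \<one>" and P_l_inv: "x \<in> P \<Longrightarrow> inv x \<otimes> x = \<one>"
  using P_Units by auto

lemma P_inv_eq: assumes "x \<in> P" "y \<in> P" "y \<otimes> x = \<one>" shows "inv x = y"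
proof -
  have "inv x = (y \<otimes> x) \<otimes> inv x" using assms P_carrier P_inv by simp
  also have "\<dots> = y \<otimes> (x \<otimes> inv x)" using assms P_carrier P_inv by (intro m_assoc) auto
  finally show ?thesis using assms P_carrier by (simp add: P_r_inv)
qed

lemma P_cancel:
  assumes P: "x \<in> P" "y \<in> P" and c: "a \<in> carrier R" "b \<in> carrier R"
    and eq: "x \<otimes> a \<otimes> y = x \<otimes> b \<otimes> y"
  shows "a = b"
proof -
  note Pc = P[THEN P_carrier] P[THEN P_inv, THEN P_carrier]
  have "inv x \<otimes> (x \<otimes> d \<otimes> y) \<otimes> inv y = d" if "d \<in> carrier R" for d
  proof -
    have "inv x \<otimes> (x \<otimes> d \<otimes> y) \<otimes> inv y = (inv x \<otimes> x) \<otimes> d \<otimes> (y \<otimes> inv y)"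
      using that Pc by (simp only: m_assoc m_closed)
    then show ?thesis using that P by (simp add: P_r_inv P_l_inv)
  qed
  then have "a = inv x \<otimes> (x \<otimes> a \<otimes> y) \<otimes> inv y" "inv x \<otimes> (x \<otimes> b \<otimes> y) \<otimes> inv y = b"
    using c by simp_all
  then show ?thesis unfolding eq by (rule trans)
qed

lemma PJ: "\<lbrakk>x \<in> P; a \<in> J\<rbrakk> \<Longrightarrow> x \<otimes> a \<in> J"
  using J_add[OF _ J_mult] J_carrier by (auto simp: P_def l_distr)

lemma JP: "\<lbrakk>a \<in> J; x \<in> P\<rbrakk> \<Longrightarrow> a \<otimes> x \<in> J"
  using J_add[OF _ J_mult] J_carrier by (auto simp: P_def r_distr)

lemma P_add_J: "\<lbrakk>x \<in> P; a \<in> J\<rbrakk> \<Longrightarrow> x \<oplus> a \<in> P"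
  using J_carrier by (auto simp: P_def a_assoc intro: J_add)

lemma P_mult: "\<lbrakk>x \<in> P; y \<in> P\<rbrakk> \<Longrightarrow> x \<otimes> y \<in> P"
proof -
  assume x: "x \<in> P" and "y \<in> P"
  then obtain b where b: "b \<in> J" "y = \<one> \<oplus> b" by (auto simp: P_def)
  then show "x \<otimes> y \<in> P"
    using P_add_J[OF x PJ[OF x b(1)]] P_carrier[OF x] J_carrier[OF b(1)] by (simp add: r_distr)
qed

lemma P_invol: "x \<in> P \<Longrightarrow> \<sigma> x \<in> P"
  using J_carrier by (auto simp: P_def invol_add invol_one intro!: J_invol)

lemma invol_m_inv: assumes "x \<in> P" shows "\<sigma> (inv x) = inv (\<sigma> x)"
proof -
  have "\<sigma> (inv x) \<otimes> \<sigma> x = \<one>" "\<sigma> x \<otimes> \<sigma> (inv x) = \<one>"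
    using invol_mult[of x "inv x"] invol_mult[of "inv x" x] assms P_carrier P_inv invol_one
    by (auto simp: P_r_inv P_l_inv)
  then show ?thesis
    using inv_unique'[of "\<sigma> x" "\<sigma> (inv x)"] assms P_carrier P_inv invol_closed by auto
qed

lemma J_minus: "\<lbrakk>a \<in> J; b \<in> J\<rbrakk> \<Longrightarrow> a \<ominus> b \<in> J"
  by (simp add: minus_eq J_add J_neg)

section \<open>Square roots in P and twisted conjugacy\<close>

lemma card_P: "card P = p ^ N"
proof -
  have "P = (\<lambda>a. \<one> \<oplus> a) ` J" by (auto simp: P_def)
  moreover have "inj_on (\<lambda>a. \<one> \<oplus> a) J" using J_carrier by (auto intro!: inj_onI)
  ultimately show ?thesis by (simp add: card_image card_J)
qed

lemma finite_P: "finite P"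
  using finite_carrier P_carrier by (meson finite_subset subsetI)

lemma group_P: "group \<lparr>carrier = P, monoid.mult = (\<otimes>), one = \<one>\<rparr>"
  using P_inverse by (intro groupI) (auto simp: P_mult one_P P_carrier m_assoc)

text \<open>As |P| is odd, |P| + 1 = 2k and w^k is a square root. It is a power of w, so relations
  satisfied by w can be passed on to it by induction.\<close>

lemma P_sqrt:
  assumes w: "w \<in> P"
  obtains k :: nat where "(w [^] k) \<otimes> (w [^] k) = w" and "w [^] k \<in> P"
proof -
  let ?U = "\<lparr>carrier = P, monoid.mult = (\<otimes>), one = \<one>\<rparr>"
  interpret U: group ?U by (rule group_P)
  have pow: "w [^]\<^bsub>?U\<^esub> (k::nat) = w [^] k" for k
    by (induction k) (simp_all add: nat_pow_def)
  have "odd (card P)" using odd_p by (simp add: card_P)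
  then obtain k where k: "Suc (card P) = k + k" by (metis even_Suc evenE mult_2)
  have "(w [^] k) \<otimes> (w [^] k) = w [^] Suc (card P)"
    using P_carrier[OF w] by (simp add: nat_pow_mult k)
  also have "\<dots> = w"
    using U.pow_order_eq_1[of w] w P_carrier[OF w] by (simp add: pow Coset.order_def)
  finally have "(w [^] k) \<otimes> (w [^] k) = w" .
  moreover have "w [^] k \<in> P" using U.nat_pow_closed[of w k] w by (simp add: pow)
  ultimately show thesis using that by blast
qed

text \<open>Write y = w \<sigma>(x). Comparing x a y with the negative of its image under \<sigma>
  yields \<sigma>(w) a = a w, a relation that passes to powers of w. For a power v with v v = w, the
  element x a v v \<sigma>(x) equals (x \<sigma>(v)) a \<sigma>(x \<sigma>(v)).\<close>

lemma twisted_conj_J: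
  assumes "a \<in> skew" and xy: "x \<in> P" "y \<in> P" and b: "x \<otimes> a \<otimes> y \<in> skew"
  obtains z where "z \<in> P" "x \<otimes> a \<otimes> y = z \<otimes> a \<otimes> \<sigma> z"
proof -
  have a: "a \<in> J" "\<sigma> a = \<ominus> a" "a \<in> carrier R" using assms by (auto simp: skew_def J_carrier)
  note c = xy[THEN P_carrier] a(3) invol_closed[OF P_carrier[OF xy(1)]] invol_closed[OF P_carrier[OF xy(2)]]
  define w where "w = y \<otimes> inv (\<sigma> x)"
  have wP: "w \<in> P" using xy by (simp add: w_def P_mult P_inv P_invol)
  note wc = P_carrier[OF wP] invol_closed[OF P_carrier[OF wP]]
  have y: "y = w \<otimes> \<sigma> x"
    using xy c by (simp add: w_def m_assoc P_l_inv P_invol P_carrier P_inv)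
  have "\<sigma> (x \<otimes> a \<otimes> y) = \<ominus> (x \<otimes> a \<otimes> y)" using b by (simp add: skew_def)
  moreover have "\<sigma> (x \<otimes> a \<otimes> y) = \<ominus> (x \<otimes> (\<sigma> w \<otimes> a) \<otimes> \<sigma> x)"
    using c wc a(2) by (simp add: y invol_mult invol_invol m_assoc l_minus r_minus)
  moreover have "x \<otimes> a \<otimes> y = x \<otimes> (a \<otimes> w) \<otimes> \<sigma> x"
    using c wc by (simp add: y m_assoc)
  ultimately have "x \<otimes> (\<sigma> w \<otimes> a) \<otimes> \<sigma> x = x \<otimes> (a \<otimes> w) \<otimes> \<sigma> x"
    using c wc by (metis m_closed minus_minus)
  then have sw: "\<sigma> w \<otimes> a = a \<otimes> w"
    using P_cancel[OF xy(1) P_invol[OF xy(1)], of "\<sigma> w \<otimes> a" "a \<otimes> w"] c wc by simp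
  have pow: "\<sigma> (w [^] k) \<otimes> a = a \<otimes> w [^] k" for k :: nat
  proof (induction k)
    case 0
    then show ?case using c by (simp add: invol_one)
  next
    case (Suc k)
    have "\<sigma> (w [^] Suc k) \<otimes> a = \<sigma> w \<otimes> (\<sigma> (w [^] k) \<otimes> a)"
      using c wc by (simp add: invol_mult m_assoc invol_closed)
    also have "\<dots> = (\<sigma> w \<otimes> a) \<otimes> w [^] k"
      using c wc Suc by (simp add: m_assoc)
    also have "\<dots> = a \<otimes> w [^] Suc k"
      using c wc sw nat_pow_Suc2[of w k] by (simp add: m_assoc)
    finally show ?case .
  qed
  obtain k :: nat where k: "(w [^] k) \<otimes> (w [^] k) = w" "w [^] k \<in> P" using P_sqrt[OF wP] by metis
  define v where "v = w [^] k"
  have v: "v \<in> P" "v \<otimes> v = w" "\<sigma> v \<otimes> a = a \<otimes> v" using k pow by (auto simp: v_def)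
  have vc: "v \<in> carrier R" "\<sigma> v \<in> carrier R" using v P_carrier invol_closed by auto
  have "x \<otimes> a \<otimes> y = x \<otimes> ((a \<otimes> v) \<otimes> v) \<otimes> \<sigma> x"
    using c vc wc by (simp add: y v(2)[symmetric] m_assoc)
  also have "\<dots> = x \<otimes> ((\<sigma> v \<otimes> a) \<otimes> v) \<otimes> \<sigma> x"
    by (simp add: v(3))
  also have "\<dots> = (x \<otimes> \<sigma> v) \<otimes> a \<otimes> \<sigma> (x \<otimes> \<sigma> v)"
    using c vc by (simp add: invol_mult invol_invol m_assoc)
  finally show thesis
    using that[of "x \<otimes> \<sigma> v"] xy v by (simp add: P_mult P_invol)
qed

section \<open>The group of fixed points\<close>

lemma C_sel [simp]: "carrier C = fixed" "monoid.mult C = (\<otimes>)" "one C = \<one>"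
  by (simp_all add: C_def)

lemma fixed_iff: "x \<in> fixed \<longleftrightarrow> x \<in> P \<and> \<sigma> x = inv x"
proof -
  have "\<sigma> (inv x) = x \<longleftrightarrow> \<sigma> x = inv x" if "x \<in> P"
    using that invol_invol P_carrier P_inv by metis
  then show ?thesis by (auto simp: fixed_def)
qed

lemma fixed_inv: assumes "x \<in> fixed" shows "inv x \<in> fixed"
  using assms P_Units unfolding fixed_iff
  by (simp add: P_inv invol_m_inv)

lemma group_C: "group C"
proof (intro groupI)
  fix x y assume "x \<in> carrier C" "y \<in> carrier C"
  then have xy: "x \<in> P" "y \<in> P" "\<sigma> x = inv x" "\<sigma> y = inv y" by (auto simp: fixed_iff)
  note Pc = xy(1,2)[THEN P_carrier] xy(1,2)[THEN P_inv, THEN P_carrier]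
  have "(inv y \<otimes> inv x) \<otimes> (x \<otimes> y) = inv y \<otimes> ((inv x \<otimes> x) \<otimes> y)"
    using Pc by (simp only: m_assoc m_closed)
  also have "\<dots> = \<one>" using Pc xy by (simp add: P_l_inv)
  finally have "inv (x \<otimes> y) = inv y \<otimes> inv x"
    using xy by (intro P_inv_eq) (auto intro: P_mult P_inv)
  then show "x \<otimes>\<^bsub>C\<^esub> y \<in> carrier C"
    using xy Pc by (simp add: fixed_iff P_mult invol_mult)
next
  fix x assume "x \<in> carrier C"
  then show "\<exists>y\<in>carrier C. y \<otimes>\<^bsub>C\<^esub> x = \<one>\<^bsub>C\<^esub>"
    using fixed_inv[of x] by (intro bexI[of _ "inv x"]) (auto simp: fixed_iff P_l_inv)
next
  show "\<one>\<^bsub>C\<^esub> \<in> carrier C" by (simp add: fixed_iff one_P invol_one)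
qed (simp_all add: fixed_iff P_carrier m_assoc)

lemma finite_C: "finite (carrier C)"
  using finite_P by (simp add: fixed_def)

lemma inv_C: assumes "x \<in> fixed" shows "inv\<^bsub>C\<^esub> x = inv x"
proof -
  interpret C: group C by (rule group_C)
  show ?thesis
    using assms fixed_inv[OF assms] C.inv_equality[of "inv x" x] by (simp add: fixed_iff P_l_inv)
qed

section \<open>The Cayley transform\<close>

lemma one_minus_P: "a \<in> J \<Longrightarrow> \<one> \<ominus> a \<in> P"
  using P_I[OF J_neg] by (simp add: minus_eq)

text \<open>x + 1 is twice the element 1 + h (x - 1) of P. This form of the inverse shows below that
  \<open>cay_inv x\<close> stays in J.\<close>

lemma P_plus_one:
  assumes x: "x \<in> P"
  shows "x \<oplus> \<one> \<in> Units R" "inv (x \<oplus> \<one>) = inv (\<one> \<oplus> h \<otimes> (x \<ominus> \<one>)) \<otimes> h"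
proof -
  have a: "x \<ominus> \<one> \<in> J" by (rule P_minus_one[OF x])
  define y where "y = \<one> \<oplus> h \<otimes> (x \<ominus> \<one>)"
  have y: "y \<in> P" unfolding y_def by (intro P_I J_half a)
  have c: "x \<in> carrier R" "y \<in> carrier R" "inv y \<in> carrier R" "x \<ominus> \<one> \<in> carrier R"
    using x y P_carrier P_inv J_carrier a by auto
  have "h \<otimes> (x \<oplus> \<one>) = y"
  proof -
    have "h \<otimes> (x \<oplus> \<one>) = h \<otimes> (\<one> \<oplus> \<one> \<oplus> (x \<ominus> \<one>))"
      using c by (simp add: minus_eq a_ac r_neg)
    also have "\<dots> = (h \<otimes> \<one> \<oplus> h \<otimes> \<one>) \<oplus> h \<otimes> (x \<ominus> \<one>)"
      using c half_closed by (simp add: r_distr)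
    finally show ?thesis by (simp add: half half_closed y_def)
  qed
  then have "inv y \<otimes> h \<otimes> (x \<oplus> \<one>) = \<one>" "(x \<oplus> \<one>) \<otimes> (inv y \<otimes> h) = \<one>"
  proof -
    assume hy: "h \<otimes> (x \<oplus> \<one>) = y"
    show "inv y \<otimes> h \<otimes> (x \<oplus> \<one>) = \<one>"
      using c half_closed y hy by (simp add: m_assoc P_l_inv)
    have "(x \<oplus> \<one>) \<otimes> (inv y \<otimes> h) = (x \<oplus> \<one>) \<otimes> (h \<otimes> inv y)"
      using c by (simp add: half_comm)
    also have "\<dots> = ((x \<oplus> \<one>) \<otimes> h) \<otimes> inv y" using c half_closed by (simp add: m_assoc)
    also have "(x \<oplus> \<one>) \<otimes> h = y" using hy half_comm[of "x \<oplus> \<one>"] c by simp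
    finally show "(x \<oplus> \<one>) \<otimes> (inv y \<otimes> h) = \<one>" using y by (simp add: P_r_inv)
  qed
  moreover have "x \<oplus> \<one> \<in> carrier R" "inv y \<otimes> h \<in> carrier R" using c half_closed by auto
  ultimately show "x \<oplus> \<one> \<in> Units R" "inv (x \<oplus> \<one>) = inv (\<one> \<oplus> h \<otimes> (x \<ominus> \<one>)) \<otimes> h"
    using inv_unique'[of "x \<oplus> \<one>" "inv y \<otimes> h", THEN sym] unfolding y_def[symmetric] Units_def
    by blast+
qed

lemma cay_inv_J: assumes x: "x \<in> P" shows "cay_inv x \<in> J"
proof -
  have a: "x \<ominus> \<one> \<in> J" by (rule P_minus_one[OF x])
  define y where "y = inv (\<one> \<oplus> h \<otimes> (x \<ominus> \<one>))"
  have y: "y \<in> P" unfolding y_def by (intro P_inv P_I J_half a)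
  have "cay_inv x = h \<otimes> ((x \<ominus> \<one>) \<otimes> y)"
    using J_carrier[OF a] P_carrier[OF y] half_closed
    by (simp add: cay_inv_def P_plus_one(2)[OF x] y_def[symmetric] half_comm[of "(x \<ominus> \<one>) \<otimes> y"] m_assoc)
  then show ?thesis using J_half[OF JP[OF a y]] by simp
qed

lemma cay_P: "a \<in> J \<Longrightarrow> cay a \<in> P"
  unfolding cay_def by (intro P_mult P_I P_inv one_minus_P)

lemma right_divide_iff:
  assumes "u \<in> Units R" "a \<in> carrier R" "b \<in> carrier R"
  shows "a \<otimes> inv u = b \<longleftrightarrow> a = b \<otimes> u"
proof
  assume "a \<otimes> inv u = b"
  then have "b \<otimes> u = a \<otimes> (inv u \<otimes> u)" using assms by (auto simp: m_assoc Units_closed)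
  then show "a = b \<otimes> u" using assms by simp
next
  assume "a = b \<otimes> u"
  then show "a \<otimes> inv u = b" using assms by (simp add: m_assoc Units_closed)
qed

lemma cay_inv_iff:
  assumes x: "x \<in> P" and c: "c \<in> J"
  shows "cay_inv x = c \<longleftrightarrow> x \<ominus> \<one> = c \<otimes> (x \<oplus> \<one>)"
  unfolding cay_inv_def
  using right_divide_iff[OF P_plus_one(1)[OF x], of "x \<ominus> \<one>" c] J_carrier[OF c] P_carrier[OF x] by auto

lemma one_pm_comm:
  assumes "c \<in> carrier R" shows "(\<one> \<oplus> c) \<otimes> (\<one> \<ominus> c) = (\<one> \<ominus> c) \<otimes> (\<one> \<oplus> c)"
  using assms by (simp add: minus_eq l_distr r_distr l_minus r_minus a_ac minus_add)

lemma cay_iff: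
  assumes x: "x \<in> P" and c: "c \<in> J"
  shows "cay c = x \<longleftrightarrow> \<one> \<oplus> c = (\<one> \<ominus> c) \<otimes> x"
proof -
  have u: "\<one> \<ominus> c \<in> P" by (rule one_minus_P[OF c])
  note cc = J_carrier[OF c] P_carrier[OF x] P_carrier[OF u] P_carrier[OF P_inv[OF u]]
  have "cay c = inv (\<one> \<ominus> c) \<otimes> (\<one> \<oplus> c)"
  proof -
    have "cay c = inv (\<one> \<ominus> c) \<otimes> ((\<one> \<ominus> c) \<otimes> (\<one> \<oplus> c)) \<otimes> inv (\<one> \<ominus> c)"
      using cc u by (simp add: cay_def m_assoc[symmetric] P_l_inv)
    also have "\<dots> = inv (\<one> \<ominus> c) \<otimes> ((\<one> \<oplus> c) \<otimes> (\<one> \<ominus> c)) \<otimes> inv (\<one> \<ominus> c)"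
      using cc by (simp add: one_pm_comm)
    also have "\<dots> = inv (\<one> \<ominus> c) \<otimes> (\<one> \<oplus> c)"
      using cc u by (simp add: m_assoc P_r_inv)
    finally show ?thesis .
  qed
  moreover have "inv (\<one> \<ominus> c) \<otimes> (\<one> \<oplus> c) = x \<longleftrightarrow> \<one> \<oplus> c = (\<one> \<ominus> c) \<otimes> x"
    using cc u
    by (metis P_Units P_l_inv P_r_inv m_assoc l_one add.m_closed one_closed)
  ultimately show ?thesis by simp
qed

text \<open>Adding c x - 1 to both sides turns 1 + c = (1 - c) x into c (x + 1) = x - 1; these are
  the two equations with denominators cleared.\<close>

lemma cay_cay_inv_iff:
  assumes x: "x \<in> P" and c: "c \<in> J"
  shows "cay c = x \<longleftrightarrow> cay_inv x = c"
proof -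
  note cc = J_carrier[OF c] P_carrier[OF x]
  have "\<one> \<oplus> c = (\<one> \<ominus> c) \<otimes> x \<longleftrightarrow> \<one> \<oplus> c \<oplus> (c \<otimes> x \<ominus> \<one>) = (\<one> \<ominus> c) \<otimes> x \<oplus> (c \<otimes> x \<ominus> \<one>)"
    using cc by (simp add: a_comm[of _ "c \<otimes> x \<ominus> \<one>"])
  also have "\<one> \<oplus> c \<oplus> (c \<otimes> x \<ominus> \<one>) = c \<otimes> (x \<oplus> \<one>)"
    using cc by (simp add: minus_eq r_distr a_ac r_neg)
  also have "(\<one> \<ominus> c) \<otimes> x \<oplus> (c \<otimes> x \<ominus> \<one>) = x \<ominus> \<one>"
    using cc by (simp add: minus_eq l_distr l_minus a_assoc r_neg1)
  finally show ?thesis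
    using cay_iff[OF assms] cay_inv_iff[OF assms] by auto
qed

lemma cay_inv_cay: "a \<in> J \<Longrightarrow> cay_inv (cay a) = a"
  using cay_cay_inv_iff[OF cay_P] by blast

lemma cay_cay_inv: "x \<in> P \<Longrightarrow> cay (cay_inv x) = x"
  using cay_cay_inv_iff[OF _ cay_inv_J] by blast

lemma cay_inv_props:
  assumes x: "x \<in> P"
  shows "x \<ominus> \<one> = cay_inv x \<otimes> (x \<oplus> \<one>)" "x \<ominus> \<one> = (x \<oplus> \<one>) \<otimes> cay_inv x"
proof -
  note c = P_carrier[OF x] J_carrier[OF cay_inv_J[OF x]]
  show 1: "x \<ominus> \<one> = cay_inv x \<otimes> (x \<oplus> \<one>)"
    using cay_inv_iff[OF x cay_inv_J[OF x]] by simp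
  have u: "x \<oplus> \<one> \<in> Units R" by (rule P_plus_one(1)[OF x])
  have "(x \<oplus> \<one>) \<otimes> cay_inv x = (x \<oplus> \<one>) \<otimes> (x \<ominus> \<one>) \<otimes> inv (x \<oplus> \<one>)"
    using c u by (simp add: cay_inv_def m_assoc)
  also have "(x \<oplus> \<one>) \<otimes> (x \<ominus> \<one>) = (x \<ominus> \<one>) \<otimes> (x \<oplus> \<one>)"
    using c by (simp add: minus_eq l_distr r_distr l_minus r_minus a_ac minus_add)
  also have "\<dots> \<otimes> inv (x \<oplus> \<one>) = x \<ominus> \<one>"
    using c u by (simp add: m_assoc)
  finally show "x \<ominus> \<one> = (x \<oplus> \<one>) \<otimes> cay_inv x" by simp
qed

text \<open>Applying \<sigma> to x - 1 = c (x + 1) and multiplying by x gives 1 - x = (1 + x)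
  \<sigma>(c). The same holds with - c in place of \<sigma>(c), because c commutes with x + 1, and 1
  + x is a unit.\<close>

lemma cay_inv_skew:
  assumes "x \<in> fixed" shows "cay_inv x \<in> skew"
proof -
  have x: "x \<in> P" and sx: "\<sigma> x = inv x" using assms by (auto simp: fixed_iff)
  define c where "c = cay_inv x"
  have cJ: "c \<in> J" using cay_inv_J[OF x] by (simp add: c_def)
  note cc = P_carrier[OF x] J_carrier[OF cJ] P_carrier[OF P_inv[OF x]] invol_closed[OF J_carrier[OF cJ]]
  have "\<sigma> (x \<ominus> \<one>) = \<sigma> (c \<otimes> (x \<oplus> \<one>))" using cay_inv_props(1)[OF x] by (simp add: c_def)
  then have "inv x \<ominus> \<one> = (inv x \<oplus> \<one>) \<otimes> \<sigma> c"
    using cc by (simp add: minus_eq invol_add invol_neg invol_one invol_mult sx)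
  then have "x \<otimes> (inv x \<ominus> \<one>) = x \<otimes> ((inv x \<oplus> \<one>) \<otimes> \<sigma> c)" by simp
  then have "\<one> \<ominus> x = (\<one> \<oplus> x) \<otimes> \<sigma> c"
    using cc x by (simp add: minus_eq r_distr r_minus P_r_inv m_assoc[symmetric])
  moreover have "\<one> \<ominus> x = (\<one> \<oplus> x) \<otimes> (\<ominus> c)"
  proof -
    have "\<one> \<ominus> x = \<ominus> (x \<ominus> \<one>)" using cc by (simp add: minus_eq minus_add a_comm)
    also have "\<dots> = (x \<oplus> \<one>) \<otimes> (\<ominus> c)" using cay_inv_props(2)[OF x] cc by (simp add: c_def r_minus)
    finally show ?thesis using cc by (simp add: a_comm)
  qed
  moreover have "\<one> \<oplus> x \<in> Units R" using P_plus_one(1)[OF x] cc by (simp add: a_comm)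
  ultimately have "\<sigma> c = \<ominus> c"
    using cc by (metis Units_l_cancel a_inv_closed)
  then show ?thesis using cJ by (simp add: skew_def c_def)
qed

lemma cay_fixed: assumes "c \<in> skew" shows "cay c \<in> fixed"
proof -
  have c: "c \<in> J" "\<sigma> c = \<ominus> c" using assms by (auto simp: skew_def)
  have u: "\<one> \<ominus> c \<in> P" "\<one> \<oplus> c \<in> P" using c one_minus_P P_I by auto
  have s: "\<sigma> (\<one> \<ominus> c) = \<one> \<oplus> c" "\<sigma> (\<one> \<oplus> c) = \<one> \<ominus> c"
    using J_carrier[OF c(1)] c(2) by (simp_all add: minus_eq invol_add invol_one invol_neg)
  have "\<sigma> (cay c) = inv (\<one> \<oplus> c) \<otimes> (\<one> \<ominus> c)"
    unfolding cay_def using u P_carrier P_inv by (simp add: invol_mult invol_m_inv s)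
  moreover have "(inv (\<one> \<oplus> c) \<otimes> (\<one> \<ominus> c)) \<otimes> cay c = \<one>"
  proof -
    have "(inv (\<one> \<oplus> c) \<otimes> (\<one> \<ominus> c)) \<otimes> cay c = inv (\<one> \<oplus> c) \<otimes> ((\<one> \<ominus> c) \<otimes> cay c)"
      using u cay_P[OF c(1)] P_carrier P_inv by (simp add: m_assoc)
    also have "(\<one> \<ominus> c) \<otimes> cay c = \<one> \<oplus> c"
      using cay_iff[OF cay_P[OF c(1)] c(1)] by simp
    finally show ?thesis using u by (simp add: P_l_inv)
  qed
  ultimately show ?thesis
    using cay_P[OF c(1)] P_inv_eq[OF cay_P[OF c(1)] P_invol[OF cay_P[OF c(1)]]] unfolding fixed_iff by simp
qed

text \<open>Needed for the pairing of characters, where it converts inversion in the fixed group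
  into negation. It follows by multiplying x - 1 = c x + c by the inverse of x.\<close>

lemma cay_inv_inv: assumes x: "x \<in> P" shows "cay_inv (inv x) = \<ominus> cay_inv x"
proof -
  define c where "c = cay_inv x"
  have cJ: "c \<in> J" using cay_inv_J[OF x] by (simp add: c_def)
  note cc = P_carrier[OF x] J_carrier[OF cJ] P_carrier[OF P_inv[OF x]]
  have e: "x \<ominus> \<one> = c \<otimes> x \<oplus> c" using cay_inv_props(1)[OF x] cc by (simp add: c_def r_distr)
  have "inv x \<ominus> \<one> = \<ominus> ((x \<ominus> \<one>) \<otimes> inv x)"
    using cc x by (simp add: minus_eq l_distr l_minus P_r_inv minus_add a_comm)
  also have "\<dots> = (\<ominus> c) \<otimes> (inv x \<oplus> \<one>)"
    unfolding e using cc x by (simp add: l_distr r_distr m_assoc P_r_inv l_minus r_minus minus_add a_comm)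
  finally show ?thesis
    using cay_inv_iff[OF P_inv[OF x] J_neg[OF cJ]] by (simp add: c_def)
qed

lemma cay_inv_bij: "bij_betw cay_inv fixed skew"
proof (rule bij_betw_byWitness[where f' = cay])
  show "\<forall>a\<in>fixed. cay (cay_inv a) = a" by (simp add: cay_cay_inv fixed_def)
  show "\<forall>a\<in>skew. cay_inv (cay a) = a" by (simp add: cay_inv_cay skew_def)
qed (use cay_inv_skew cay_fixed in auto)

lemma skew_symmetrize: "a \<in> J \<Longrightarrow> a \<ominus> \<sigma> a \<in> skew"
  using J_carrier invol_closed
  by (auto simp: skew_def minus_eq invol_add invol_neg invol_invol minus_add a_comm intro: J_minus[unfolded minus_eq] J_invol)

end

section \<open>Invariant additive characters\<close>

text \<open>The direct sum of m copies, indexed by pairs; it exhibits m times a trace as a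
  character.\<close>

lemma kernel_rep_multiple:
  assumes r: "kernel_rep G X r" and m: "0 < (m::nat)"
  shows "kernel_rep G (X \<times> {..<m}) (\<lambda>g (A, i) (B, j). if i = j then r g A B else 0)"
proof -
  have "(\<Sum>(B, k)\<in>X \<times> {..<m}. (if i = k then r g A B else 0) * (if k = j then r h B E else 0)) =
      (if i = j then r (g \<otimes>\<^bsub>G\<^esub> h) A E else 0)"
    if gh: "g \<in> carrier G" "h \<in> carrier G" and AE: "A \<in> X" "E \<in> X" and ij: "i < m" "j < m" for g h A E i j
  proof -
    have "(\<Sum>(B, k)\<in>X \<times> {..<m}. (if i = k then r g A B else 0) * (if k = j then r h B E else 0)) =
      (\<Sum>B\<in>X. \<Sum>k<m. if k = i then (if i = j then r g A B * r h B E else 0) else 0)"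
      unfolding sum.cartesian_product by (intro sum.cong refl) auto
    also have "\<dots> = (\<Sum>B\<in>X. if i = j then r g A B * r h B E else 0)"
      using ij by simp
    also have "\<dots> = (if i = j then r (g \<otimes>\<^bsub>G\<^esub> h) A E else 0)"
      using r gh AE by (simp add: kernel_rep_def)
    finally show ?thesis .
  qed
  then show ?thesis
    using r m by (auto simp: kernel_rep_def case_prod_unfold lessThan_empty_iff)
qed

text \<open>Translation by an element d with \<open>f d \<noteq> 1\<close> permutes S and multiplies
  the sum by \<open>f d\<close>.\<close>

lemma (in ring) additive_char_sum:
  fixes f :: "'a \<Rightarrow> complex"
  assumes "finite S" and S: "\<And>a. a \<in> S \<Longrightarrow> a \<in> carrier R" "\<And>a b. \<lbrakk>a \<in> S; b \<in> S\<rbrakk> \<Longrightarrow> a \<oplus> b \<in> S"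
    "\<And>a. a \<in> S \<Longrightarrow> \<ominus> a \<in> S"
    and f: "\<And>a b. \<lbrakk>a \<in> S; b \<in> S\<rbrakk> \<Longrightarrow> f (a \<oplus> b) = f a * f b"
  shows "(\<Sum>a\<in>S. f a) = (if \<forall>a\<in>S. f a = 1 then of_nat (card S) else 0)"
proof (cases "\<forall>a\<in>S. f a = 1")
  case False
  then obtain d where d: "d \<in> S" "f d \<noteq> 1" by blast
  have "bij_betw (\<lambda>a. d \<oplus> a) S S"
    using S d by (intro bij_betw_byWitness[where f' = "\<lambda>a. (\<ominus> d) \<oplus> a"]) (auto simp: r_neg1 r_neg2)
  then have "(\<Sum>a\<in>S. f a) = (\<Sum>a\<in>S. f (d \<oplus> a))"
    by (rule sum.reindex_bij_betw[symmetric])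
  also have "\<dots> = f d * (\<Sum>a\<in>S. f a)"
    using f d by (simp add: sum_distrib_left)
  finally have "(\<Sum>a\<in>S. f a) = 0" using d by simp
  then show ?thesis using False by presburger
qed simp

context involutive_algebra_group
begin

definition "inv_chars = {\<mu>. \<mu> \<in> extensional J \<and> \<mu> \<zero> = (1::complex) \<and>
  (\<forall>a\<in>J. \<forall>b\<in>J. \<mu> (a \<oplus> b) = \<mu> a * \<mu> b) \<and> (\<forall>a\<in>J. \<mu> (\<ominus> \<sigma> a) = \<mu> a)}"

lemma skew_J: "c \<in> skew \<Longrightarrow> c \<in> J"
  by (simp add: skew_def)

lemma skew_add: "\<lbrakk>a \<in> skew; b \<in> skew\<rbrakk> \<Longrightarrow> a \<oplus> b \<in> skew"
  using J_carrier by (auto simp: skew_def J_add invol_add minus_add)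

lemma skew_neg: "a \<in> skew \<Longrightarrow> \<ominus> a \<in> skew"
  using J_carrier by (auto simp: skew_def J_neg invol_neg)

lemma skew_half: assumes "a \<in> skew" shows "h \<otimes> a \<in> skew"
proof -
  have a: "a \<in> J" "\<sigma> a = \<ominus> a" using assms by (auto simp: skew_def)
  then have "\<sigma> (h \<otimes> a) = (\<ominus> a) \<otimes> h"
    using J_carrier half_closed by (simp add: invol_mult invol_half)
  also have "\<dots> = \<ominus> (h \<otimes> a)"
    using a J_carrier half_closed by (simp add: half_comm l_minus)
  finally show ?thesis
    using a by (simp add: skew_def J_half)
qed

lemma finite_skew: "finite skew"
  using finite_J by (simp add: skew_def)

text \<open>The arguments a and - \<sigma>(a) give the same value, so replacing a by its skew part
  changes nothing. Hence an invariant character is determined by its values on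
  \<open>skew\<close>.\<close>

lemma inv_char_eq_skew:
  assumes "\<mu> \<in> inv_chars" and a: "a \<in> J"
  shows "\<mu> (h \<otimes> a \<ominus> \<sigma> (h \<otimes> a)) = \<mu> a"
proof -
  have "\<mu> (h \<otimes> a \<ominus> \<sigma> (h \<otimes> a)) = \<mu> (h \<otimes> a) * \<mu> (h \<otimes> a)"
    using assms J_half[OF a] J_neg J_invol by (simp add: minus_eq inv_chars_def)
  also have "\<dots> = \<mu> (h \<otimes> a \<oplus> h \<otimes> a)"
    using assms J_half[OF a] by (simp add: inv_chars_def)
  finally show ?thesis using J_carrier[OF a] by (simp add: half_add)
qed

lemma inv_char_neg:
  assumes "\<mu> \<in> inv_chars" and a: "a \<in> J"
  shows "\<mu> a * \<mu> (\<ominus> a) = 1"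
proof -
  have "\<mu> a * \<mu> (\<ominus> a) = \<mu> (a \<oplus> (\<ominus> a))" using assms J_neg by (simp add: inv_chars_def)
  then show ?thesis using assms J_carrier by (simp add: r_neg inv_chars_def)
qed

text \<open>The quotient of the two characters is summed over the additive group
  \<open>skew\<close>. By \<open>inv_char_eq_skew\<close> it can be trivial there only if the
  characters agree on all of J.\<close>

lemma inv_chars_orthogonal:
  assumes \<mu>: "\<mu> \<in> inv_chars" and \<nu>: "\<nu> \<in> inv_chars"
  shows "(\<Sum>c\<in>skew. \<mu> c * \<nu> (\<ominus> c)) = (if \<mu> = \<nu> then of_nat (card skew) else 0)"
proof -
  have "(\<Sum>c\<in>skew. \<mu> c * \<nu> (\<ominus> c)) = (if \<forall>c\<in>skew. \<mu> c * \<nu> (\<ominus> c) = 1 then of_nat (card skew) else 0)"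
  proof (intro additive_char_sum)
    fix a b assume "a \<in> skew" "b \<in> skew"
    then have ab: "a \<in> J" "b \<in> J" by (auto dest: skew_J)
    then have "\<nu> (\<ominus> (a \<oplus> b)) = \<nu> (\<ominus> a) * \<nu> (\<ominus> b)"
      using \<nu> ab[THEN J_carrier] J_neg by (simp add: minus_add inv_chars_def)
    then show "\<mu> (a \<oplus> b) * \<nu> (\<ominus> (a \<oplus> b)) = \<mu> a * \<nu> (\<ominus> a) * (\<mu> b * \<nu> (\<ominus> b))"
      using \<mu> ab by (simp add: inv_chars_def)
  qed (auto simp: finite_skew skew_add skew_neg dest: skew_J J_carrier)
  moreover have "(\<forall>c\<in>skew. \<mu> c * \<nu> (\<ominus> c) = 1) \<longleftrightarrow> \<mu> = \<nu>"
  proof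
    assume *: "\<forall>c\<in>skew. \<mu> c * \<nu> (\<ominus> c) = 1"
    have eq: "\<mu> c = \<nu> c" if c: "c \<in> skew" for c
    proof -
      have "\<mu> c * \<nu> (\<ominus> c) = \<nu> c * \<nu> (\<ominus> c)" using * c inv_char_neg[OF \<nu> skew_J[OF c]] by simp
      moreover have "\<nu> (\<ominus> c) \<noteq> 0" using * c by fastforce
      ultimately show ?thesis by simp
    qed
    show "\<mu> = \<nu>"
    proof (rule extensionalityI[of _ J])
      fix a assume a: "a \<in> J"
      have "\<mu> a = \<mu> (h \<otimes> a \<ominus> \<sigma> (h \<otimes> a))" using inv_char_eq_skew[OF \<mu> a] by simp
      also have "\<dots> = \<nu> (h \<otimes> a \<ominus> \<sigma> (h \<otimes> a))" by (intro eq skew_symmetrize J_half a)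
      also have "\<dots> = \<nu> a" by (rule inv_char_eq_skew[OF \<nu> a])
      finally show "\<mu> a = \<nu> a" .
    qed (use \<mu> \<nu> in \<open>auto simp: inv_chars_def\<close>)
  next
    assume "\<mu> = \<nu>"
    then show "\<forall>c\<in>skew. \<mu> c * \<nu> (\<ominus> c) = 1" using inv_char_neg[OF \<nu>] skew_J by blast
  qed
  ultimately show ?thesis by simp
qed

definition "orbit_char \<Omega> = (\<lambda>x\<in>fixed. \<Sum>\<mu>\<in>\<Omega>. \<mu> (cay_inv x) :: complex)"

text \<open>Along the Cayley bijection the sum over the fixed group becomes a sum over
  \<open>skew\<close>, and inversion becomes negation. What remains are pairings of distinct
  additive characters.\<close>

lemma orbit_char_inner:
  assumes "\<Omega> \<subseteq> inv_chars" "\<Omega>' \<subseteq> inv_chars" "\<Omega> \<inter> \<Omega>' = {}"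
  shows "char_inner C (orbit_char \<Omega>) (orbit_char \<Omega>') = 0"
proof -
  have "char_inner C (orbit_char \<Omega>) (orbit_char \<Omega>') =
    (\<Sum>x\<in>fixed. (\<Sum>\<mu>\<in>\<Omega>. \<Sum>\<nu>\<in>\<Omega>'. \<mu> (cay_inv x) * \<nu> (\<ominus> cay_inv x)))"
    unfolding char_inner_def C_sel
  proof (intro sum.cong refl)
    fix x assume x: "x \<in> fixed"
    then have "cay_inv (inv x) = \<ominus> cay_inv x" using cay_inv_inv by (simp add: fixed_iff)
    then show "orbit_char \<Omega> x * orbit_char \<Omega>' (inv\<^bsub>C\<^esub> x) =
        (\<Sum>\<mu>\<in>\<Omega>. \<Sum>\<nu>\<in>\<Omega>'. \<mu> (cay_inv x) * \<nu> (\<ominus> cay_inv x))"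
      using x fixed_inv[OF x] by (simp add: orbit_char_def inv_C sum_product)
  qed
  also have "\<dots> = (\<Sum>c\<in>skew. (\<Sum>\<mu>\<in>\<Omega>. \<Sum>\<nu>\<in>\<Omega>'. \<mu> c * \<nu> (\<ominus> c)))"
    by (rule sum.reindex_bij_betw[OF cay_inv_bij, of "\<lambda>c. \<Sum>\<mu>\<in>\<Omega>. \<Sum>\<nu>\<in>\<Omega>'. \<mu> c * \<nu> (\<ominus> c)"])
  also have "\<dots> = (\<Sum>\<mu>\<in>\<Omega>. \<Sum>\<nu>\<in>\<Omega>'. \<Sum>c\<in>skew. \<mu> c * \<nu> (\<ominus> c))"
    by (subst sum.swap, intro sum.cong refl, subst sum.swap) simp
  also have "\<dots> = 0"
  proof (rule sum.neutral, rule ballI, rule sum.neutral, rule ballI)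
    fix \<mu> \<nu> assume "\<mu> \<in> \<Omega>" "\<nu> \<in> \<Omega>'"
    then have "\<mu> \<in> inv_chars" "\<nu> \<in> inv_chars" "\<mu> \<noteq> \<nu>" using assms by auto
    then show "(\<Sum>c\<in>skew. \<mu> c * \<nu> (\<ominus> c)) = 0"
      using inv_chars_orthogonal[of \<mu> \<nu>] by simp
  qed
  finally show ?thesis .
qed

text \<open>Multiplication by \<nu> is injective, as \<nu> has no zeros on J; so it permutes S and
  multiplies the sum at c by \<nu>(c).\<close>

lemma inv_chars_sum:
  assumes "finite S" "S \<subseteq> inv_chars" and \<nu>: "\<nu> \<in> S" "\<nu> c \<noteq> 1" and c: "c \<in> J"
    and closed: "\<And>\<mu>. \<mu> \<in> S \<Longrightarrow> (\<lambda>a\<in>J. \<nu> a * \<mu> a) \<in> S"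
  shows "(\<Sum>\<mu>\<in>S. \<mu> c) = 0"
proof -
  let ?f = "\<lambda>\<mu>. \<lambda>a\<in>J. \<nu> a * \<mu> a"
  have inj: "inj_on ?f S"
  proof
    fix \<mu> \<mu>' assume *: "\<mu> \<in> S" "\<mu>' \<in> S" "?f \<mu> = ?f \<mu>'"
    show "\<mu> = \<mu>'"
    proof (rule extensionalityI[of _ J])
      fix a assume a: "a \<in> J"
      have "\<nu> a * \<mu> a = \<nu> a * \<mu>' a" using fun_cong[OF *(3), of a] a by simp
      moreover have "\<nu> a \<noteq> 0" using inv_char_neg[of \<nu> a] \<nu> assms(2) a by fastforce
      ultimately show "\<mu> a = \<mu>' a" by simp
    qed (use * assms(2) in \<open>auto simp: inv_chars_def\<close>)
  qed
  have "?f ` S = S"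
    using closed inj assms(1) by (intro endo_inj_surj) auto
  then have "(\<Sum>\<mu>\<in>S. \<mu> c) = (\<Sum>\<mu>\<in>S. ?f \<mu> c)"
    using inj sum.reindex[OF inj, of "\<lambda>\<mu>. \<mu> c"] by (simp add: o_def)
  also have "\<dots> = \<nu> c * (\<Sum>\<mu>\<in>S. \<mu> c)"
    using c by (simp add: sum_distrib_left)
  finally show ?thesis using \<nu>(2) by simp
qed

end

text \<open>l lives on the whole ring, so additivity applies to products with elements of P and with
  h without membership in J; the orbits record only its restrictions to J.\<close>

locale invariant_character = involutive_algebra_group +
  fixes l :: "'a \<Rightarrow> complex"
  assumes lam_add: "\<lbrakk>a \<in> carrier R; b \<in> carrier R\<rbrakk> \<Longrightarrow> l (a \<oplus> b) = l a * l b"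
    and lam_zero: "l \<zero> = 1"
    and lam_invol: "a \<in> carrier R \<Longrightarrow> l (\<sigma> a) = l (\<ominus> a)"
begin

section \<open>Twisted orbits of an invariant character\<close>

definition "tw z a = z \<otimes> a \<otimes> \<sigma> z"

definition "tw_char z = (\<lambda>a\<in>J. l (tw z a))"

definition "\<Omega> = tw_char ` P"

lemma lam_neg: "a \<in> carrier R \<Longrightarrow> l a * l (\<ominus> a) = 1"
  using lam_add[of a "\<ominus> a"] by (simp add: r_neg lam_zero)

lemma lam_diff: "\<lbrakk>a \<in> carrier R; b \<in> carrier R; l a = l b\<rbrakk> \<Longrightarrow> l (a \<ominus> b) = 1"
  using lam_add[of a "\<ominus> b"] lam_neg[of b] by (simp add: minus_eq)

lemma lam_neg_one_iff: "a \<in> carrier R \<Longrightarrow> l (\<ominus> a) = 1 \<longleftrightarrow> l a = 1"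
  using lam_neg[of a] by auto

lemma lam_neg_invol: "a \<in> carrier R \<Longrightarrow> l (\<ominus> \<sigma> a) = l a"
  using lam_neg[of "\<sigma> a"] lam_neg[of a] lam_invol[of a] invol_closed[of a]
  by (metis mult.commute mult_cancel_left mult_zero_left zero_neq_one)

text \<open>Exchanging the arguments of the form (a, b) -> l(a \<sigma>(b)) inverts its
  value.\<close>

lemma lam_flip:
  assumes "a \<in> carrier R" "b \<in> carrier R"
  shows "l (a \<otimes> \<sigma> b) = l (\<ominus> (b \<otimes> \<sigma> a))"
  using lam_neg_invol[of "a \<otimes> \<sigma> b"] assms invol_closed by (simp add: invol_mult invol_invol)

lemma tw_closed: "\<lbrakk>z \<in> P; a \<in> J\<rbrakk> \<Longrightarrow> tw z a \<in> J"
  unfolding tw_def by (intro JP PJ P_invol)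

lemma tw_tw: "\<lbrakk>z \<in> P; w \<in> P; a \<in> J\<rbrakk> \<Longrightarrow> tw z (tw w a) = tw (z \<otimes> w) a"
  using P_carrier J_carrier invol_closed by (simp add: tw_def invol_mult m_assoc)

lemma tw_char_inv_chars: assumes z: "z \<in> P" shows "tw_char z \<in> inv_chars"
proof -
  note Pc = P_carrier[OF z] invol_closed[OF P_carrier[OF z]]
  have "l (tw z (\<ominus> \<sigma> a)) = l (tw z a)" if a: "a \<in> J" for a
  proof -
    note ac = J_carrier[OF a] invol_closed[OF J_carrier[OF a]]
    have "tw z (\<ominus> \<sigma> a) = \<ominus> \<sigma> (tw z a)"
      using ac Pc by (simp add: tw_def invol_mult invol_invol m_assoc l_minus r_minus)
    then show ?thesis using lam_neg_invol J_carrier[OF tw_closed[OF z a]] by simp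
  qed
  moreover have "l (tw z (a \<oplus> b)) = l (tw z a) * l (tw z b)" if ab: "a \<in> J" "b \<in> J" for a b
    using ab[THEN J_carrier] Pc by (simp add: tw_def l_distr r_distr lam_add)
  moreover have "l (tw z \<zero>) = 1" using Pc by (simp add: tw_def lam_zero)
  ultimately show ?thesis
    using J_add J_neg J_invol J_zero by (simp add: inv_chars_def tw_char_def)
qed

lemma \<Omega>_inv_chars: "\<Omega> \<subseteq> inv_chars"
  using tw_char_inv_chars by (auto simp: \<Omega>_def)

lemma finite_\<Omega>: "finite \<Omega>"
  using finite_P by (simp add: \<Omega>_def)

lemma tw_char_mult:
  assumes "z \<in> P" "w \<in> P"
  shows "tw_char (z \<otimes> w) = (\<lambda>a\<in>J. tw_char z (tw w a))"
  using assms tw_closed[OF assms(2)] by (auto simp: tw_char_def tw_tw restrict_def fun_eq_iff)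

definition "stab_card = card {z \<in> P. tw_char z = tw_char \<one>}"

text \<open>\<open>tw_char (z \<otimes> w)\<close> is \<open>tw_char z\<close> composed with
  \<open>tw w\<close>, so right multiplication by w carries the stabilizer of the restriction of l
  to J onto the fibre of w.\<close>

lemma fiber_card:
  assumes w: "w \<in> P" shows "card {z \<in> P. tw_char z = tw_char w} = stab_card"
proof -
  have cancel: "z \<otimes> u \<otimes> inv u = z" "z \<otimes> inv u \<otimes> u = z" if "z \<in> P" "u \<in> P" for z u
    using that P_carrier P_inv by (simp_all add: m_assoc P_r_inv P_l_inv)
  have "bij_betw (\<lambda>z. z \<otimes> w) {z \<in> P. tw_char z = tw_char \<one>} {z \<in> P. tw_char z = tw_char w}"
  proof (rule bij_betw_byWitness[where f' = "\<lambda>z. z \<otimes> inv w"])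
    show "(\<lambda>z. z \<otimes> w) ` {z \<in> P. tw_char z = tw_char \<one>} \<subseteq> {z \<in> P. tw_char z = tw_char w}"
    proof clarify
      fix z assume z: "z \<in> P" "tw_char z = tw_char \<one>"
      have "tw_char (z \<otimes> w) = tw_char (\<one> \<otimes> w)"
        unfolding tw_char_mult[OF z(1) w] tw_char_mult[OF one_P w] z(2) ..
      then show "z \<otimes> w \<in> P \<and> tw_char (z \<otimes> w) = tw_char w"
        using z w P_carrier by (simp add: P_mult)
    qed
    show "(\<lambda>z. z \<otimes> inv w) ` {z \<in> P. tw_char z = tw_char w} \<subseteq> {z \<in> P. tw_char z = tw_char \<one>}"
    proof clarify
      fix z assume z: "z \<in> P" "tw_char z = tw_char w"
      have "tw_char (z \<otimes> inv w) = tw_char (w \<otimes> inv w)"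
        unfolding tw_char_mult[OF z(1) P_inv[OF w]] tw_char_mult[OF w P_inv[OF w]] z(2) ..
      then show "z \<otimes> inv w \<in> P \<and> tw_char (z \<otimes> inv w) = tw_char \<one>"
        using z w by (simp add: P_mult P_inv P_r_inv)
    qed
  qed (use cancel w in auto)
  then show ?thesis unfolding stab_card_def by (rule bij_betw_same_card[symmetric])
qed

lemma sum_P_orbit:
  assumes "c \<in> J"
  shows "(\<Sum>z\<in>P. l (tw z c)) = of_nat stab_card * (\<Sum>\<mu>\<in>\<Omega>. \<mu> c)"
proof -
  have "(\<Sum>z\<in>P. l (tw z c)) = (\<Sum>z\<in>P. tw_char z c)"
    using assms by (simp add: tw_char_def)
  also have "\<dots> = (\<Sum>\<mu>\<in>\<Omega>. \<Sum>z\<in>{z \<in> P. tw_char z = \<mu>}. tw_char z c)"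
    unfolding \<Omega>_def by (rule sum.image_gen[OF finite_P])
  also have "\<dots> = (\<Sum>\<mu>\<in>\<Omega>. of_nat stab_card * \<mu> c)"
    by (intro sum.cong refl) (auto simp: \<Omega>_def fiber_card)
  finally show ?thesis by (simp add: sum_distrib_left)
qed

lemma card_P_orbit: "card P = stab_card * card \<Omega>"
proof -
  have "card P = (\<Sum>\<mu>\<in>\<Omega>. card {z \<in> P. tw_char z = \<mu>})"
    unfolding \<Omega>_def using sum.image_gen[OF finite_P, of "\<lambda>_. 1::nat" tw_char] by simp
  also have "\<dots> = (\<Sum>\<mu>\<in>\<Omega>. stab_card)"
    by (intro sum.cong refl) (auto simp: \<Omega>_def fiber_card)
  finally show ?thesis by simp
qed

lemma stab_card_pos: "0 < stab_card"
  using one_P finite_P by (auto simp: stab_card_def card_gt_0_iff)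

lemma orbit_sum_tw:
  assumes w: "w \<in> P" and c: "c \<in> J"
  shows "(\<Sum>\<mu>\<in>\<Omega>. \<mu> (tw w c)) = (\<Sum>\<mu>\<in>\<Omega>. \<mu> c)"
proof -
  have cancel: "z \<otimes> u \<otimes> inv u = z" "z \<otimes> inv u \<otimes> u = z" if "z \<in> P" "u \<in> P" for z u
    using that P_carrier P_inv by (simp_all add: m_assoc P_r_inv P_l_inv)
  have "bij_betw (\<lambda>z. z \<otimes> w) P P"
    using w cancel by (intro bij_betw_byWitness[where f' = "\<lambda>z. z \<otimes> inv w"]) (auto simp: P_mult P_inv)
  then have "(\<Sum>z\<in>P. l (tw z c)) = (\<Sum>z\<in>P. l (tw (z \<otimes> w) c))"
    by (rule sum.reindex_bij_betw[symmetric])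
  also have "\<dots> = (\<Sum>z\<in>P. l (tw z (tw w c)))"
    using w c by (simp add: tw_tw)
  finally show ?thesis
    using sum_P_orbit[OF c] sum_P_orbit[OF tw_closed[OF w c]] stab_card_pos by simp
qed

text \<open>The dual of \<open>twisted_conj_J\<close>. With y = \<sigma>(x) w, invariance says
  l(\<sigma>(w) b) = l(b w) for all b in J. This passes to powers of w, in particular to a square
  root v, and \<sigma>(v) x is the element that produces the given character.\<close>

lemma twisted_conj_char:
  assumes xy: "x \<in> P" "y \<in> P"
    and inv: "\<And>a. a \<in> J \<Longrightarrow> l (x \<otimes> (\<ominus> \<sigma> a) \<otimes> y) = l (x \<otimes> a \<otimes> y)"
  shows "(\<lambda>a\<in>J. l (x \<otimes> a \<otimes> y)) \<in> \<Omega>"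
proof -
  note c = xy[THEN P_carrier] invol_closed[OF P_carrier[OF xy(1)]] invol_closed[OF P_carrier[OF xy(2)]]
  define w where "w = inv (\<sigma> x) \<otimes> y"
  have wP: "w \<in> P" using xy by (simp add: w_def P_mult P_inv P_invol)
  note wc = P_carrier[OF wP] invol_closed[OF P_carrier[OF wP]]
  have y: "y = \<sigma> x \<otimes> w"
    using c xy P_inv[OF P_invol[OF xy(1)]] P_invol[OF xy(1)]
    by (simp add: w_def m_assoc[symmetric] P_r_inv P_carrier)
  have sw: "l (\<sigma> w \<otimes> b) = l (b \<otimes> w)" if b: "b \<in> J" for b
  proof -
    \<comment> \<open>Chosen so that x a \<sigma>(x) = b; thus invariance at a yields a statement
      about an arbitrary b in J.\<close>
    define a where "a = inv x \<otimes> b \<otimes> inv (\<sigma> x)"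
    have aJ: "a \<in> J" using b xy by (simp add: a_def JP PJ P_inv P_invol)
    have ac: "a \<in> carrier R" "\<sigma> a \<in> carrier R" using J_carrier[OF aJ] invol_closed by auto
    have bc: "b \<in> carrier R" "\<sigma> b \<in> carrier R" using J_carrier[OF b] invol_closed by auto
    have ix: "inv x \<in> carrier R" "inv (\<sigma> x) \<in> carrier R"
      using xy P_inv P_invol P_carrier by auto
    have "x \<otimes> a \<otimes> \<sigma> x = (x \<otimes> inv x) \<otimes> b \<otimes> (inv (\<sigma> x) \<otimes> \<sigma> x)"
      using c bc ix unfolding a_def by (simp only: m_assoc m_closed)
    also have "\<dots> = b" using xy bc by (simp add: P_r_inv P_l_inv P_invol)
    finally have xa: "x \<otimes> a \<otimes> \<sigma> x = b" .
    have 1: "x \<otimes> a \<otimes> y = b \<otimes> w"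
      using c ac wc by (simp add: y xa[symmetric] m_assoc)
    have "x \<otimes> (\<ominus> \<sigma> a) \<otimes> y = \<ominus> (\<sigma> (x \<otimes> a \<otimes> \<sigma> x) \<otimes> w)"
      using c ac wc by (simp add: y invol_mult invol_invol m_assoc l_minus r_minus)
    also have "\<dots> = \<ominus> \<sigma> (\<sigma> w \<otimes> b)"
      using bc wc by (simp add: xa invol_mult invol_invol)
    finally have "l (x \<otimes> (\<ominus> \<sigma> a) \<otimes> y) = l (\<sigma> w \<otimes> b)"
      using bc wc by (simp add: lam_neg_invol)
    then show ?thesis using inv[OF aJ] 1 by simp
  qed
  \<comment> \<open>Membership in J belongs to the induction, since \<open>sw\<close> is applied to
    \<sigma>(w^k) b.\<close>
  have pow: "l (\<sigma> (w [^] k) \<otimes> b) = l (b \<otimes> w [^] k) \<and> \<sigma> (w [^] k) \<otimes> b \<in> J" if b: "b \<in> J" for b and k :: nat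
    using b
  proof (induction k arbitrary: b)
    case 0
    then show ?case using J_carrier by (simp add: invol_one)
  next
    case (Suc k)
    note bc = J_carrier[OF Suc.prems]
    have e: "\<sigma> (w [^] Suc k) \<otimes> b = \<sigma> w \<otimes> (\<sigma> (w [^] k) \<otimes> b)"
      using bc wc by (simp add: invol_mult m_assoc invol_closed)
    have IH: "\<sigma> (w [^] k) \<otimes> b \<in> J" using Suc by blast
    have bw: "b \<otimes> w \<in> J" by (rule JP[OF Suc.prems wP])
    have "l (\<sigma> (w [^] Suc k) \<otimes> b) = l (\<sigma> (w [^] k) \<otimes> b \<otimes> w)"
      unfolding e by (rule sw[OF IH])
    also have "\<dots> = l (\<sigma> (w [^] k) \<otimes> (b \<otimes> w))"
      using bc wc by (simp add: m_assoc invol_closed)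
    also have "\<dots> = l (b \<otimes> w \<otimes> w [^] k)"
      using Suc.IH[OF bw] by blast
    also have "b \<otimes> w \<otimes> w [^] k = b \<otimes> w [^] Suc k"
      using bc wc nat_pow_Suc2[of w k] by (simp add: m_assoc)
    finally show ?case unfolding e using PJ[OF P_invol[OF wP] IH] e by simp
  qed
  obtain k :: nat where k: "(w [^] k) \<otimes> (w [^] k) = w" "w [^] k \<in> P" using P_sqrt[OF wP] by metis
  define v where "v = w [^] k"
  have v: "v \<in> P" "v \<otimes> v = w" and vs: "\<And>b. b \<in> J \<Longrightarrow> l (\<sigma> v \<otimes> b) = l (b \<otimes> v)"
    using k pow by (auto simp: v_def)
  have vc: "v \<in> carrier R" "\<sigma> v \<in> carrier R" using v P_carrier invol_closed by auto
  have "l (x \<otimes> a \<otimes> y) = l (tw (\<sigma> v \<otimes> x) a)" if a: "a \<in> J" for a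
  proof -
    note ac = J_carrier[OF a]
    have bJ: "x \<otimes> a \<otimes> \<sigma> x \<otimes> v \<in> J" using a xy v by (simp add: JP PJ P_invol)
    have "x \<otimes> a \<otimes> y = (x \<otimes> a \<otimes> \<sigma> x \<otimes> v) \<otimes> v"
      using c vc ac by (simp add: y v(2)[symmetric] m_assoc)
    then have "l (x \<otimes> a \<otimes> y) = l (\<sigma> v \<otimes> (x \<otimes> a \<otimes> \<sigma> x \<otimes> v))"
      using vs[OF bJ] by simp
    also have "\<sigma> v \<otimes> (x \<otimes> a \<otimes> \<sigma> x \<otimes> v) = tw (\<sigma> v \<otimes> x) a"
      using c vc ac by (simp add: tw_def invol_mult invol_invol m_assoc)
    finally show ?thesis .
  qed
  then have "(\<lambda>a\<in>J. l (x \<otimes> a \<otimes> y)) = tw_char (\<sigma> v \<otimes> x)"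
    by (auto simp: tw_char_def restrict_def)
  then show ?thesis
    using v xy by (simp add: \<Omega>_def P_mult P_invol)
qed

end

section \<open>Orbit sums as characters\<close>

text \<open>\<open>I\<close> is a maximal isotropic subgroup, stable under right multiplication, for the alternating
  form \<open>(a, b) \<mapsto> l (a \<otimes> \<sigma> b)\<close> on \<open>J\<close>.\<close>

locale polarization = invariant_character +
  fixes I :: "'a set"
  assumes I_J: "a \<in> I \<Longrightarrow> a \<in> J"
    and I_zero: "\<zero> \<in> I"
    and I_add: "\<lbrakk>a \<in> I; b \<in> I\<rbrakk> \<Longrightarrow> a \<oplus> b \<in> I"
    and I_neg: "a \<in> I \<Longrightarrow> \<ominus> a \<in> I"
    and I_mult: "\<lbrakk>a \<in> I; b \<in> J\<rbrakk> \<Longrightarrow> a \<otimes> b \<in> I"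
    and I_half: "a \<in> I \<Longrightarrow> h \<otimes> a \<in> I"
    and I_isotropic: "\<lbrakk>a \<in> I; b \<in> I\<rbrakk> \<Longrightarrow> l (a \<otimes> \<sigma> b) = 1"
    and I_maximal: "\<lbrakk>a \<in> J; \<And>b. b \<in> I \<Longrightarrow> l (a \<otimes> \<sigma> b) = 1\<rbrakk> \<Longrightarrow> a \<in> I"
    and I_radical: "\<lbrakk>a \<in> I; \<And>c. c \<in> skew \<Longrightarrow> l (a \<otimes> c) = 1; b \<in> J\<rbrakk> \<Longrightarrow> l (a \<otimes> b) = 1"
begin

lemma I_carrier: "a \<in> I \<Longrightarrow> a \<in> carrier R"
  using I_J J_carrier by blast

lemma I_P: "\<lbrakk>a \<in> I; x \<in> P\<rbrakk> \<Longrightarrow> a \<otimes> x \<in> I"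
  using I_carrier J_carrier I_add[OF _ I_mult] by (auto simp: P_def r_distr)

lemma I_minus: "\<lbrakk>a \<in> I; b \<in> I\<rbrakk> \<Longrightarrow> a \<ominus> b \<in> I"
  by (simp add: minus_eq I_add I_neg)

lemma finite_I: "finite I"
  using finite_J I_J by (meson finite_subset subsetI)

section \<open>Cosets of \<open>I\<close> in \<open>P\<close> and the monomial
  representation\<close>

definition "rel z w \<longleftrightarrow> z \<ominus> w \<in> I"

lemma rel_refl: "z \<in> P \<Longrightarrow> rel z z"
  using P_carrier by (simp add: rel_def I_zero minus_eq r_neg)

lemma rel_sym: assumes "z \<in> P" "w \<in> P" "rel z w" shows "rel w z"
proof -
  have "w \<ominus> z = \<ominus> (z \<ominus> w)" using assms P_carrier by (simp add: minus_eq minus_add a_comm)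
  then show ?thesis using assms I_neg by (simp add: rel_def)
qed

lemma rel_trans: assumes "z \<in> P" "w \<in> P" "u \<in> P" "rel z w" "rel w u" shows "rel z u"
proof -
  have "z \<ominus> u = (z \<ominus> w) \<oplus> (w \<ominus> u)"
    using assms P_carrier by (simp add: minus_eq a_assoc r_neg1)
  then show ?thesis using assms I_add by (simp add: rel_def)
qed

lemma minus_mult_distr:
  "\<lbrakk>z \<in> carrier R; w \<in> carrier R; x \<in> carrier R\<rbrakk> \<Longrightarrow> (z \<ominus> w) \<otimes> x = z \<otimes> x \<ominus> w \<otimes> x"
  by (simp add: minus_eq l_distr l_minus)

text \<open>Since \<open>I\<close> absorbs P from the right, right multiplication by elements of P
  permutes the cosets.\<close>

lemma rel_mult: assumes "z \<in> P" "w \<in> P" "x \<in> P" "rel z w" shows "rel (z \<otimes> x) (w \<otimes> x)"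
  using I_P[of "z \<ominus> w" x] assms P_carrier by (simp add: rel_def minus_mult_distr)

definition "repr z = (SOME w. w \<in> P \<and> rel w z)"

definition "T = repr ` P"

lemma repr: assumes "z \<in> P" shows "repr z \<in> P" "rel (repr z) z"
  using someI[of "\<lambda>w. w \<in> P \<and> rel w z" z] rel_refl[OF assms] assms by (auto simp: repr_def)

lemma repr_cong: assumes "z \<in> P" "w \<in> P" "rel z w" shows "repr z = repr w"
proof -
  have "(u \<in> P \<and> rel u z) = (u \<in> P \<and> rel u w)" for u
    using assms rel_trans rel_sym by blast
  then show ?thesis by (simp add: repr_def)
qed

lemma T_P: "A \<in> T \<Longrightarrow> A \<in> P"
  using repr by (auto simp: T_def)

lemma finite_T: "finite T"
  using finite_P by (simp add: T_def)

lemma T_nonempty: "T \<noteq> {}"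
  using one_P by (auto simp: T_def)

lemma T_repr: assumes "A \<in> T" shows "repr A = A"
proof -
  obtain z where z: "z \<in> P" "A = repr z" using assms by (auto simp: T_def)
  then show ?thesis using repr_cong[OF repr(1) _ repr(2)] by blast
qed

lemma T_eq: "\<lbrakk>A \<in> T; B \<in> T; rel A B\<rbrakk> \<Longrightarrow> A = B"
  using repr_cong T_P T_repr by metis

lemma T_add_bij: "bij_betw (\<lambda>(A, b). A \<oplus> b) (T \<times> I) P"
proof (rule bij_betw_byWitness[where f' = "\<lambda>z. (repr z, z \<ominus> repr z)"])
  have *: "repr (A \<oplus> b) = A" if "A \<in> T" "b \<in> I" for A b
  proof -
    have A: "A \<in> P" "A \<oplus> b \<in> P" using that T_P P_add_J I_J by auto
    have "(A \<oplus> b) \<ominus> A = b"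
      using P_carrier[OF A(1)] I_carrier[OF that(2)] by (simp add: minus_eq a_comm[of A b] a_assoc r_neg)
    then have "rel (A \<oplus> b) A" using that by (simp add: rel_def)
    then show ?thesis using repr_cong[OF A(2,1)] T_repr that by simp
  qed
  show "\<forall>a\<in>T \<times> I. (\<lambda>z. (repr z, z \<ominus> repr z)) ((\<lambda>(A, b). A \<oplus> b) a) = a"
  proof clarsimp
    fix A b assume Ab: "A \<in> T" "b \<in> I"
    show "repr (A \<oplus> b) = A \<and> A \<oplus> b \<ominus> repr (A \<oplus> b) = b"
      using *[OF Ab] P_carrier[OF T_P[OF Ab(1)]] I_carrier[OF Ab(2)]
      by (simp add: minus_eq a_comm[of A b] a_assoc r_neg)
  qed
  show "\<forall>z\<in>P. (\<lambda>(A, b). A \<oplus> b) (repr z, z \<ominus> repr z) = z"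
    using repr(1) P_carrier by (simp add: minus_eq a_lcomm r_neg)
  show "(\<lambda>(A, b). A \<oplus> b) ` (T \<times> I) \<subseteq> P"
    using T_P P_add_J I_J by auto
  show "(\<lambda>z. (repr z, z \<ominus> repr z)) ` P \<subseteq> T \<times> I"
    using rel_sym[OF repr(1) _ repr(2)] by (auto simp: T_def rel_def)
qed

lemma card_P_T: "card P = card T * card I"
  using bij_betw_same_card[OF T_add_bij] by (simp add: card_cartesian_product)

text \<open>The matrix of right translation by x on the functions f on P with f(B + b) = l(h b
  \<sigma>(B)) f(B) for b in \<open>I\<close>, expressed by their values on the transversal
  \<open>T\<close>. The only nonzero entry of row A is at the representative B of A x.\<close>

definition "mono_entry x A B = (if rel (A \<otimes> x) B then l (h \<otimes> ((A \<otimes> x \<ominus> B) \<otimes> \<sigma> B)) else 0)"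

lemma isotropic_half: "\<lbrakk>a \<in> I; b \<in> I\<rbrakk> \<Longrightarrow> l (h \<otimes> (a \<otimes> \<sigma> b)) = 1"
  using I_isotropic[OF I_half] I_carrier half_closed invol_closed by (simp add: m_assoc)

text \<open>Because y \<sigma>(y) = 1, the first displacement can be paired with B0 y instead of B0.
  Then the displacements b and e add up, and the cross term l(h b \<sigma>(e)) is trivial by
  isotropy.\<close>

lemma mono_kernel_rep: "kernel_rep C T mono_entry"
  unfolding kernel_rep_def
proof (intro conjI ballI)
  fix x y A E assume "x \<in> carrier C" "y \<in> carrier C" and A: "A \<in> T" and E: "E \<in> T"
  then have xy: "x \<in> P" "y \<in> P" and sy: "\<sigma> y = inv y" by (auto simp: fixed_iff)
  define B0 where "B0 = repr (A \<otimes> x)"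
  note AE = T_P[OF A] T_P[OF E]
  have Ax: "A \<otimes> x \<in> P" using AE xy by (simp add: P_mult)
  have B0: "B0 \<in> T" "B0 \<in> P" "rel (A \<otimes> x) B0"
    using repr[OF Ax] Ax rel_sym[OF _ Ax repr(2)[OF Ax]] by (auto simp: B0_def T_def)
  have uniq: "rel (A \<otimes> x) B \<longleftrightarrow> B = B0" if "B \<in> T" for B
    using that B0 T_eq[of B B0] T_P[OF that] Ax rel_sym rel_trans by blast
  have "(\<Sum>B\<in>T. mono_entry x A B * mono_entry y B E) = (\<Sum>B\<in>T. if B = B0 then mono_entry x A B0 * mono_entry y B0 E else 0)"
    using uniq by (intro sum.cong refl) (auto simp: mono_entry_def)
  also have "\<dots> = mono_entry x A B0 * mono_entry y B0 E"
    using B0 finite_T by simp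
  also have "\<dots> = mono_entry (x \<otimes> y) A E"
  proof -
    note c = AE[THEN P_carrier] xy[THEN P_carrier] P_carrier[OF B0(2)] invol_closed[OF P_carrier[OF xy(2)]]
      invol_closed[OF P_carrier[OF AE(2)]] invol_closed[OF P_carrier[OF B0(2)]]
    have rel_iff: "rel (A \<otimes> (x \<otimes> y)) E \<longleftrightarrow> rel (B0 \<otimes> y) E"
    proof -
      have "rel (A \<otimes> (x \<otimes> y)) (B0 \<otimes> y)"
        using rel_mult[OF Ax B0(2) xy(2) B0(3)] c by (simp add: m_assoc)
      moreover have "A \<otimes> (x \<otimes> y) \<in> P" "B0 \<otimes> y \<in> P" using AE xy B0 by (auto simp: P_mult)
      ultimately show ?thesis using AE(2) rel_trans rel_sym by blast
    qed
    show ?thesis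
    proof (cases "rel (B0 \<otimes> y) E")
      case True
      define b where "b = (A \<otimes> x \<ominus> B0) \<otimes> y"
      define e where "e = B0 \<otimes> y \<ominus> E"
      have bI: "b \<in> I" using B0(3) xy(2) by (simp add: b_def rel_def I_P)
      have eI: "e \<in> I" using True by (simp add: e_def rel_def)
      note be = I_carrier[OF bI] I_carrier[OF eI] invol_closed[OF I_carrier[OF eI]]
      have 1: "(A \<otimes> x \<ominus> B0) \<otimes> \<sigma> B0 = b \<otimes> \<sigma> (B0 \<otimes> y)"
      proof -
        have "b \<otimes> \<sigma> (B0 \<otimes> y) = (A \<otimes> x \<ominus> B0) \<otimes> ((y \<otimes> inv y) \<otimes> \<sigma> B0)"
          unfolding b_def using c by (simp add: invol_mult m_assoc sy[symmetric])
        then show ?thesis using c xy by (simp add: P_r_inv)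
      qed
      have 2: "B0 \<otimes> y = e \<oplus> E" using c by (simp add: e_def minus_eq a_assoc l_neg)
      have 3: "A \<otimes> (x \<otimes> y) \<ominus> E = b \<oplus> e"
      proof -
        have "b \<oplus> e = A \<otimes> x \<otimes> y \<oplus> ((\<ominus> (B0 \<otimes> y)) \<oplus> (B0 \<otimes> y \<oplus> (\<ominus> E)))"
          using c by (simp add: b_def e_def minus_eq l_distr l_minus a_assoc)
        then show ?thesis using c by (simp add: r_neg1 minus_eq m_assoc)
      qed
      have "mono_entry x A B0 = l (h \<otimes> (b \<otimes> \<sigma> (e \<oplus> E)))"
        by (simp add: mono_entry_def B0(3) 1 2)
      moreover have "mono_entry y B0 E = l (h \<otimes> (e \<otimes> \<sigma> E))"
        using True by (simp add: mono_entry_def e_def)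
      ultimately have "mono_entry x A B0 * mono_entry y B0 E = l (h \<otimes> (b \<otimes> \<sigma> (e \<oplus> E))) * l (h \<otimes> (e \<otimes> \<sigma> E))"
        by simp
      also have "\<dots> = l (h \<otimes> (b \<otimes> \<sigma> e)) * (l (h \<otimes> (b \<otimes> \<sigma> E)) * l (h \<otimes> (e \<otimes> \<sigma> E)))"
        using c be half_closed by (simp add: invol_add r_distr lam_add)
      also have "\<dots> = l (h \<otimes> ((b \<oplus> e) \<otimes> \<sigma> E))"
        using c be half_closed isotropic_half[OF bI eI] by (simp add: l_distr r_distr lam_add)
      also have "\<dots> = mono_entry (x \<otimes> y) A E"
        using True rel_iff by (simp add: mono_entry_def 3)
      finally show ?thesis .
    next
      case False
      then show ?thesis using rel_iff by (simp add: mono_entry_def)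
    qed
  qed
  finally show "(\<Sum>B\<in>T. mono_entry x A B * mono_entry y B E) = mono_entry (x \<otimes>\<^bsub>C\<^esub> y) A E" by simp
next
  fix A B assume AB: "A \<in> T" "B \<in> T"
  have "rel A B \<longleftrightarrow> A = B" using AB T_eq rel_refl T_P by blast
  then show "mono_entry \<one>\<^bsub>C\<^esub> A B = (if A = B then 1 else 0)"
    using AB[THEN T_P, THEN P_carrier] half_closed invol_closed by (simp add: mono_entry_def lam_zero r_neg minus_eq)
qed (use finite_T T_nonempty in auto)

text \<open>Expand l((A + b) c \<sigma>(A + b)) with c = \<open>cay_inv x\<close>. The term
  quadratic in b is trivial by isotropy and the two mixed terms agree, so the sum is l(A c
  \<sigma>(A)) times the sum of an additive character of \<open>I\<close>. By maximality that
  character is trivial exactly if A c lies in \<open>I\<close>, and this is the condition that x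
  fixes the coset of A.\<close>

lemma coset_sum:
  assumes x: "x \<in> fixed" and A: "A \<in> T"
  shows "(\<Sum>b\<in>I. l (tw (A \<oplus> b) (cay_inv x))) = of_nat (card I) * mono_entry x A A"
proof -
  define c where "c = cay_inv x"
  have xP: "x \<in> P" using x by (simp add: fixed_iff)
  have AP: "A \<in> P" by (rule T_P[OF A])
  have c: "c \<in> J" "\<sigma> c = \<ominus> c" using cay_inv_skew[OF x] by (auto simp: c_def skew_def)
  note cc = P_carrier[OF xP] P_carrier[OF AP] J_carrier[OF c(1)] invol_closed[OF P_carrier[OF AP]]
  note Ib = I_carrier invol_closed[OF I_carrier]
  have flip: "l (A \<otimes> c \<otimes> \<sigma> b) = l (b \<otimes> c \<otimes> \<sigma> A)" if b: "b \<in> I" for b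
  proof -
    have "l (A \<otimes> c \<otimes> \<sigma> b) = l (\<ominus> (b \<otimes> \<sigma> (A \<otimes> c)))"
      using cc Ib[OF b] by (intro lam_flip) auto
    then show ?thesis using cc Ib[OF b] by (simp add: invol_mult c(2) l_minus r_minus m_assoc)
  qed
  define d where "d = c \<otimes> \<sigma> A \<oplus> c \<otimes> \<sigma> A"
  have dc: "d \<in> carrier R" using cc by (simp add: d_def)
  have expand: "l (tw (A \<oplus> b) c) = l (tw A c) * l (b \<otimes> d)" if b: "b \<in> I" for b
  proof -
    have "tw (A \<oplus> b) c = (A \<otimes> c \<otimes> \<sigma> A \<oplus> b \<otimes> c \<otimes> \<sigma> A) \<oplus> (A \<otimes> c \<otimes> \<sigma> b \<oplus> b \<otimes> c \<otimes> \<sigma> b)"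
      using cc Ib[OF b] by (simp add: tw_def invol_add l_distr r_distr)
    then have "l (tw (A \<oplus> b) c) = l (tw A c) * l (b \<otimes> c \<otimes> \<sigma> A) * (l (A \<otimes> c \<otimes> \<sigma> b) * l (b \<otimes> c \<otimes> \<sigma> b))"
      using cc Ib[OF b] by (simp add: lam_add tw_def)
    also have "l (b \<otimes> c \<otimes> \<sigma> b) = 1" by (intro I_isotropic I_mult b c)
    finally show ?thesis
      using cc Ib[OF b] flip[OF b] by (simp add: d_def r_distr lam_add m_assoc)
  qed
  have d_iff: "(\<forall>b\<in>I. l (b \<otimes> d) = 1) \<longleftrightarrow> A \<otimes> c \<in> I"
  proof
    assume *: "\<forall>b\<in>I. l (b \<otimes> d) = 1"
    show "A \<otimes> c \<in> I"
    proof (rule I_maximal)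
      show "A \<otimes> c \<in> J" by (rule PJ[OF AP c(1)])
      fix b assume b: "b \<in> I"
      have "h \<otimes> b \<otimes> d = (h \<otimes> b \<oplus> h \<otimes> b) \<otimes> (c \<otimes> \<sigma> A)"
        using cc Ib[OF b] half_closed by (simp add: d_def l_distr r_distr)
      then have "h \<otimes> b \<otimes> d = b \<otimes> c \<otimes> \<sigma> A"
        using cc Ib[OF b] by (simp add: half_add m_assoc)
      then show "l (A \<otimes> c \<otimes> \<sigma> b) = 1" using flip[OF b] * I_half[OF b] by metis
    qed
  next
    assume *: "A \<otimes> c \<in> I"
    show "\<forall>b\<in>I. l (b \<otimes> d) = 1"
    proof
      fix b assume b: "b \<in> I"
      have "l (b \<otimes> c \<otimes> \<sigma> A) = 1" using I_isotropic[OF * b] flip[OF b] by simp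
      then show "l (b \<otimes> d) = 1" using cc Ib[OF b] by (simp add: d_def r_distr lam_add m_assoc)
    qed
  qed
  have Ax: "A \<otimes> x \<ominus> A = A \<otimes> (x \<ominus> \<one>)" using cc by (simp add: minus_eq r_distr r_minus)
  have x1: "x \<ominus> \<one> = c \<otimes> x \<oplus> c" using cay_inv_props(1)[OF xP] cc by (simp add: c_def r_distr)
  \<comment> \<open>A x - A = A c (x + 1), and \<open>I\<close> absorbs both x + 1 and its
    inverse.\<close>
  have rel_iff: "rel (A \<otimes> x) A \<longleftrightarrow> A \<otimes> c \<in> I"
  proof
    assume "A \<otimes> c \<in> I"
    then have "A \<otimes> c \<otimes> x \<oplus> A \<otimes> c \<in> I" using I_add I_P xP by blast
    then show "rel (A \<otimes> x) A" using cc by (simp add: rel_def Ax x1 r_distr m_assoc)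
  next
    assume "rel (A \<otimes> x) A"
    then have a: "A \<otimes> (x \<ominus> \<one>) \<in> I" by (simp add: rel_def Ax)
    define y where "y = inv (\<one> \<oplus> h \<otimes> (x \<ominus> \<one>))"
    have y: "y \<in> P" unfolding y_def by (intro P_inv P_I J_half P_minus_one xP)
    have "A \<otimes> c = A \<otimes> (x \<ominus> \<one>) \<otimes> y \<otimes> h"
      unfolding c_def cay_inv_def P_plus_one(2)[OF xP] y_def[symmetric]
      using cc P_carrier[OF y] half_closed by (simp add: m_assoc)
    also have "\<dots> = h \<otimes> (A \<otimes> (x \<ominus> \<one>) \<otimes> y)"
      using cc P_carrier[OF y] by (intro half_comm[symmetric]) auto
    finally show "A \<otimes> c \<in> I" using I_half[OF I_P[OF a y]] by simp
  qed
  \<comment> \<open>From x - 1 = c (x + 1) and x + 1 = (x - 1) + 2, half of A x - A is A c plus half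
    of A c (x - 1). The second part contributes nothing, since A c (x - 1) \<sigma>(A) = A c (x + 1)
    c \<sigma>(A) pairs two elements of \<open>I\<close>, up to sign.\<close>
  have val: "l (tw A c) = mono_entry x A A" if Ac: "A \<otimes> c \<in> I"
  proof -
    define w where "w = h \<otimes> (A \<otimes> c \<otimes> (x \<oplus> \<one>))"
    have "A \<otimes> c \<otimes> x \<oplus> A \<otimes> c \<in> I" using I_add I_P xP Ac by blast
    then have w: "w \<in> I" unfolding w_def using cc by (intro I_half) (simp add: r_distr)
    note wc = I_carrier[OF w]
    have "h \<otimes> (A \<otimes> c \<otimes> (x \<ominus> \<one>) \<otimes> \<sigma> A) = w \<otimes> (c \<otimes> \<sigma> A)"
      unfolding w_def using cay_inv_props(2)[OF xP] cc half_closed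
      by (simp add: c_def[symmetric] m_assoc)
    also have "\<dots> = \<ominus> (w \<otimes> \<sigma> (A \<otimes> c))"
      using cc wc by (simp add: invol_mult c(2) l_minus r_minus)
    finally have 1: "l (h \<otimes> (A \<otimes> c \<otimes> (x \<ominus> \<one>) \<otimes> \<sigma> A)) = 1"
      using lam_neg_one_iff[of "w \<otimes> \<sigma> (A \<otimes> c)"] I_isotropic[OF w Ac] wc cc invol_closed by simp
    have "A \<otimes> x \<ominus> A = A \<otimes> c \<otimes> (x \<ominus> \<one>) \<oplus> (A \<otimes> c \<oplus> A \<otimes> c)"
    proof -
      have "(x \<ominus> \<one>) \<oplus> (\<one> \<oplus> \<one>) = x \<oplus> \<one>"
        using cc by (simp add: minus_eq a_assoc r_neg1)
      then have "A \<otimes> x \<ominus> A = A \<otimes> c \<otimes> ((x \<ominus> \<one>) \<oplus> (\<one> \<oplus> \<one>))"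
        unfolding Ax using cay_inv_props(1)[OF xP] cc by (simp add: c_def[symmetric] m_assoc)
      then show ?thesis using cc by (simp add: r_distr)
    qed
    then have "h \<otimes> ((A \<otimes> x \<ominus> A) \<otimes> \<sigma> A) =
        h \<otimes> (A \<otimes> c \<otimes> (x \<ominus> \<one>) \<otimes> \<sigma> A) \<oplus> (h \<otimes> (A \<otimes> c \<otimes> \<sigma> A) \<oplus> h \<otimes> (A \<otimes> c \<otimes> \<sigma> A))"
      using cc half_closed by (simp add: l_distr r_distr)
    then have "h \<otimes> ((A \<otimes> x \<ominus> A) \<otimes> \<sigma> A) = h \<otimes> (A \<otimes> c \<otimes> (x \<ominus> \<one>) \<otimes> \<sigma> A) \<oplus> tw A c"
      using cc by (simp add: half_add tw_def)
    then have "l (h \<otimes> ((A \<otimes> x \<ominus> A) \<otimes> \<sigma> A)) = l (tw A c)"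
      using 1 cc half_closed by (simp add: lam_add tw_def)
    then show ?thesis using Ac rel_iff by (simp add: mono_entry_def)
  qed
  have "(\<Sum>b\<in>I. l (tw (A \<oplus> b) c)) = l (tw A c) * (\<Sum>b\<in>I. l (b \<otimes> d))"
    using expand by (simp add: sum_distrib_left)
  also have "(\<Sum>b\<in>I. l (b \<otimes> d)) = (if \<forall>b\<in>I. l (b \<otimes> d) = 1 then of_nat (card I) else 0)"
    using finite_I I_carrier dc
    by (intro additive_char_sum) (auto simp: I_add I_neg l_distr lam_add)
  finally show ?thesis
    using val rel_iff by (auto simp: d_iff c_def[symmetric] mono_entry_def)
qed

lemma orbit_char_eq:
  assumes x: "x \<in> fixed"
  shows "of_nat stab_card * orbit_char \<Omega> x = of_nat (card I) * (\<Sum>A\<in>T. mono_entry x A A)"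
proof -
  have c: "cay_inv x \<in> J" using cay_inv_skew[OF x] by (simp add: skew_J)
  have "of_nat stab_card * orbit_char \<Omega> x = (\<Sum>z\<in>P. l (tw z (cay_inv x)))"
    using x sum_P_orbit[OF c] by (simp add: orbit_char_def)
  also have "\<dots> = (\<Sum>(A, b)\<in>T \<times> I. l (tw (A \<oplus> b) (cay_inv x)))"
    using sum.reindex_bij_betw[OF T_add_bij, of "\<lambda>z. l (tw z (cay_inv x))"]
    by (simp add: case_prod_unfold)
  also have "\<dots> = (\<Sum>A\<in>T. \<Sum>b\<in>I. l (tw (A \<oplus> b) (cay_inv x)))"
    by (simp add: sum.cartesian_product)
  also have "\<dots> = (\<Sum>A\<in>T. of_nat (card I) * mono_entry x A A)"
    using coset_sum[OF x] by simp
  finally show ?thesis by (simp add: sum_distrib_left)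
qed

section \<open>Comparison of the stabilizer with the isotropic subgroup\<close>

definition "L = {a \<in> J. \<forall>b\<in>J. l (a \<otimes> b) = 1}"

lemma L_I: "L \<subseteq> I"
  using I_maximal J_invol I_J by (auto simp: L_def)

text \<open>Double counting of l(a \<sigma>(b)) over a in J and b in \<open>I\<close>: the sum over
  b detects whether a lies in \<open>I\<close>, by maximality, and the sum over a detects whether b
  lies in \<open>L\<close>, the radical of the form since \<sigma> permutes J.\<close>

lemma card_I_square: "card I * card I = card J * card L"
proof -
  have 1: "(\<Sum>b\<in>I. l (a \<otimes> \<sigma> b)) = (if a \<in> I then of_nat (card I) else 0)" if a: "a \<in> J" for a
  proof -
    have "(\<Sum>b\<in>I. l (a \<otimes> \<sigma> b)) = (if \<forall>b\<in>I. l (a \<otimes> \<sigma> b) = 1 then of_nat (card I) else 0)"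
      using finite_I I_carrier J_carrier[OF a] invol_closed
      by (intro additive_char_sum) (auto simp: I_add I_neg invol_add r_distr lam_add)
    moreover have "(\<forall>b\<in>I. l (a \<otimes> \<sigma> b) = 1) \<longleftrightarrow> a \<in> I"
      using I_maximal[OF a] I_isotropic by blast
    ultimately show ?thesis by simp
  qed
  have 2: "(\<Sum>a\<in>J. l (a \<otimes> \<sigma> b)) = (if b \<in> L then of_nat (card J) else 0)" if b: "b \<in> I" for b
  proof -
    note bc = I_carrier[OF b]
    have "(\<Sum>a\<in>J. l (a \<otimes> \<sigma> b)) = (if \<forall>a\<in>J. l (a \<otimes> \<sigma> b) = 1 then of_nat (card J) else 0)"
      using finite_J J_carrier bc invol_closed
      by (intro additive_char_sum) (auto simp: J_add J_neg l_distr lam_add)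
    moreover have "(\<forall>a\<in>J. l (a \<otimes> \<sigma> b) = 1) \<longleftrightarrow> b \<in> L"
    proof -
      have "l (a \<otimes> \<sigma> b) = 1 \<longleftrightarrow> l (b \<otimes> \<sigma> a) = 1" if "a \<in> J" for a
        using lam_flip[of a b] lam_neg_one_iff[of "b \<otimes> \<sigma> a"] J_carrier[OF that] bc invol_closed by simp
      moreover have "(\<forall>a\<in>J. l (b \<otimes> \<sigma> a) = 1) \<longleftrightarrow> (\<forall>a\<in>J. l (b \<otimes> a) = 1)"
        using J_invol invol_invol J_carrier by metis
      ultimately show ?thesis using I_J[OF b] by (simp add: L_def)
    qed
    ultimately show ?thesis by simp
  qed
  have LJ: "L \<subseteq> J" by (auto simp: L_def)
  have "of_nat (card I * card I) = (\<Sum>a\<in>J. if a \<in> I then of_nat (card I) else (0::complex))"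
    using I_J finite_J by (simp add: sum.If_cases Int_absorb1 subset_iff)
  also have "\<dots> = (\<Sum>a\<in>J. \<Sum>b\<in>I. l (a \<otimes> \<sigma> b))"
    using 1 by simp
  also have "\<dots> = (\<Sum>b\<in>I. \<Sum>a\<in>J. l (a \<otimes> \<sigma> b))"
    by (rule sum.swap)
  also have "\<dots> = (\<Sum>b\<in>I. if b \<in> L then of_nat (card J) else 0)"
    using 2 by simp
  also have "\<dots> = of_nat (card J * card L)"
    using L_I finite_I by (simp add: sum.If_cases Int_absorb1 mult.commute)
  finally show ?thesis by (simp only: of_nat_eq_iff)
qed

text \<open>Only the part of the orbit reached from elements 1 + a with a in \<open>I\<close> is
  counted. At a skew c such a character has the value l(c) l(a c)^2, so equal characters force l((a
  - a0) c) = 1 for all skew c; by \<open>I_radical\<close>, a and a0 then differ by an element of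
  \<open>L\<close>.\<close>

lemma card_I_le: "card I \<le> card \<Omega> * card L"
proof -
  let ?f = "\<lambda>a. tw_char (\<one> \<oplus> a)"
  have fib: "card {a \<in> I. ?f a = \<mu>} \<le> card L" if \<mu>: "\<mu> \<in> ?f ` I" for \<mu>
  proof -
    obtain a0 where a0: "a0 \<in> I" "\<mu> = ?f a0" using \<mu> by blast
    have exp: "l (tw (\<one> \<oplus> a) c) = l c * (l (a \<otimes> c) * l (a \<otimes> c))" if a: "a \<in> I" and c: "c \<in> skew" for a c
    proof -
      have cJ: "c \<in> J" "\<sigma> c = \<ominus> c" using c by (auto simp: skew_def)
      note cc = I_carrier[OF a] J_carrier[OF cJ(1)] invol_closed[OF I_carrier[OF a]]
      have "tw (\<one> \<oplus> a) c = (c \<oplus> a \<otimes> c) \<oplus> (c \<otimes> \<sigma> a \<oplus> a \<otimes> c \<otimes> \<sigma> a)"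
        using cc by (simp add: tw_def invol_add invol_one l_distr r_distr)
      then have "l (tw (\<one> \<oplus> a) c) = l c * l (a \<otimes> c) * (l (c \<otimes> \<sigma> a) * l (a \<otimes> c \<otimes> \<sigma> a))"
        using cc by (simp add: lam_add)
      moreover have "l (c \<otimes> \<sigma> a) = l (a \<otimes> c)"
        using lam_flip[of c a] cc by (simp add: cJ(2) r_minus)
      moreover have "l (a \<otimes> c \<otimes> \<sigma> a) = 1" by (intro I_isotropic I_mult a cJ)
      ultimately show ?thesis by simp
    qed
    have sub: "{a \<in> I. ?f a = \<mu>} \<subseteq> (\<lambda>d. d \<oplus> a0) ` L"
    proof
      fix a assume "a \<in> {a \<in> I. ?f a = \<mu>}"
      then have a: "a \<in> I" "?f a = \<mu>" by auto
      note ac = I_carrier[OF a(1)] I_carrier[OF a0(1)]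
      have "l (a \<otimes> c) = l (a0 \<otimes> c)" if c: "c \<in> skew" for c
      proof -
        \<comment> \<open>Evaluation at half of c undoes the square in \<open>exp\<close>.\<close>
        have hc: "h \<otimes> c \<in> skew" by (rule skew_half[OF c])
        have cc: "c \<in> carrier R" using c by (simp add: skew_J J_carrier)
        have sq: "l (b \<otimes> (h \<otimes> c)) * l (b \<otimes> (h \<otimes> c)) = l (b \<otimes> c)" if "b \<in> carrier R" for b
        proof -
          have "l (b \<otimes> (h \<otimes> c)) * l (b \<otimes> (h \<otimes> c)) = l (b \<otimes> (h \<otimes> c \<oplus> h \<otimes> c))"
            using that cc half_closed by (simp add: r_distr lam_add)
          then show ?thesis using cc by (simp add: half_add)
        qed
        have "tw_char (\<one> \<oplus> a) (h \<otimes> c) = tw_char (\<one> \<oplus> a0) (h \<otimes> c)" using a a0 by simp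
        then have "l (h \<otimes> c) * l (a \<otimes> c) = l (h \<otimes> c) * l (a0 \<otimes> c)"
          using hc ac exp[OF a(1) hc] exp[OF a0(1) hc] by (simp add: tw_char_def skew_J sq)
        moreover have "l (h \<otimes> c) \<noteq> 0" using lam_neg[of "h \<otimes> c"] cc half_closed by auto
        ultimately show ?thesis by simp
      qed
      then have "l ((a \<ominus> a0) \<otimes> c) = 1" if "c \<in> skew" for c
        using that ac J_carrier[OF skew_J[OF that]] by (simp add: minus_mult_distr lam_diff)
      then have "a \<ominus> a0 \<in> L"
        using I_radical[of "a \<ominus> a0"] I_minus[OF a(1) a0(1)] I_J by (auto simp: L_def)
      moreover have "a = (a \<ominus> a0) \<oplus> a0" using ac by (simp add: minus_eq a_assoc l_neg)
      ultimately show "a \<in> (\<lambda>d. d \<oplus> a0) ` L" by blast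
    qed
    have "finite L" using finite_I L_I finite_subset by blast
    then show ?thesis
      using card_mono[OF _ sub] card_image_le[of L "\<lambda>d. d \<oplus> a0"] by fastforce
  qed
  have "card I = (\<Sum>\<mu>\<in>?f ` I. card {a \<in> I. ?f a = \<mu>})"
    using sum.image_gen[OF finite_I, of "\<lambda>_. 1::nat" ?f] by simp
  also have "\<dots> \<le> card (?f ` I) * card L"
    using sum_bounded_above[of "?f ` I" "\<lambda>\<mu>. card {a \<in> I. ?f a = \<mu>}" "card L"] fib by simp
  also have "\<dots> \<le> card \<Omega> * card L"
    using P_I I_J finite_\<Omega> by (intro mult_right_mono card_mono) (auto simp: \<Omega>_def)
  finally show ?thesis .
qed

text \<open>|I|^2 = |J| |L| = \<open>stab_card\<close> |\<Omega>| |L| together with |I| \<le>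
  |\<Omega>| |L| gives \<open>stab_card\<close> \<le> |I|. Both are powers of p, so the inequality
  is a divisibility.\<close>

lemma stab_card_dvd: "stab_card dvd card I"
proof -
  have "stab_card dvd p ^ N" using card_P_orbit card_P by (metis dvd_triv_left)
  then obtain i where i: "stab_card = p ^ i" using divides_primepow_nat[OF prime_p] by blast
  have "card I dvd p ^ N" using card_P_T card_P by (metis dvd_triv_right)
  then obtain j where j: "card I = p ^ j" using divides_primepow_nat[OF prime_p] by blast
  have "card I * card I = stab_card * card \<Omega> * card L"
    using card_I_square card_P_orbit card_P card_J by simp
  then have "stab_card * card I \<le> card I * card I"
    using card_I_le by (simp add: mult.assoc)
  moreover have "0 < card I" using I_zero finite_I by (auto simp: card_gt_0_iff)
  ultimately have "stab_card \<le> card I" by (rule mult_right_le_imp_le)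
  then have "p ^ i \<le> p ^ j" by (simp only: i j)
  then have "i \<le> j" using prime_p prime_gt_1_nat power_le_imp_le_exp by blast
  then show ?thesis by (simp add: i j le_imp_power_dvd)
qed

text \<open>Cancelling \<open>stab_card\<close> leaves |I| / \<open>stab_card\<close> copies of the
  monomial representation.\<close>

theorem orbit_char_character: "orbit_char \<Omega> \<in> characters C"
proof -
  obtain m where m: "card I = stab_card * m" using stab_card_dvd by blast
  have "0 < card I" using I_zero finite_I by (auto simp: card_gt_0_iff)
  then have m0: "0 < m" using m by (cases m) auto
  have "(\<Sum>A\<in>T \<times> {..<m}. (\<lambda>(A, i) (B, j). if i = j then mono_entry x A B else 0) A A) = orbit_char \<Omega> x"
    if x: "x \<in> fixed" for x
  proof -
    have "of_nat stab_card * orbit_char \<Omega> x = of_nat stab_card * (of_nat m * (\<Sum>A\<in>T. mono_entry x A A))"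
      using orbit_char_eq[OF x] m by simp
    then have "orbit_char \<Omega> x = of_nat m * (\<Sum>A\<in>T. mono_entry x A A)"
      using stab_card_pos by simp
    also have "\<dots> = (\<Sum>A\<in>T. \<Sum>i<m. mono_entry x A A)" by (simp add: sum_distrib_left)
    also have "\<dots> = (\<Sum>A\<in>T \<times> {..<m}. (\<lambda>(A, i) (B, j). if i = j then mono_entry x A B else 0) A A)"
      unfolding sum.cartesian_product by (intro sum.cong refl) auto
    finally show ?thesis by simp
  qed
  then have "orbit_char \<Omega> = (\<lambda>x\<in>carrier C.
      \<Sum>A\<in>T \<times> {..<m}. (\<lambda>(A, i) (B, j). if i = j then mono_entry x A B else 0) A A)"
    by (auto simp: orbit_char_def restrict_def fun_eq_iff)
  then show ?thesis
    using kernel_rep_character[OF group_C kernel_rep_multiple[OF mono_kernel_rep m0]] by simp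
qed

end

section \<open>Unitriangular matrices\<close>

lemma mat_mult_entry:
  fixes A B :: "'c::semiring_0 mat"
  assumes "A \<in> carrier_mat m n" "B \<in> carrier_mat n k" "i < m" "j < k"
  shows "(A * B) $$ (i, j) = (\<Sum>l<n. A $$ (i, l) * B $$ (l, j))"
  using assms by (simp add: scalar_prod_def atLeast0LessThan)

lemma mat_mult_closed: "\<lbrakk>a \<in> carrier_mat n n; b \<in> carrier_mat n n\<rbrakk> \<Longrightarrow> a * b \<in> carrier_mat n n"
  by (rule mult_carrier_mat)

lemma mat_assoc:
  "\<lbrakk>a \<in> carrier_mat n n; b \<in> carrier_mat n n; c \<in> carrier_mat n n\<rbrakk> \<Longrightarrow> a * b * c = a * (b * c)"
  by (rule assoc_mult_mat)

lemma UT_iff: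
  "x \<in> UT n \<longleftrightarrow> x \<in> carrier_mat n n \<and> (\<forall>i<n. x $$ (i, i) = 1) \<and> (\<forall>i<n. \<forall>j<i. x $$ (i, j) = 0)"
proof
  assume "x \<in> UT n"
  then show "x \<in> carrier_mat n n \<and> (\<forall>i<n. x $$ (i, i) = 1) \<and> (\<forall>i<n. \<forall>j<i. x $$ (i, j) = 0)"
    by (auto simp: UT_def strict_upper_def)
next
  assume x: "x \<in> carrier_mat n n \<and> (\<forall>i<n. x $$ (i, i) = 1) \<and> (\<forall>i<n. \<forall>j<i. x $$ (i, j) = 0)"
  then have "x - 1\<^sub>m n \<in> strict_upper n"
    by (auto simp: strict_upper_def dest: le_neq_implies_less)
  moreover have "x = 1\<^sub>m n + (x - 1\<^sub>m n)"
    using x by (intro eq_matI) auto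
  ultimately show "x \<in> UT n" by (auto simp: UT_def)
qed

lemma UT_carrier: "x \<in> UT n \<Longrightarrow> x \<in> carrier_mat n n"
  by (simp add: UT_iff)

lemma UT_one: "1\<^sub>m n \<in> UT n"
  by (simp add: UT_iff)

lemma strict_upper_carrier: "a \<in> strict_upper n \<Longrightarrow> a \<in> carrier_mat n n"
  by (simp add: strict_upper_def)

lemma strict_upper_mult:
  assumes a: "a \<in> strict_upper n" and b: "b \<in> strict_upper n"
  shows "a * b \<in> strict_upper n"
proof -
  note c = a[THEN strict_upper_carrier] b[THEN strict_upper_carrier]
  have "(a * b) $$ (i, j) = 0" if ij: "i < n" "j < n" "j \<le> i" for i j
  proof -
    have "a $$ (i, l) * b $$ (l, j) = 0" if "l < n" for l
      using a b ij that by (cases "l \<le> i") (auto simp: strict_upper_def)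
    then show ?thesis
      unfolding mat_mult_entry[OF c ij(1,2)] by (intro sum.neutral) auto
  qed
  then show ?thesis using c by (auto simp: strict_upper_def)
qed

lemma UT_mult:
  assumes x: "x \<in> UT n" and y: "y \<in> UT n"
  shows "x * y \<in> UT n"
proof -
  note c = x[THEN UT_carrier] y[THEN UT_carrier]
  have "(x * y) $$ (i, j) = (if i = j then 1 else 0)" if ij: "i < n" "j \<le> i" for i j
  proof -
    have "(x * y) $$ (i, j) = (\<Sum>l<n. if l = i then (if i = j then 1 else 0) else 0)"
      unfolding mat_mult_entry[OF c ij(1) le_less_trans[OF ij(2,1)]]
    proof (intro sum.cong refl)
      fix l assume "l \<in> {..<n}"
      then show "x $$ (i, l) * y $$ (l, j) = (if l = i then (if i = j then 1 else 0) else 0)"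
        using x y ij by (cases l i rule: linorder_cases) (auto simp: UT_iff)
    qed
    then show ?thesis using ij by simp
  qed
  then show ?thesis using c by (simp add: UT_iff)
qed

lemma UT_Units:
  fixes x :: "'k::field mat"
  assumes "x \<in> UT n" shows "x \<in> Units (ring_mat TYPE('k) n ())"
proof -
  have "det x = prod_list (diag_mat x)"
    using assms by (intro det_upper_triangular[of _ n]) (auto simp: UT_iff)
  also have "diag_mat x = replicate n 1"
    using assms by (intro nth_equalityI) (auto simp: diag_mat_def UT_iff)
  finally have "det x \<noteq> 0" by simp
  then show ?thesis
    by (rule det_non_zero_imp_unit[OF UT_carrier[OF assms]])
qed

lemma finite_carrier_mat: "finite (carrier_mat n m :: 'k::finite mat set)"
proof -
  have "carrier_mat n m \<subseteq> (\<lambda>f. mat n m f) ` (({..<n} \<times> {..<m}) \<rightarrow>\<^sub>E (UNIV :: 'k set))"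
  proof
    fix a :: "'k mat" assume a: "a \<in> carrier_mat n m"
    have "a = mat n m (restrict (\<lambda>ij. a $$ ij) ({..<n} \<times> {..<m}))"
      using a by (intro eq_matI) auto
    then show "a \<in> (\<lambda>f. mat n m f) ` (({..<n} \<times> {..<m}) \<rightarrow>\<^sub>E (UNIV :: 'k set))"
      by (rule image_eqI[where x = "restrict (\<lambda>ij. a $$ ij) ({..<n} \<times> {..<m})"]) auto
  qed
  moreover have "finite (({..<n} \<times> {..<m}) \<rightarrow>\<^sub>E (UNIV :: 'k set))"
    by (intro finite_PiE) auto
  ultimately show ?thesis by (meson finite_imageI finite_subset)
qed

lemma card_strict_upper:
  "card (strict_upper n :: 'k::{field,finite} mat set) = card (UNIV :: 'k set) ^ card {(i, j). i < j \<and> j < n}"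
proof -
  let ?S = "{(i, j). i < j \<and> j < n}"
  have fin: "finite ?S" by (rule finite_subset[of _ "{..<n} \<times> {..<n}"]) auto
  have "bij_betw (\<lambda>a. \<lambda>ij\<in>?S. a $$ ij) (strict_upper n :: 'k mat set) (?S \<rightarrow>\<^sub>E UNIV)"
  proof (rule bij_betw_byWitness[where f' = "\<lambda>f. mat n n (\<lambda>ij. if ij \<in> ?S then f ij else 0)"])
    show "\<forall>a\<in>strict_upper n. mat n n (\<lambda>ij. if ij \<in> ?S then (\<lambda>ij\<in>?S. a $$ ij) ij else 0) = a"
      by (intro ballI eq_matI) (auto simp: strict_upper_def not_less)
    show "\<forall>f\<in>?S \<rightarrow>\<^sub>E (UNIV :: 'k set). (\<lambda>ij\<in>?S. mat n n (\<lambda>ij. if ij \<in> ?S then f ij else 0) $$ ij) = f"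
      by (auto simp: fun_eq_iff PiE_def extensional_def)
  qed (auto simp: strict_upper_def split: if_splits)
  then have "card (strict_upper n :: 'k mat set) = card (?S \<rightarrow>\<^sub>E (UNIV :: 'k set))"
    by (rule bij_betw_same_card)
  then show ?thesis using fin by (simp add: card_PiE)
qed

text \<open>By finiteness, left multiplication by a unitriangular matrix permutes the unitriangular matrices.\<close>

lemma UT_right_inverse:
  fixes x :: "'k::{field,finite} mat"
  assumes x: "x \<in> UT n"
  shows "\<exists>y\<in>UT n. x * y = 1\<^sub>m n"
proof -
  obtain z where z: "z \<in> carrier_mat n n" "z * x = 1\<^sub>m n"
    using UT_Units[OF x] by (auto simp: Units_def ring_mat_simps)
  have "inj_on (\<lambda>y. x * y) (UT n)"
  proof
    fix y y' assume y: "y \<in> UT n" "y' \<in> UT n" "x * y = x * y'"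
    have "z * (x * y) = y" if "y \<in> UT n" for y
      using that x z
      by (simp add: mat_assoc[where n = n, symmetric] UT_carrier left_mult_one_mat[of _ n n])
    from this[OF y(1)] this[OF y(2)] show "y = y'" unfolding y(3) by (rule trans[OF sym])
  qed
  moreover have "finite (UT n :: 'k mat set)"
    by (rule finite_subset[OF _ finite_carrier_mat[of n n]]) (auto simp: UT_carrier)
  moreover have "(\<lambda>y. x * y) ` UT n \<subseteq> UT n"
    using UT_mult[OF x] by auto
  ultimately have "(\<lambda>y. x * y) ` UT n = UT n"
    by (simp add: endo_inj_surj)
  then have "1\<^sub>m n \<in> (\<lambda>y. x * y) ` UT n" using UT_one by simp
  then show ?thesis by auto
qed


section \<open>Bruhat decomposition\<close>

text \<open>The state of the elimination after k columns. Zero rows and columns are allowed, so at k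
  = n this is a partial permutation matrix with arbitrary nonzero values.\<close>

definition monomial_upto :: "nat \<Rightarrow> nat \<Rightarrow> 'k::zero mat \<Rightarrow> bool" where
  "monomial_upto n k e \<longleftrightarrow> e \<in> carrier_mat n n \<and>
     (\<forall>i<n. \<forall>j<k. \<forall>j'<k. e $$ (i, j) \<noteq> 0 \<longrightarrow> e $$ (i, j') \<noteq> 0 \<longrightarrow> j = j') \<and>
     (\<forall>i<n. \<forall>i'<n. \<forall>j<k. e $$ (i, j) \<noteq> 0 \<longrightarrow> e $$ (i', j) \<noteq> 0 \<longrightarrow> i = i')"

abbreviation monomial_mat :: "nat \<Rightarrow> 'k::zero mat \<Rightarrow> bool" where
  "monomial_mat n \<equiv> monomial_upto n n"

lemma monomial_row:
  assumes "monomial_upto n k e"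
  shows "\<lbrakk>i < n; j < k; j' < k; e $$ (i, j) \<noteq> 0; e $$ (i, j') \<noteq> 0\<rbrakk> \<Longrightarrow> j = j'"
  using assms unfolding monomial_upto_def by blast

lemma monomial_col:
  assumes "monomial_upto n k e"
  shows "\<lbrakk>i < n; i' < n; j < k; e $$ (i, j) \<noteq> 0; e $$ (i', j) \<noteq> 0\<rbrakk> \<Longrightarrow> i = i'"
  using assms unfolding monomial_upto_def by blast

lemma column_operation:
  fixes b :: "'k::field mat" and v :: "nat \<Rightarrow> 'k"
  assumes b: "b \<in> carrier_mat n n" and k: "k < n"
  defines "y \<equiv> mat n n (\<lambda>(i, j). if i = j then 1 else if j = k \<and> i < k then v i else 0)"
  shows "y \<in> UT n"
    and "\<lbrakk>r < n; c < n; c \<noteq> k\<rbrakk> \<Longrightarrow> (b * y) $$ (r, c) = b $$ (r, c)"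
    and "r < n \<Longrightarrow> (b * y) $$ (r, k) = b $$ (r, k) + (\<Sum>l<k. b $$ (r, l) * v l)"
proof -
  show "y \<in> UT n" by (auto simp: UT_iff y_def)
  have yc: "y \<in> carrier_mat n n" by (simp add: y_def)
  show "(b * y) $$ (r, c) = b $$ (r, c)" if "r < n" "c < n" "c \<noteq> k"
  proof -
    have "(b * y) $$ (r, c) = (\<Sum>l<n. if l = c then b $$ (r, c) else 0)"
      unfolding mat_mult_entry[OF b yc that(1,2)]
      using that by (intro sum.cong refl) (auto simp: y_def)
    then show ?thesis using that by simp
  qed
  show "(b * y) $$ (r, k) = b $$ (r, k) + (\<Sum>l<k. b $$ (r, l) * v l)" if r: "r < n"
  proof -
    have "(b * y) $$ (r, k) = (\<Sum>l<n. (if l = k then b $$ (r, k) else 0) + (if l < k then b $$ (r, l) * v l else 0))"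
      unfolding mat_mult_entry[OF b yc r k]
      using k by (intro sum.cong refl) (auto simp: y_def)
    also have "\<dots> = b $$ (r, k) + (\<Sum>l<n. if l < k then b $$ (r, l) * v l else 0)"
      using k by (simp add: sum.distrib)
    also have "(\<Sum>l<n. if l < k then b $$ (r, l) * v l else 0) = (\<Sum>l<k. b $$ (r, l) * v l)"
      using k by (intro sum.mono_neutral_cong_right) auto
    finally show ?thesis .
  qed
qed

lemma row_operation:
  fixes b :: "'k::field mat" and w :: "nat \<Rightarrow> 'k"
  assumes b: "b \<in> carrier_mat n n" and k: "k < n"
  defines "x \<equiv> mat n n (\<lambda>(i, j). if i = j then 1 else if j = k \<and> i < k then w i else 0)"
  shows "x \<in> UT n"
    and "\<lbrakk>r < n; c < n\<rbrakk> \<Longrightarrow> (x * b) $$ (r, c) = b $$ (r, c) + (if r < k then w r * b $$ (k, c) else 0)"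
proof -
  show "x \<in> UT n" by (auto simp: UT_iff x_def)
  have xc: "x \<in> carrier_mat n n" by (simp add: x_def)
  show "(x * b) $$ (r, c) = b $$ (r, c) + (if r < k then w r * b $$ (k, c) else 0)" if rc: "r < n" "c < n"
  proof -
    have "(x * b) $$ (r, c) = (\<Sum>l<n. (if l = r then b $$ (r, c) else 0) +
        (if l = k then (if r < k then w r * b $$ (k, c) else 0) else 0))"
      unfolding mat_mult_entry[OF xc b rc]
      using rc k by (intro sum.cong refl) (auto simp: x_def)
    then show ?thesis using rc k by (simp add: sum.distrib)
  qed
qed

text \<open>\<open>i0\<close> is the row of the new pivot. If the new column is zero, it may be any
  index, since \<open>new\<close> and \<open>zero\<close> are vacuous.\<close>

lemma monomial_upto_SucI:
  assumes b: "monomial_upto n k b" and e: "e \<in> carrier_mat n n"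
    and low: "\<And>i j. \<lbrakk>i < n; j < k\<rbrakk> \<Longrightarrow> e $$ (i, j) = b $$ (i, j)"
    and new: "\<And>i. \<lbrakk>i < n; e $$ (i, k) \<noteq> 0\<rbrakk> \<Longrightarrow> i = i0"
    and zero: "\<And>j. \<lbrakk>i0 < n; j < k; e $$ (i0, k) \<noteq> 0\<rbrakk> \<Longrightarrow> b $$ (i0, j) = 0"
  shows "monomial_upto n (Suc k) e"
proof -
  note row = monomial_row[OF b] and col = monomial_col[OF b]
  have mixed: False if "i < n" "j < k" "e $$ (i, j) \<noteq> 0" "e $$ (i, k) \<noteq> 0" for i j
    using low[OF that(1,2)] new[OF that(1,4)] zero[of j] that by simp
  show ?thesis
    unfolding monomial_upto_def
  proof (intro conjI allI impI)
    fix i j j' assume h: "i < n" "j < Suc k" "j' < Suc k" "e $$ (i, j) \<noteq> 0" "e $$ (i, j') \<noteq> 0"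
    then consider "j < k" "j' < k" | "j = k" "j' < k" | "j < k" "j' = k" | "j = k" "j' = k"
      by linarith
    then show "j = j'"
      using h row[of i j j'] low mixed[of i j] mixed[of i j'] by cases auto
  next
    fix i i' j assume h: "i < n" "i' < n" "j < Suc k" "e $$ (i, j) \<noteq> 0" "e $$ (i', j) \<noteq> 0"
    then show "i = i'"
      using new[of i] new[of i'] low col[of i i' j] by (cases "j = k") auto
  qed (rule e)
qed

text \<open>Earlier columns clear column k in all rows that already carry a pivot. The lowest
  surviving entry becomes the new pivot and clears what is above it; its row is zero in the first k
  columns, so these are not disturbed.\<close>

lemma monomial_step:
  fixes b :: "'k::field mat"
  assumes b: "monomial_upto n k b" and k: "k < n"
  shows "\<exists>x\<in>UT n. \<exists>y\<in>UT n. monomial_upto n (Suc k) (x * b * y)"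
proof -
  note row = monomial_row[OF b] and col = monomial_col[OF b]
  have bc: "b \<in> carrier_mat n n" using b by (simp add: monomial_upto_def)
  \<comment> \<open>At most one summand is nonzero, namely that of the pivot row of column j;
    without a pivot the coefficient is 0.\<close>
  define v where "v j = (\<Sum>i<n. if b $$ (i, j) \<noteq> 0 then - b $$ (i, k) / b $$ (i, j) else 0)" for j
  define y where "y = mat n n (\<lambda>(i, j). if i = j then 1 else if j = k \<and> i < k then v i else 0)"
  note yp = column_operation[OF bc k, where v = v, folded y_def]
  define b1 where "b1 = b * y"
  have b1c: "b1 \<in> carrier_mat n n" using bc yp(1) UT_carrier by (auto simp: b1_def intro: mat_mult_closed)
  have same: "b1 $$ (r, c) = b $$ (r, c)" if "r < n" "c < k" for r c
    using yp(2)[of r c] that k by (simp add: b1_def)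
  have killed: "b1 $$ (r, k) = 0" if r: "r < n" and j: "j < k" "b $$ (r, j) \<noteq> 0" for r j
  proof -
    have "v j = (\<Sum>i<n. if i = r then - b $$ (r, k) / b $$ (r, j) else 0)"
      unfolding v_def
    proof (intro sum.cong refl)
      fix i assume "i \<in> {..<n}"
      then show "(if b $$ (i, j) \<noteq> 0 then - b $$ (i, k) / b $$ (i, j) else 0) =
          (if i = r then - b $$ (r, k) / b $$ (r, j) else 0)"
        using col[of i r j] r j by (cases "i = r") auto
    qed
    then have vj: "v j = - b $$ (r, k) / b $$ (r, j)" using r by simp
    have "(\<Sum>l<k. b $$ (r, l) * v l) = (\<Sum>l<k. if l = j then b $$ (r, j) * v j else 0)"
    proof (intro sum.cong refl)
      fix l assume "l \<in> {..<k}"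
      then show "b $$ (r, l) * v l = (if l = j then b $$ (r, j) * v j else 0)"
        using row[of r l j] r j by (cases "l = j") auto
    qed
    also have "\<dots> = - b $$ (r, k)" using j vj by simp
    finally show ?thesis using yp(3)[OF r] by (simp add: b1_def)
  qed
  show ?thesis
  proof (cases "\<exists>i<n. b1 $$ (i, k) \<noteq> 0")
    case False
    then have "monomial_upto n (Suc k) b1"
      by (intro monomial_upto_SucI[OF b b1c same, of 0]) auto
    moreover have "b1 = 1\<^sub>m n * b * y" using bc by (simp add: b1_def)
    ultimately show ?thesis using yp(1) UT_one by metis
  next
    case True
    \<comment> \<open>The maximum, because unitriangular row operations add lower rows to higher
      ones only.\<close>
    define i0 where "i0 = Max {i. i < n \<and> b1 $$ (i, k) \<noteq> 0}"
    have "i0 \<in> {i. i < n \<and> b1 $$ (i, k) \<noteq> 0}" unfolding i0_def using True by (intro Max_in) auto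
    then have i0: "i0 < n" "b1 $$ (i0, k) \<noteq> 0" by auto
    have above: "b1 $$ (i, k) = 0" if "i < n" "i0 < i" for i
    proof (rule ccontr)
      assume "b1 $$ (i, k) \<noteq> 0"
      then have "i \<le> i0" unfolding i0_def using that by (intro Max_ge) auto
      then show False using that by simp
    qed
    have zero: "b1 $$ (i0, c) = 0" if "c < k" for c
      using killed[OF i0(1) that] same[OF i0(1) that] i0(2) by auto
    define w where "w i = - b1 $$ (i, k) / b1 $$ (i0, k)" for i
    define x where "x = mat n n (\<lambda>(i, j). if i = j then 1 else if j = i0 \<and> i < i0 then w i else 0)"
    note xp = row_operation[OF b1c i0(1), where w = w, folded x_def]
    have low: "(x * b1) $$ (r, c) = b $$ (r, c)" if "r < n" "c < k" for r c
      using xp(2)[of r c] that k zero same by simp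
    have new: "(x * b1) $$ (r, k) = (if r = i0 then b1 $$ (i0, k) else 0)" if "r < n" for r
      using xp(2)[OF that k] above[OF that] i0 by (cases r i0 rule: linorder_cases) (auto simp: w_def)
    have bi0: "b $$ (i0, c) = 0" if "c < k" for c
      using zero[OF that] same[OF i0(1) that] by simp
    have "x * b1 \<in> carrier_mat n n" using xp(1) b1c UT_carrier by (auto intro: mat_mult_closed)
    then have "monomial_upto n (Suc k) (x * b1)"
      by (rule monomial_upto_SucI[OF b _ low, of i0]) (auto simp: new bi0 split: if_splits)
    moreover have "x * b1 = x * b * y"
      using xp(1) yp(1) bc by (simp add: b1_def UT_carrier mat_assoc[where n = n])
    ultimately show ?thesis using xp(1) yp(1) by metis
  qed
qed

lemma monomial_form:
  fixes m :: "'k::field mat"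
  assumes m: "m \<in> carrier_mat n n"
  obtains x y where "x \<in> UT n" "y \<in> UT n" "monomial_mat n (x * m * y)"
proof -
  have "\<exists>x\<in>UT n. \<exists>y\<in>UT n. monomial_upto n k (x * m * y)" if "k \<le> n" for k
    using that
  proof (induction k)
    case 0
    then show ?case
      using m UT_one[of n] by (intro bexI[of _ "1\<^sub>m n"]) (auto simp: monomial_upto_def)
  next
    case (Suc k)
    then obtain x y where xy: "x \<in> UT n" "y \<in> UT n" "monomial_upto n k (x * m * y)" by auto
    obtain x' y' where xy': "x' \<in> UT n" "y' \<in> UT n" "monomial_upto n (Suc k) (x' * (x * m * y) * y')"
      using monomial_step[OF xy(3)] Suc.prems by auto
    have "x' * (x * m * y) * y' = (x' * x) * m * (y * y')"
      using xy xy' m by (simp add: UT_carrier mat_assoc[where n = n] mat_mult_closed)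
    then show ?case using xy xy' UT_mult by metis
  qed
  then show thesis using that by blast
qed

text \<open>The region \<open>Z\<close> allows both sides to be compared only modulo the entries outside of it.\<close>

lemma monomial_unique:
  fixes e e' :: "'k::field mat"
  assumes e: "monomial_mat n e" and e': "monomial_mat n e'" and x: "x \<in> UT n" and y: "y \<in> UT n"
    and supp: "\<And>i j. \<lbrakk>i < n; j < n; e $$ (i, j) \<noteq> 0\<rbrakk> \<Longrightarrow> (i, j) \<in> Z"
    and supp': "\<And>i j. \<lbrakk>i < n; j < n; e' $$ (i, j) \<noteq> 0\<rbrakk> \<Longrightarrow> (i, j) \<in> Z"
    and eq: "\<And>i j. \<lbrakk>i < n; j < n; (i, j) \<in> Z\<rbrakk> \<Longrightarrow> (x * e) $$ (i, j) = (e' * y) $$ (i, j)"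
  shows "e = e'"
proof -
  have ec: "e \<in> carrier_mat n n" "e' \<in> carrier_mat n n" using e e' by (auto simp: monomial_upto_def)
  note xc = x[THEN UT_carrier] y[THEN UT_carrier]
  note row = monomial_row[OF e] and col = monomial_col[OF e]
    and row' = monomial_row[OF e'] and col' = monomial_col[OF e']
  have xe: "(x * e) $$ (i, j) = x $$ (i, l) * e $$ (l, j)" if "i < n" "j < n" "l < n" "e $$ (l, j) \<noteq> 0" for i j l
  proof -
    have "(x * e) $$ (i, j) = (\<Sum>m<n. if m = l then x $$ (i, l) * e $$ (l, j) else 0)"
      unfolding mat_mult_entry[OF xc(1) ec(1) that(1,2)]
    proof (intro sum.cong refl)
      fix m assume "m \<in> {..<n}"
      then show "x $$ (i, m) * e $$ (m, j) = (if m = l then x $$ (i, l) * e $$ (l, j) else 0)"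
        using col[of m l j] that by (cases "m = l") auto
    qed
    then show ?thesis using that by simp
  qed
  have xe0: "\<exists>l<n. e $$ (l, j) \<noteq> 0" if "i < n" "j < n" "(x * e) $$ (i, j) \<noteq> 0" for i j
  proof (rule ccontr)
    assume "\<not> ?thesis"
    then have "(x * e) $$ (i, j) = 0"
      unfolding mat_mult_entry[OF xc(1) ec(1) that(1,2)] by (intro sum.neutral) auto
    then show False using that by simp
  qed
  have ey: "(e' * y) $$ (i, j) = e' $$ (i, l) * y $$ (l, j)" if "i < n" "j < n" "l < n" "e' $$ (i, l) \<noteq> 0" for i j l
  proof -
    have "(e' * y) $$ (i, j) = (\<Sum>m<n. if m = l then e' $$ (i, l) * y $$ (l, j) else 0)"
      unfolding mat_mult_entry[OF ec(2) xc(2) that(1,2)]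
    proof (intro sum.cong refl)
      fix m assume "m \<in> {..<n}"
      then show "e' $$ (i, m) * y $$ (m, j) = (if m = l then e' $$ (i, l) * y $$ (l, j) else 0)"
        using row'[of i m l] that by (cases "m = l") auto
    qed
    then show ?thesis using that by simp
  qed
  have ey0: "\<exists>l\<le>j. e' $$ (i, l) \<noteq> 0" if "i < n" "j < n" "(e' * y) $$ (i, j) \<noteq> 0" for i j
  proof (rule ccontr)
    assume *: "\<not> ?thesis"
    have "e' $$ (i, m) * y $$ (m, j) = 0" if "m < n" for m
      using * y that by (cases "m \<le> j") (auto simp: UT_iff)
    then have "(e' * y) $$ (i, j) = 0"
      unfolding mat_mult_entry[OF ec(2) xc(2) that(1,2)] by (intro sum.neutral) auto
    then show False using that by simp
  qed
  have x1: "x $$ (i, i) = 1" "y $$ (i, i) = 1" if "i < n" for i using x y that by (auto simp: UT_iff)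
  \<comment> \<open>Induction on the column. Row i of e' y is nonzero at j, so e' has an entry in
    row i at some j' \<le> j. If j' < j, then e has an entry in column j' too, say in row l, and by
    induction so has e'; hence l = i, and e would have two entries in row i.\<close>
  have claim: "e' $$ (i, j) = e $$ (i, j)" if "i < n" "j < n" "e $$ (i, j) \<noteq> 0" for i j
    using that
  proof (induction j arbitrary: i rule: less_induct)
    case (less j)
    have "(e' * y) $$ (i, j) = e $$ (i, j)"
      using eq[OF less.prems(1,2) supp[OF less.prems]] xe[of i j i] less.prems x1 by simp
    then obtain j' where j': "j' \<le> j" "e' $$ (i, j') \<noteq> 0" using ey0[of i j] less.prems by auto
    then have j'n: "j' < n" using less.prems by simp
    have B: "(x * e) $$ (i, j') = e' $$ (i, j')"
      using eq[OF less.prems(1) j'n supp'[OF less.prems(1) j'n j'(2)]] ey[of i j' j'] less.prems j' j'n x1 by simp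
    then obtain l where l: "l < n" "e $$ (l, j') \<noteq> 0" using xe0[OF less.prems(1) j'n] j' by auto
    have "j' = j"
    proof (rule ccontr)
      assume "j' \<noteq> j"
      then have "e' $$ (l, j') \<noteq> 0" using less.IH[of j' l] j' l j'n by simp
      then have "l = i" using col'[of l i j'] l less.prems j' j'n by simp
      then show False using row[of i j j'] less.prems l j'n \<open>j' \<noteq> j\<close> by simp
    qed
    then show ?case
      using \<open>(e' * y) $$ (i, j) = e $$ (i, j)\<close> ey[of i j j] less.prems j' x1 by simp
  qed
  have claim': "e $$ (i, j) = e' $$ (i, j)" if ij: "i < n" "j < n" "e' $$ (i, j) \<noteq> 0" for i j
  proof -
    have "(x * e) $$ (i, j) = e' $$ (i, j)"
      using eq[OF ij(1,2) supp'[OF ij]] ey[of i j j] ij x1 by simp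
    then obtain l where l: "l < n" "e $$ (l, j) \<noteq> 0" using xe0[of i j] ij by auto
    then have "e' $$ (l, j) \<noteq> 0" using claim[of l j] ij by simp
    then have "l = i" using col'[of l i j] l ij by simp
    then show ?thesis using claim[of i j] l ij by simp
  qed
  have "e $$ (i, j) = e' $$ (i, j)" if "i < n" "j < n" for i j
    using claim[OF that] claim'[OF that] by metis
  then show ?thesis using ec by (intro eq_matI) auto
qed


section \<open>The trace form\<close>

definition trace_form :: "nat \<Rightarrow> 'k::comm_semiring_0 mat \<Rightarrow> 'k mat \<Rightarrow> 'k" where
  "trace_form n m a = (\<Sum>i<n. (m * a) $$ (i, i))"

lemma trace_form_sum:
  assumes "m \<in> carrier_mat n n" "a \<in> carrier_mat n n"
  shows "trace_form n m a = (\<Sum>i<n. \<Sum>j<n. m $$ (i, j) * a $$ (j, i))"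
  unfolding trace_form_def using mat_mult_entry[OF assms] by (intro sum.cong refl) auto

lemma trace_form_add:
  assumes "m \<in> carrier_mat n n" "a \<in> carrier_mat n n" "b \<in> carrier_mat n n"
  shows "trace_form n m (a + b) = trace_form n m a + trace_form n m b"
  using assms by (simp add: trace_form_sum distrib_left sum.distrib)

text \<open>Cyclicity of the trace moves the two-sided action from the argument to the matrix of the
  functional, so that orbits of characters can be treated by double cosets of matrices.\<close>

lemma trace_form_mult:
  assumes "m \<in> carrier_mat n n" "a \<in> carrier_mat n n" "x \<in> carrier_mat n n" "y \<in> carrier_mat n n"
  shows "trace_form n m (x * a * y) = trace_form n (y * m * x) a"
proof -
  have "trace_form n m (x * a * y) = (\<Sum>i<n. (m * x * a * y) $$ (i, i))"
    unfolding trace_form_def using assms by (simp add: mat_assoc[where n = n] mat_mult_closed)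
  also have "\<dots> = (\<Sum>i<n. (y * (m * x * a)) $$ (i, i))"
    using assms by (intro trace_mult_commute) auto
  also have "\<dots> = trace_form n (y * m * x) a"
    unfolding trace_form_def using assms by (simp add: mat_assoc[where n = n] mat_mult_closed)
  finally show ?thesis .
qed


section \<open>Finite fields\<close>

lemma finite_field_char_prime: "prime CHAR('k::{field,finite})"
  using prime_CHAR_semidom[where ?'a = 'k] finite_imp_CHAR_pos[where ?'a = 'k] by simp

text \<open>For a prime q dividing the order, Sylow's theorem gives a nonzero x with q x = 0, hence
  q = 0 in the field and q is the characteristic.\<close>

lemma finite_field_card:
  obtains N where "card (UNIV :: 'k::{field,finite} set) = CHAR('k) ^ N"
proof -
  let ?p = "CHAR('k)"
  let ?G = "\<lparr>carrier = (UNIV :: 'k set), monoid.mult = (+), one = 0\<rparr>"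
  have p: "prime ?p" by (rule finite_field_char_prime)
  have G: "group ?G"
    by (rule groupI) (auto simp: add.assoc intro: exI[of _ "- x" for x])
  interpret group ?G by (rule G)
  have pow: "x [^]\<^bsub>?G\<^esub> (k::nat) = of_nat k * x" for x k
    by (induction k) (simp_all add: nat_pow_def algebra_simps)
  have only: "q = ?p" if q: "prime q" "q dvd card (UNIV :: 'k set)" for q
  proof (rule ccontr)
    assume qp: "q \<noteq> ?p"
    obtain m where m: "card (UNIV :: 'k set) = q ^ 1 * m" using q by auto
    obtain H where H: "subgroup H ?G" "card H = q ^ 1"
      using sylow_thm[OF q(1) G, of 1 m] m by (auto simp: Coset.order_def)
    have "1 < card H" using H q prime_gt_1_nat by simp
    then have "\<not> H \<subseteq> {0}" using card_mono[of "{0}" H] by auto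
    then obtain x where x: "x \<in> H" "x \<noteq> 0" by blast
    interpret S: group "?G\<lparr>carrier := H\<rparr>" by (rule subgroup.subgroup_is_group[OF H(1) G])
    have "x [^]\<^bsub>?G\<lparr>carrier := H\<rparr>\<^esub> card H = 0"
      using S.pow_order_eq_1[of x] x by (simp add: Coset.order_def)
    then have "of_nat q * x = 0"
      using H(2) nat_pow_consistent[of x q H] pow by simp
    then have "(of_nat q :: 'k) = 0" using x by simp
    then have "?p dvd q" by (simp add: of_nat_eq_0_iff_char_dvd)
    then show False using p q qp primes_dvd_imp_eq by blast
  qed
  have "card (UNIV :: 'k set) = ?p ^ multiplicity ?p (card (UNIV :: 'k set))"
  proof -
    obtain m where m: "card (UNIV :: 'k set) = ?p ^ multiplicity ?p (card (UNIV :: 'k set)) * m" "\<not> ?p dvd m"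
      using multiplicity_decompose'[of "card (UNIV :: 'k set)" ?p] p by (auto simp: mult.commute)
    have "m = 1"
    proof (rule ccontr)
      assume "m \<noteq> 1"
      then obtain q where q: "prime q" "q dvd m" using prime_factor_nat by blast
      then have "q dvd card (UNIV :: 'k set)" using m(1) by (metis dvd_mult)
      then show False using only q m(2) by blast
    qed
    then show ?thesis using m by simp
  qed
  then show thesis using that by blast
qed

lemma finite_field_power_card:
  fixes x :: "'k::{field,finite}"
  shows "x ^ card (UNIV :: 'k set) = x"
proof (cases "x = 0")
  case True
  then show ?thesis by (simp add: power_0_left card_eq_0_iff)
next
  case False
  let ?G = "\<lparr>carrier = UNIV - {0 :: 'k}, monoid.mult = (*), one = 1\<rparr>"
  have G: "group ?G"
  proof (rule groupI)
    fix y assume "y \<in> carrier ?G"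
    then show "\<exists>z\<in>carrier ?G. z \<otimes>\<^bsub>?G\<^esub> y = \<one>\<^bsub>?G\<^esub>" by (intro bexI[of _ "inverse y"]) auto
  qed auto
  interpret group ?G by (rule G)
  have pow: "y [^]\<^bsub>?G\<^esub> (k::nat) = y ^ k" for y k
    by (induction k) (simp_all add: nat_pow_def mult.commute)
  have "x ^ (card (UNIV :: 'k set) - 1) = 1"
    using pow_order_eq_1[of x] False pow by (simp add: Coset.order_def card_Diff_singleton)
  moreover have "0 < card (UNIV :: 'k set)" by (simp add: card_gt_0_iff)
  ultimately show ?thesis using power_Suc[of x "card (UNIV :: 'k set) - 1"] by simp
qed

lemma finite_field_two_nonzero:
  assumes "odd CHAR('k)" shows "(2 :: 'k::{field,finite}) \<noteq> 0"
proof
  assume "(2 :: 'k) = 0"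
  then have "CHAR('k) dvd 2" using of_nat_eq_0_iff_char_dvd[of 2, where ?'a = 'k] by simp
  then have "CHAR('k) = 2"
    by (rule primes_dvd_imp_eq[OF finite_field_char_prime two_is_prime_nat])
  then show False using assms by simp
qed

section \<open>The canonical involutions\<close>

text \<open>In all cases \<open>\<sigma>(a)\<^sub>i\<^sub>j = s\<^sub>i s\<^sub>j \<tau>(a\<^sub>j\<^sub>'\<^sub>i\<^sub>')\<close> with \<open>i' = n - 1 - i\<close> and signs \<open>s\<^sub>i\<close> for which \<open>s\<^sub>i s\<^sub>i\<^sub>'\<close> does not
  depend on \<open>i\<close>.\<close>

locale canonical_involution =
  fixes n :: nat and s :: "nat \<Rightarrow> 'k::{field,finite}" and \<tau> :: "'k \<Rightarrow> 'k" and \<epsilon> :: 'k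
    and \<theta> :: "'k \<Rightarrow> complex"
  assumes odd_char: "odd CHAR('k)"
    and s_cases: "s i = 1 \<or> s i = - 1"
    and s_reflect: "i < n \<Longrightarrow> s i * s (n - Suc i) = \<epsilon>"
    and \<tau>_add: "\<tau> (\<alpha> + \<beta>) = \<tau> \<alpha> + \<tau> \<beta>"
    and \<tau>_mult: "\<tau> (\<alpha> * \<beta>) = \<tau> \<alpha> * \<tau> \<beta>"
    and \<tau>_\<tau>: "\<tau> (\<tau> \<alpha>) = \<alpha>"
    and \<theta>_char: "nontrivial_additive_character \<theta>"
    and \<theta>_\<tau>: "\<theta> (\<tau> \<alpha>) = \<theta> \<alpha>"
begin

definition \<sigma> :: "'k mat \<Rightarrow> 'k mat" where
  "\<sigma> a = mat n n (\<lambda>(i, j). s i * s j * \<tau> (a $$ (n - Suc j, n - Suc i)))"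

lemma two: "(2 :: 'k) \<noteq> 0"
  using odd_char by (rule finite_field_two_nonzero)

lemma halves: "\<alpha> / 2 + \<alpha> / 2 = (\<alpha> :: 'k)"
  using two by (simp add: add_divide_distrib[symmetric] flip: mult_2)

lemma s_sq: "s i * s i = 1"
  using s_cases[of i] by auto

text \<open>Signs are their own inverses, so reflecting an index multiplies its sign by \<epsilon>;
  two reflections give the factor \<epsilon>^2 = 1.\<close>

lemma s_reflect2: assumes "i < n" "j < n" shows "s (n - Suc i) * s (n - Suc j) = s i * s j"
proof -
  have "s (n - Suc i) * s (n - Suc j) = (s i * s i) * s (n - Suc i) * s (n - Suc j) * (s j * s j)"
    by (simp add: s_sq)
  also have "\<dots> = s i * s j * ((s i * s (n - Suc i)) * (s j * s (n - Suc j)))"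
    by (simp add: mult_ac)
  also have "\<dots> = s i * s j * ((s j * s (n - Suc j)) * (s j * s (n - Suc j)))"
    using assms by (simp add: s_reflect)
  also have "\<dots> = s i * s j * ((s j * s j) * (s (n - Suc j) * s (n - Suc j)))"
    by (simp add: mult_ac)
  finally show ?thesis by (simp add: s_sq)
qed

lemma \<tau>_zero: "\<tau> 0 = 0"
proof -
  have "\<tau> 0 + \<tau> 0 = \<tau> 0 + 0" using \<tau>_add[of 0 0] by simp
  then show ?thesis by (rule add_left_imp_eq)
qed

lemma \<tau>_neg: "\<tau> (- \<alpha>) = - \<tau> \<alpha>"
  using \<tau>_add[of "- \<alpha>" \<alpha>] by (simp add: \<tau>_zero eq_neg_iff_add_eq_0)

lemma \<tau>_diff: "\<tau> (\<alpha> - \<beta>) = \<tau> \<alpha> - \<tau> \<beta>"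
  using \<tau>_add[of \<alpha> "- \<beta>"] by (simp add: \<tau>_neg)

lemma \<tau>_one: "\<tau> 1 = 1"
proof -
  have "\<tau> 1 \<noteq> 0" using \<tau>_\<tau>[of 1] \<tau>_zero by auto
  then show ?thesis using \<tau>_mult[of 1 1] by simp
qed

lemma \<tau>_s: "\<tau> (s i) = s i"
  using s_cases[of i] by (auto simp: \<tau>_one \<tau>_neg)

lemma \<tau>_half: "\<tau> (\<alpha> / 2) = \<tau> \<alpha> / 2"
proof -
  have "\<tau> (\<alpha> / 2) + \<tau> (\<alpha> / 2) = \<tau> \<alpha>"
    unfolding \<tau>_add[symmetric] halves ..
  also have "\<dots> = \<tau> \<alpha> / 2 + \<tau> \<alpha> / 2" by (simp only: halves)
  finally have "2 * \<tau> (\<alpha> / 2) = 2 * (\<tau> \<alpha> / 2)" by (simp only: mult_2)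
  then show ?thesis by (rule mult_left_cancel[OF two, THEN iffD1])
qed

lemma \<tau>_sum: "\<tau> (\<Sum>x\<in>A. f x) = (\<Sum>x\<in>A. \<tau> (f x))"
  by (induction A rule: infinite_finite_induct) (simp_all add: \<tau>_zero \<tau>_add)

lemma \<sigma>_carrier: "\<sigma> a \<in> carrier_mat n n"
  by (simp add: \<sigma>_def)

lemma \<sigma>_entry: "\<lbrakk>i < n; j < n\<rbrakk> \<Longrightarrow> \<sigma> a $$ (i, j) = s i * s j * \<tau> (a $$ (n - Suc j, n - Suc i))"
  by (simp add: \<sigma>_def)

lemma sum_reflect: "(\<Sum>i<n. f (n - Suc i)) = (\<Sum>i<n. f i)" for f :: "nat \<Rightarrow> 'c::comm_monoid_add"
  by (rule sum.nat_diff_reindex)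

lemma \<sigma>_add: "\<lbrakk>a \<in> carrier_mat n n; b \<in> carrier_mat n n\<rbrakk> \<Longrightarrow> \<sigma> (a + b) = \<sigma> a + \<sigma> b"
  by (intro eq_matI) (auto simp: \<sigma>_def \<tau>_add distrib_left)

lemma \<sigma>_\<sigma>: assumes a: "a \<in> carrier_mat n n" shows "\<sigma> (\<sigma> a) = a"
proof (rule eq_matI)
  fix i j assume "i < dim_row a" "j < dim_col a"
  then have ij: "i < n" "j < n" using a by auto
  then have "\<sigma> (\<sigma> a) $$ (i, j) = s i * s j * (s (n - Suc j) * s (n - Suc i) * a $$ (i, j))"
    by (simp add: \<sigma>_entry \<tau>_mult \<tau>_s \<tau>_\<tau> Suc_diff_Suc)
  also have "\<dots> = (s i * s i) * (s j * s j) * a $$ (i, j)"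
    using ij s_reflect2[of j i] by (simp add: mult_ac)
  finally show "\<sigma> (\<sigma> a) $$ (i, j) = a $$ (i, j)" by (simp add: s_sq)
qed (use a in \<open>auto simp: \<sigma>_def\<close>)

lemma \<sigma>_mult:
  assumes a: "a \<in> carrier_mat n n" and b: "b \<in> carrier_mat n n"
  shows "\<sigma> (a * b) = \<sigma> b * \<sigma> a"
proof (rule eq_matI)
  fix i j assume "i < dim_row (\<sigma> b * \<sigma> a)" "j < dim_col (\<sigma> b * \<sigma> a)"
  then have ij: "i < n" "j < n" by (auto simp: \<sigma>_def)
  let ?i = "n - Suc i" and ?j = "n - Suc j"
  have "(\<sigma> b * \<sigma> a) $$ (i, j) = (\<Sum>l<n. \<sigma> b $$ (i, l) * \<sigma> a $$ (l, j))"
    by (rule mat_mult_entry[OF \<sigma>_carrier \<sigma>_carrier ij])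
  also have "\<dots> = (\<Sum>l<n. s i * s j * (\<tau> (a $$ (?j, n - Suc l)) * \<tau> (b $$ (n - Suc l, ?i))))"
  proof (intro sum.cong refl)
    fix l assume "l \<in> {..<n}"
    then have "\<sigma> b $$ (i, l) * \<sigma> a $$ (l, j) =
      (s l * s l) * (s i * s j * (\<tau> (a $$ (?j, n - Suc l)) * \<tau> (b $$ (n - Suc l, ?i))))"
      using ij by (simp add: \<sigma>_entry mult_ac)
    then show "\<sigma> b $$ (i, l) * \<sigma> a $$ (l, j) = s i * s j * (\<tau> (a $$ (?j, n - Suc l)) * \<tau> (b $$ (n - Suc l, ?i)))"
      by (simp add: s_sq)
  qed
  also have "\<dots> = (\<Sum>l<n. s i * s j * (\<tau> (a $$ (?j, l)) * \<tau> (b $$ (l, ?i))))"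
    by (rule sum_reflect[of "\<lambda>l. s i * s j * (\<tau> (a $$ (?j, l)) * \<tau> (b $$ (l, ?i)))"])
  also have "\<dots> = s i * s j * \<tau> (\<Sum>l<n. a $$ (?j, l) * b $$ (l, ?i))"
    by (simp add: \<tau>_sum \<tau>_mult sum_distrib_left)
  also have "(\<Sum>l<n. a $$ (?j, l) * b $$ (l, ?i)) = (a * b) $$ (?j, ?i)"
    using mat_mult_entry[OF a b, of ?j ?i] ij by simp
  also have "s i * s j * \<tau> ((a * b) $$ (?j, ?i)) = \<sigma> (a * b) $$ (i, j)"
    using ij by (simp add: \<sigma>_entry)
  finally show "\<sigma> (a * b) $$ (i, j) = (\<sigma> b * \<sigma> a) $$ (i, j)" by simp
qed (auto simp: \<sigma>_def)

lemma \<sigma>_strict_upper: "a \<in> strict_upper n \<Longrightarrow> \<sigma> a \<in> strict_upper n"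
  by (auto simp: strict_upper_def \<sigma>_carrier \<sigma>_entry \<tau>_zero)

definition half :: "'k mat" where "half = (1 / 2) \<cdot>\<^sub>m 1\<^sub>m n"

definition logJ :: nat where "logJ = (SOME N. card (strict_upper n :: 'k mat set) = CHAR('k) ^ N)"

lemma card_J: "card (strict_upper n :: 'k mat set) = CHAR('k) ^ logJ"
proof -
  obtain N where "card (UNIV :: 'k set) = CHAR('k) ^ N" by (rule finite_field_card)
  then have "\<exists>N. card (strict_upper n :: 'k mat set) = CHAR('k) ^ N"
    by (auto simp: card_strict_upper power_mult[symmetric])
  then show ?thesis unfolding logJ_def by (rule someI_ex)
qed

lemma half_mult: "a \<in> carrier_mat n n \<Longrightarrow> half * a = (1 / 2) \<cdot>\<^sub>m a"
  unfolding half_def by (subst mult_smult_assoc_mat[of _ n n]) auto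

abbreviation R where "R \<equiv> ring_mat TYPE('k) n ()"

lemma a_inv_mat: assumes "a \<in> carrier_mat n n" shows "\<ominus>\<^bsub>R\<^esub> a = - a"
proof -
  interpret ring R by (rule ring_mat)
  show ?thesis
    using assms minus_equality[of "- a" a] uminus_l_inv_mat[OF assms] by (simp add: ring_mat_simps)
qed

lemma a_minus_mat: "\<lbrakk>a \<in> carrier_mat n n; b \<in> carrier_mat n n\<rbrakk> \<Longrightarrow> a \<ominus>\<^bsub>R\<^esub> b = a - b"
  unfolding a_minus_def by (simp add: a_inv_mat ring_mat_simps minus_add_uminus_mat)

lemma strict_upper_uminus: "a \<in> strict_upper n \<Longrightarrow> - a \<in> strict_upper n"
  by (auto simp: strict_upper_def)

sublocale involutive_algebra_group R "strict_upper n" \<sigma> half "CHAR('k)" logJ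
  rewrites "carrier R = carrier_mat n n"
    and "monoid.mult R = (*)"
    and "add R = (+)"
    and "one R = 1\<^sub>m n"
    and "zero R = 0\<^sub>m n n"
proof -
  interpret ring R by (rule ring_mat)
  have "half + half = 1\<^sub>m n"
    using two by (intro eq_matI) (auto simp: half_def)
  moreover have "half \<in> carrier_mat n n" by (simp add: half_def)
  moreover have "half * a \<in> strict_upper n" if "a \<in> strict_upper n" for a
    using that by (auto simp: half_mult strict_upper_def)
  moreover have "\<exists>b\<in>strict_upper n. (1\<^sub>m n + a) * (1\<^sub>m n + b) = 1\<^sub>m n" if "a \<in> strict_upper n" for a :: "'k mat"
    using UT_right_inverse[of "1\<^sub>m n + a" n] that unfolding UT_def by blast
  ultimately show "involutive_algebra_group R (strict_upper n) \<sigma> half CHAR('k) logJ"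
    using odd_char card_J finite_field_char_prime finite_carrier_mat
    by unfold_locales
      (auto simp: ring_mat_simps \<sigma>_carrier \<sigma>_add \<sigma>_mult \<sigma>_\<sigma> \<sigma>_strict_upper strict_upper_mult
        a_inv_mat strict_upper_carrier strict_upper_uminus intro: strict_upper_carrier,
       auto simp: strict_upper_def)
qed (simp_all add: ring_mat_simps)

lemma P_UT: "P = UT n"
  by (auto simp: P_def UT_def)

section \<open>The additive character of the field\<close>

lemma \<theta>_add: "\<theta> (\<alpha> + \<beta>) = \<theta> \<alpha> * \<theta> \<beta>"
  using \<theta>_char by (simp add: nontrivial_additive_character_def)

lemma \<theta>_nonzero: "\<theta> \<alpha> \<noteq> 0"
  using \<theta>_char by (simp add: nontrivial_additive_character_def)

lemma \<theta>_zero: "\<theta> 0 = 1"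
  using \<theta>_add[of 0 0] \<theta>_nonzero[of 0] by simp

lemma \<theta>_neg: "\<theta> \<alpha> * \<theta> (- \<alpha>) = 1"
  using \<theta>_add[of \<alpha> "- \<alpha>"] by (simp add: \<theta>_zero)

lemma \<theta>_sum_one: "(\<And>x. x \<in> A \<Longrightarrow> \<theta> (f x) = 1) \<Longrightarrow> \<theta> (\<Sum>x\<in>A. f x) = 1"
  by (induction A rule: infinite_finite_induct) (simp_all add: \<theta>_zero \<theta>_add)

lemma \<theta>_nondegenerate: assumes "\<And>\<beta>. \<theta> (\<alpha> * \<beta>) = 1" shows "\<alpha> = 0"
proof (rule ccontr)
  assume "\<alpha> \<noteq> 0"
  then have "\<theta> \<gamma> = 1" for \<gamma> using assms[of "\<gamma> / \<alpha>"] by simp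
  then show False using \<theta>_char by (simp add: nontrivial_additive_character_def)
qed

text \<open>\<tau>-invariance of \<theta> gives \<theta>(\<alpha>/2) = \<theta>(-\<alpha>/2), so the
  square of \<theta>(\<alpha>/2) is 1.\<close>

lemma \<theta>_anti_fixed: assumes "\<tau> \<alpha> = - \<alpha>" shows "\<theta> \<alpha> = 1"
proof -
  have "\<theta> (\<alpha> / 2) = \<theta> (- (\<alpha> / 2))" using \<theta>_\<tau>[of "\<alpha> / 2"] assms by (simp add: \<tau>_half)
  then have "\<theta> (\<alpha> / 2 + \<alpha> / 2) = 1" unfolding \<theta>_add using \<theta>_neg[of "\<alpha> / 2"] by simp
  then show ?thesis by (simp only: halves)
qed

text \<open>The fixed field of \<tau> is its own orthogonal for the form \<theta>(\<phi> \<alpha>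
  \<beta>), hence the right choice of scalars in the middle column. If the anti-fixed part
  \<open>\<alpha>\<^sub>1\<close> of \<alpha> were nonzero, the fixed scalar \<phi>
  \<open>\<alpha>\<^sub>1\<close> could be divided out. This makes \<theta> trivial on the fixed
  field, and then everywhere, since \<theta>(\<gamma>) = \<theta>(\<gamma>/2 +
  \<tau>(\<gamma>/2)).\<close>

lemma \<theta>_fixed_dual:
  assumes \<phi>: "\<tau> \<phi> = - \<phi>" "\<phi> \<noteq> 0" and one: "\<And>\<beta>. \<tau> \<beta> = \<beta> \<Longrightarrow> \<theta> (\<phi> * \<alpha> * \<beta>) = 1"
  shows "\<tau> \<alpha> = \<alpha>"
proof (rule ccontr)
  assume ne: "\<tau> \<alpha> \<noteq> \<alpha>"
  define \<alpha>\<^sub>0 where "\<alpha>\<^sub>0 = (\<alpha> + \<tau> \<alpha>) / 2"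
  define \<alpha>\<^sub>1 where "\<alpha>\<^sub>1 = (\<alpha> - \<tau> \<alpha>) / 2"
  have \<alpha>: "\<alpha> = \<alpha>\<^sub>0 + \<alpha>\<^sub>1"
    using halves[of \<alpha>] by (simp add: \<alpha>\<^sub>0_def \<alpha>\<^sub>1_def add_divide_distrib diff_divide_distrib)
  have \<tau>\<alpha>: "\<tau> \<alpha>\<^sub>0 = \<alpha>\<^sub>0" "\<tau> \<alpha>\<^sub>1 = - \<alpha>\<^sub>1"
    unfolding \<alpha>\<^sub>0_def \<alpha>\<^sub>1_def \<tau>_half \<tau>_add \<tau>_diff \<tau>_\<tau> by (simp_all add: add.commute minus_divide_left)
  have c: "\<tau> (\<phi> * \<alpha>\<^sub>1) = \<phi> * \<alpha>\<^sub>1" by (simp add: \<tau>_mult \<phi> \<tau>\<alpha>)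
  have c0: "\<phi> * \<alpha>\<^sub>1 \<noteq> 0" using \<phi> ne two by (simp add: \<alpha>\<^sub>1_def)
  have fixed: "\<theta> \<gamma> = 1" if \<gamma>: "\<tau> \<gamma> = \<gamma>" for \<gamma>
  proof -
    define \<beta> where "\<beta> = \<gamma> / (\<phi> * \<alpha>\<^sub>1)"
    have "\<beta> * (\<phi> * \<alpha>\<^sub>1) = \<gamma>" using c0 by (simp add: \<beta>_def)
    then have "\<tau> (\<beta> * (\<phi> * \<alpha>\<^sub>1)) = \<beta> * (\<phi> * \<alpha>\<^sub>1)" using \<gamma> by simp
    then have "\<tau> \<beta> * (\<phi> * \<alpha>\<^sub>1) = \<beta> * (\<phi> * \<alpha>\<^sub>1)" unfolding \<tau>_mult[of \<beta>] c .
    then have \<beta>: "\<tau> \<beta> = \<beta>" by (rule mult_right_cancel[OF c0, THEN iffD1])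
    have "\<theta> (\<phi> * \<alpha> * \<beta>) = \<theta> (\<phi> * \<alpha>\<^sub>0 * \<beta>) * \<theta> (\<phi> * \<alpha>\<^sub>1 * \<beta>)"
      by (simp add: \<alpha> \<theta>_add[symmetric] algebra_simps)
    moreover have "\<theta> (\<phi> * \<alpha>\<^sub>0 * \<beta>) = 1" by (intro \<theta>_anti_fixed) (simp add: \<tau>_mult \<phi> \<tau>\<alpha> \<beta>)
    moreover have "\<phi> * \<alpha>\<^sub>1 * \<beta> = \<gamma>" using c0 by (simp add: \<beta>_def)
    ultimately show ?thesis using one[OF \<beta>] by simp
  qed
  have "\<theta> \<gamma> = 1" for \<gamma>
  proof -
    have "\<theta> \<gamma> = \<theta> (\<gamma> / 2 + \<gamma> / 2)" by (simp only: halves)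
    also have "\<dots> = \<theta> (\<gamma> / 2 + \<tau> (\<gamma> / 2))" by (simp only: \<theta>_add \<theta>_\<tau>)
    also have "\<dots> = 1" by (rule fixed) (simp add: \<tau>_add \<tau>_\<tau> add.commute)
    finally show ?thesis .
  qed
  then show False using \<theta>_char by (simp add: nontrivial_additive_character_def)
qed

section \<open>Additive characters given by matrices\<close>

definition lam :: "'k mat \<Rightarrow> 'k mat \<Rightarrow> complex" where
  "lam m a = \<theta> (trace_form n m a)"

lemma lam_add:
  "\<lbrakk>m \<in> carrier_mat n n; a \<in> carrier_mat n n; b \<in> carrier_mat n n\<rbrakk> \<Longrightarrow> lam m (a + b) = lam m a * lam m b"
  by (simp add: lam_def trace_form_add \<theta>_add)

text \<open>Reflecting both summation indices shows that \<sigma> is self-adjoint for the trace form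
  up to \<tau>, and \<theta> does not see \<tau>.\<close>

lemma trace_form_\<sigma>:
  assumes m: "m \<in> carrier_mat n n" and a: "a \<in> carrier_mat n n"
  shows "trace_form n m (\<sigma> a) = \<tau> (trace_form n (\<sigma> m) a)"
proof -
  let ?r = "\<lambda>i. n - Suc i"
  have "trace_form n m (\<sigma> a) = (\<Sum>i<n. \<Sum>j<n. m $$ (i, j) * (s j * s i * \<tau> (a $$ (?r i, ?r j))))"
    using m by (simp add: trace_form_sum \<sigma>_carrier \<sigma>_entry)
  also have "\<dots> = (\<Sum>i<n. \<Sum>j<n. m $$ (?r i, ?r j) * (s (?r j) * s (?r i) * \<tau> (a $$ (?r (?r i), ?r (?r j)))))"
    by (subst sum_reflect[symmetric], subst (2) sum_reflect[symmetric]) simp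
  also have "\<dots> = (\<Sum>i<n. \<Sum>j<n. m $$ (?r i, ?r j) * (s j * s i * \<tau> (a $$ (i, j))))"
    using s_reflect2 by (intro sum.cong refl) (simp add: Suc_diff_Suc)
  also have "\<dots> = (\<Sum>j<n. \<Sum>i<n. m $$ (?r i, ?r j) * (s j * s i * \<tau> (a $$ (i, j))))"
    by (rule sum.swap)
  also have "\<dots> = \<tau> (\<Sum>j<n. \<Sum>i<n. \<sigma> m $$ (j, i) * a $$ (i, j))"
    by (simp add: \<tau>_sum \<tau>_mult \<sigma>_entry \<tau>_s \<tau>_\<tau> mult_ac)
  also have "\<dots> = \<tau> (trace_form n (\<sigma> m) a)"
    using a by (simp add: trace_form_sum \<sigma>_carrier)
  finally show ?thesis .
qed

lemma lam_\<sigma>: "\<lbrakk>m \<in> carrier_mat n n; a \<in> carrier_mat n n\<rbrakk> \<Longrightarrow> lam m (\<sigma> a) = lam (\<sigma> m) a"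
  by (simp add: lam_def trace_form_\<sigma> \<theta>_\<tau>)

lemma \<sigma>_transpose: "a \<in> carrier_mat n n \<Longrightarrow> \<sigma> (transpose_mat a) = transpose_mat (\<sigma> a)"
  by (intro eq_matI) (auto simp: \<sigma>_def mult.commute)

lemma lam_uminus: "\<lbrakk>m \<in> carrier_mat n n; a \<in> carrier_mat n n\<rbrakk> \<Longrightarrow> lam (- m) a = lam m (- a)"
  by (simp add: lam_def trace_form_sum)

lemma invariant_character_lam:
  assumes m: "m \<in> carrier_mat n n" and \<sigma>m: "\<sigma> m = - m"
  shows "invariant_character R (strict_upper n) \<sigma> half CHAR('k) logJ (lam m)"
proof -
  have "lam m (0\<^sub>m n n) = 1" using m by (simp add: lam_def trace_form_sum \<theta>_zero)
  moreover have "lam m (\<sigma> a) = lam m (- a)" if "a \<in> carrier_mat n n" for a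
    using m that by (simp add: lam_\<sigma> \<sigma>m lam_uminus)
  ultimately show ?thesis
    using involutive_algebra_group_axioms m
    by (auto simp: invariant_character_def invariant_character_axioms_def ring_mat_simps lam_add a_inv_mat)
qed

end

context canonical_involution
begin

section \<open>The polarization attached to a skew monomial matrix\<close>

definition unit_mat :: "nat \<Rightarrow> nat \<Rightarrow> 'k \<Rightarrow> 'k mat" where
  "unit_mat l j \<beta> = mat n n (\<lambda>(r, c). if r = l \<and> c = j then \<beta> else 0)"

lemma unit_mat_carrier: "unit_mat l j \<beta> \<in> carrier_mat n n"
  by (simp add: unit_mat_def)

lemma unit_mat_J: "l < j \<Longrightarrow> unit_mat l j \<beta> \<in> strict_upper n"
  by (auto simp: unit_mat_def strict_upper_def)

lemma \<sigma>_unit_mat: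
  assumes "l < n" "j < n"
  shows "\<sigma> (unit_mat l j \<beta>) = unit_mat (n - Suc j) (n - Suc l) (s (n - Suc j) * s (n - Suc l) * \<tau> \<beta>)"
proof (rule eq_matI)
  fix r c
  assume "r < dim_row (unit_mat (n - Suc j) (n - Suc l) (s (n - Suc j) * s (n - Suc l) * \<tau> \<beta>))"
    "c < dim_col (unit_mat (n - Suc j) (n - Suc l) (s (n - Suc j) * s (n - Suc l) * \<tau> \<beta>))"
  then have rc: "r < n" "c < n" by (auto simp: unit_mat_def)
  have "n - Suc c = l \<longleftrightarrow> c = n - Suc l" "n - Suc r = j \<longleftrightarrow> r = n - Suc j"
    using rc assms by auto
  then show "\<sigma> (unit_mat l j \<beta>) $$ (r, c) =
      unit_mat (n - Suc j) (n - Suc l) (s (n - Suc j) * s (n - Suc l) * \<tau> \<beta>) $$ (r, c)"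
    using rc assms by (auto simp: \<sigma>_entry unit_mat_def \<tau>_zero)
qed (auto simp: \<sigma>_def unit_mat_def)

lemma lam_transpose:
  assumes "e \<in> carrier_mat n n" "c \<in> carrier_mat n n"
  shows "lam (transpose_mat e) c = \<theta> (\<Sum>i<n. \<Sum>j<n. e $$ (i, j) * c $$ (i, j))"
proof -
  have "trace_form n (transpose_mat e) c = (\<Sum>j<n. \<Sum>i<n. e $$ (i, j) * c $$ (i, j))"
    using assms by (subst trace_form_sum) auto
  also have "\<dots> = (\<Sum>i<n. \<Sum>j<n. e $$ (i, j) * c $$ (i, j))"
    by (rule sum.swap)
  finally show ?thesis by (simp add: lam_def)
qed

text \<open>Only column j of e and column l of a survive. For monomial e this reads off a single
  entry of a.\<close>

lemma lam_unit:
  assumes e: "e \<in> carrier_mat n n" and a: "a \<in> carrier_mat n n" and lj: "l < n" "j < n"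
  shows "lam (transpose_mat e) (a * unit_mat l j \<beta>) = \<theta> (\<Sum>i<n. e $$ (i, j) * a $$ (i, l) * \<beta>)"
proof -
  have entry: "(a * unit_mat l j \<beta>) $$ (i, c) = (if c = j then a $$ (i, l) * \<beta> else 0)" if "i < n" "c < n" for i c
  proof -
    have "(a * unit_mat l j \<beta>) $$ (i, c) = (\<Sum>r<n. if r = l then (if c = j then a $$ (i, l) * \<beta> else 0) else 0)"
      unfolding mat_mult_entry[OF a unit_mat_carrier that]
      using that lj by (intro sum.cong refl) (auto simp: unit_mat_def)
    then show ?thesis using lj by simp
  qed
  have "(\<Sum>i<n. \<Sum>c<n. e $$ (i, c) * (a * unit_mat l j \<beta>) $$ (i, c)) =
      (\<Sum>i<n. \<Sum>c<n. if c = j then e $$ (i, j) * a $$ (i, l) * \<beta> else 0)"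
    by (intro sum.cong refl) (simp add: entry)
  also have "\<dots> = (\<Sum>i<n. e $$ (i, j) * a $$ (i, l) * \<beta>)"
    using lj by simp
  finally show ?thesis
    using e a by (subst lam_transpose) (auto intro: mat_mult_closed unit_mat_carrier)
qed

lemma lam_product_one:
  assumes e: "e \<in> carrier_mat n n" and a: "a \<in> carrier_mat n n" and b: "b \<in> carrier_mat n n"
    and one: "\<And>i j l. \<lbrakk>i < n; j < n; l < n\<rbrakk> \<Longrightarrow> \<theta> (e $$ (i, j) * a $$ (i, l) * b $$ (l, j)) = 1"
  shows "lam (transpose_mat e) (a * b) = 1"
proof -
  have "lam (transpose_mat e) (a * b) =
      \<theta> (\<Sum>i<n. \<Sum>j<n. \<Sum>l<n. e $$ (i, j) * a $$ (i, l) * b $$ (l, j))"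
    unfolding lam_transpose[OF e mat_mult_closed[OF a b]]
    using mat_mult_entry[OF a b]
    by (intro arg_cong[of _ _ \<theta>] sum.cong refl) (simp add: sum_distrib_left mult.assoc)
  also have "\<dots> = 1" by (intro \<theta>_sum_one one) auto
  finally show ?thesis .
qed

definition B :: "'k mat set" where
  "B = {e \<in> strict_upper n. monomial_mat n e \<and> \<sigma> e = - e}"

text \<open>The part of the polarization in row \<open>i\<close> is everything, nothing, or half of the row (split in the
  middle column by the fixed field of \<open>\<tau>\<close>) according to the position of the nonzero entry \<open>(i, j)\<close> of
  \<open>e\<close> with respect to the antidiagonal.\<close>

definition polar :: "'k mat \<Rightarrow> 'k mat set" where
  "polar e = {a \<in> strict_upper n. \<forall>i j l. i < l \<longrightarrow> l < j \<longrightarrow> j < n \<longrightarrow> e $$ (i, j) \<noteq> 0 \<longrightarrow>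
     (Suc (i + j) < n \<longrightarrow> a $$ (i, l) = 0) \<and>
     (Suc (i + j) = n \<longrightarrow> Suc (2 * l) < n \<longrightarrow> a $$ (i, l) = 0) \<and>
     (Suc (i + j) = n \<longrightarrow> Suc (2 * l) = n \<longrightarrow> \<tau> (a $$ (i, l)) = a $$ (i, l))}"

text \<open>Put k' = n - 1 - k. In the sum of e_ij a_il \<sigma>(b)_lj, the last factor is
  \<tau>(b_j'l') up to sign, and the support of the skew e is symmetric under (i, j) -> (j', i'); so
  row i of a is paired with row j' of b. Off the antidiagonal these are different rows: one is
  cleared between diagonal and pivot, the other is left free. On the antidiagonal the row is paired
  with itself, column l against l'; the right half is kept, and a middle column is restricted to the
  fixed field of \<tau>.\<close>

lemma polarization_polar:
  assumes eB: "e \<in> B"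
  shows "polarization R (strict_upper n) \<sigma> half CHAR('k) logJ (lam (transpose_mat e)) (polar e)"
proof -
  have eJ: "e \<in> strict_upper n" and mono: "monomial_mat n e" and \<sigma>e: "\<sigma> e = - e"
    using eB by (auto simp: B_def)
  have ec: "e \<in> carrier_mat n n" by (rule strict_upper_carrier[OF eJ])
  have "\<sigma> (transpose_mat e) = - transpose_mat e"
    by (rule eq_matI) (use ec in \<open>auto simp: \<sigma>_transpose[OF ec] \<sigma>e\<close>)
  then interpret E: invariant_character R "strict_upper n" \<sigma> half "CHAR('k)" logJ "lam (transpose_mat e)"
    using ec by (intro invariant_character_lam) auto
  have e0: "e $$ (i, j) = 0" if "i < n" "j < n" "j \<le> i" for i j
    using eJ that by (simp add: strict_upper_def)
  have J0: "a $$ (i, j) = 0" if "a \<in> strict_upper n" "i < n" "j < n" "j \<le> i" for a :: "'k mat" and i j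
    using that by (simp add: strict_upper_def)
  have einv: "s i * s j * \<tau> (e $$ (n - Suc j, n - Suc i)) = - e $$ (i, j)" if "i < n" "j < n" for i j
  proof -
    have "\<sigma> e $$ (i, j) = - e $$ (i, j)" unfolding \<sigma>e using that ec by simp
    then show ?thesis using that by (simp add: \<sigma>_entry)
  qed
  have einv0: "e $$ (n - Suc j, n - Suc i) \<noteq> 0" if "i < n" "j < n" "e $$ (i, j) \<noteq> 0" for i j
    using einv[OF that(1,2)] that(3) by (auto simp: \<tau>_zero)
  have polarD: "a \<in> strict_upper n"
      "\<lbrakk>i < l; l < j; j < n; e $$ (i, j) \<noteq> 0; Suc (i + j) < n\<rbrakk> \<Longrightarrow> a $$ (i, l) = 0"
      "\<lbrakk>i < l; l < j; j < n; e $$ (i, j) \<noteq> 0; Suc (i + j) = n; Suc (2 * l) < n\<rbrakk> \<Longrightarrow> a $$ (i, l) = 0"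
      "\<lbrakk>i < l; l < j; j < n; e $$ (i, j) \<noteq> 0; Suc (i + j) = n; Suc (2 * l) = n\<rbrakk> \<Longrightarrow> \<tau> (a $$ (i, l)) = a $$ (i, l)"
    if "a \<in> polar e" for a i j l
    using that unfolding polar_def by blast+
  have polar_c: "a \<in> carrier_mat n n" if "a \<in> polar e" for a
    using polarD(1)[OF that] by (rule strict_upper_carrier)
  have anti: "\<theta> (e $$ (i, j) * \<alpha> * (s l * s j * \<beta>)) = 1"
    if "i < l" "l < j" "j < n" "Suc (i + j) = n" "Suc (2 * l) = n" "\<tau> \<alpha> = \<alpha>" "\<tau> \<beta> = \<beta>" for i j l \<alpha> \<beta>
  proof (rule \<theta>_anti_fixed)
    have i': "n - Suc j = i" "n - Suc i = j" "n - Suc l = l" using that by auto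
    \<comment> \<open>A middle column satisfies l' = l, so the common sign \<epsilon> is the square
      of the sign at l, that is, 1.\<close>
    have ss: "s i * s j = 1"
      using s_reflect[of i] s_reflect[of l] that i' by (simp add: s_sq)
    have ijn: "i < n" "j < n" using that by auto
    have "\<tau> (e $$ (i, j)) = - e $$ (i, j)" using einv[OF ijn] unfolding i' ss mult_1 .
    then show "\<tau> (e $$ (i, j) * \<alpha> * (s l * s j * \<beta>)) = - (e $$ (i, j) * \<alpha> * (s l * s j * \<beta>))"
      by (simp add: \<tau>_mult \<tau>_s that)
  qed
  have isotropic: "lam (transpose_mat e) (a * \<sigma> b) = 1" if a: "a \<in> polar e" and b: "b \<in> polar e" for a b
  proof (rule lam_product_one[OF ec polar_c[OF a] \<sigma>_carrier])
    fix i j l assume ijl: "i < n" "j < n" "l < n"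
    let ?j = "n - Suc j" and ?l = "n - Suc l" and ?i = "n - Suc i"
    have \<sigma>b: "\<sigma> b $$ (l, j) = s l * s j * \<tau> (b $$ (?j, ?l))" using ijl by (simp add: \<sigma>_entry)
    consider "e $$ (i, j) = 0" | "l \<le> i" | "j \<le> l" | "e $$ (i, j) \<noteq> 0" "i < l" "l < j" by linarith
    then show "\<theta> (e $$ (i, j) * a $$ (i, l) * \<sigma> b $$ (l, j)) = 1"
    proof cases
      case 2
      then show ?thesis using J0[OF polarD(1)[OF a]] ijl by (simp add: \<theta>_zero)
    next
      case 3
      then have "b $$ (?j, ?l) = 0" using ijl by (intro J0[OF polarD(1)[OF b]]) auto
      then show ?thesis by (simp add: \<sigma>b \<tau>_zero \<theta>_zero)
    next
      case 4
      have e': "e $$ (?j, ?i) \<noteq> 0" using einv0 ijl 4 by blast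
      have ord: "?j < ?l" "?l < ?i" "?i < n" using 4 ijl by auto
      consider "Suc (i + j) < n" | "Suc (i + j) > n" | "Suc (i + j) = n" by linarith
      then show ?thesis
      proof cases
        case 1
        then show ?thesis using polarD(2)[OF a] 4 ijl by (simp add: \<theta>_zero)
      next
        case 2
        then have "Suc (?j + ?i) < n" using ijl by linarith
        then have "b $$ (?j, ?l) = 0" using polarD(2)[OF b ord e'] by simp
        then show ?thesis by (simp add: \<sigma>b \<tau>_zero \<theta>_zero)
      next
        case 3
        then have ij': "?j = i" "?i = j" by auto
        consider "Suc (2 * l) < n" | "Suc (2 * l) > n" | "Suc (2 * l) = n" by linarith
        then show ?thesis
        proof cases
          case 1
          then show ?thesis using polarD(3)[OF a] 4 3 ijl by (simp add: \<theta>_zero)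
        next
          case 2
          then have "Suc (2 * ?l) < n" using ijl by linarith
          then have "b $$ (?j, ?l) = 0" using polarD(3)[OF b ord e'] 3 ij' by simp
          then show ?thesis by (simp add: \<sigma>b \<tau>_zero \<theta>_zero)
        next
          case l: 3
          then have l': "?l = l" by auto
          have fa: "\<tau> (a $$ (i, l)) = a $$ (i, l)" using polarD(4)[OF a] 4 3 l ijl by blast
          have fb: "\<tau> (b $$ (i, l)) = b $$ (i, l)" using polarD(4)[OF b] 4 3 l ijl by blast
          show ?thesis
            unfolding \<sigma>b ij' l' fb using anti[OF 4(2,3) ijl(2) 3 l fa fb] .
        qed
      qed
    qed (simp add: \<theta>_zero)
  qed
  have maximal: "a \<in> polar e"
    if aJ: "a \<in> strict_upper n" and one: "\<And>b. b \<in> polar e \<Longrightarrow> lam (transpose_mat e) (a * \<sigma> b) = 1" for a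
  proof -
    have ac: "a \<in> carrier_mat n n" by (rule strict_upper_carrier[OF aJ])
    \<comment> \<open>\<sigma> sends the unit at (j', l') to a multiple of the unit at (l, j), which
      isolates the product of e_ij and a_il.\<close>
    have test: "\<theta> (e $$ (i, j) * (s l * s j) * a $$ (i, l) * \<tau> \<beta>) = 1"
      if ij: "i < l" "l < j" "j < n" "e $$ (i, j) \<noteq> 0" and b: "unit_mat (n - Suc j) (n - Suc l) \<beta> \<in> polar e" for i j l \<beta>
    proof -
      have r: "n - Suc (n - Suc j) = j" "n - Suc (n - Suc l) = l" using ij by auto
      have "\<sigma> (unit_mat (n - Suc j) (n - Suc l) \<beta>) = unit_mat l j (s l * s j * \<tau> \<beta>)"
        using ij \<sigma>_unit_mat[of "n - Suc j" "n - Suc l" \<beta>] by (simp add: r)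
      then have "1 = \<theta> (\<Sum>i<n. e $$ (i, j) * a $$ (i, l) * (s l * s j * \<tau> \<beta>))"
        using one[OF b] lam_unit[OF ec ac, of l j] ij by simp
      also have "(\<Sum>i<n. e $$ (i, j) * a $$ (i, l) * (s l * s j * \<tau> \<beta>)) =
          (\<Sum>r<n. if r = i then e $$ (i, j) * a $$ (i, l) * (s l * s j * \<tau> \<beta>) else 0)"
      proof (intro sum.cong refl)
        fix r assume "r \<in> {..<n}"
        then show "e $$ (r, j) * a $$ (r, l) * (s l * s j * \<tau> \<beta>) =
            (if r = i then e $$ (i, j) * a $$ (i, l) * (s l * s j * \<tau> \<beta>) else 0)"
          using monomial_col[OF mono, of r i j] ij by (cases "r = i") auto
      qed
      finally show ?thesis using ij by (simp add: mult_ac)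
    qed
    have nz: "e $$ (i, j) * (s l * s j) \<noteq> 0" if "e $$ (i, j) \<noteq> 0" for i j l
      using that s_cases[of l] s_cases[of j] by auto
    have zero: "a $$ (i, l) = 0"
      if ij: "i < l" "l < j" "j < n" "e $$ (i, j) \<noteq> 0"
        and b: "\<And>\<beta>. unit_mat (n - Suc j) (n - Suc l) \<beta> \<in> polar e" for i j l
    proof -
      have "\<theta> (e $$ (i, j) * (s l * s j) * a $$ (i, l) * \<beta>) = 1" for \<beta>
        using test[OF ij b[of "\<tau> \<beta>"]] by (simp add: \<tau>_\<tau>)
      then have "e $$ (i, j) * (s l * s j) * a $$ (i, l) = 0" by (rule \<theta>_nondegenerate)
      then show ?thesis using nz[OF ij(4), of l] by (metis mult_eq_0_iff)
    qed
    have e_row: "c = n - Suc i" if "i < n" "j < n" "c < n" "e $$ (i, j) \<noteq> 0" "e $$ (n - Suc j, c) \<noteq> 0" for i j c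
      using monomial_row[OF mono, of "n - Suc j" c "n - Suc i"] einv0[OF that(1,2,4)] that by auto
    \<comment> \<open>The pivot of row j' is in column i'. By \<open>ok\<close> it lies below the
      antidiagonal, or on it with l' in the right half, so the position (j', l') is free; or l' is
      the middle column and the scalar is fixed by \<tau>.\<close>
    have unit_polar: "unit_mat (n - Suc j) (n - Suc l) \<beta> \<in> polar e"
      if ij: "i < l" "l < j" "j < n" "e $$ (i, j) \<noteq> 0"
        and ok: "Suc (i + j) < n \<or> Suc (i + j) = n \<and> (Suc (2 * l) < n \<or> Suc (2 * l) = n \<and> \<tau> \<beta> = \<beta>)" for i j l \<beta>
      unfolding polar_def
    proof (intro CollectI conjI allI impI)
      let ?u = "unit_mat (n - Suc j) (n - Suc l) \<beta>"
      show "?u \<in> strict_upper n" using ij by (intro unit_mat_J) linarith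
      fix r c m assume rcm: "r < m" "m < c" "c < n" "e $$ (r, c) \<noteq> 0"
      have u: "?u $$ (r, m) = (if r = n - Suc j \<and> m = n - Suc l then \<beta> else 0)"
        using rcm by (simp add: unit_mat_def)
      have key: "c = n - Suc i" if "r = n - Suc j" using e_row[of i j c] ij rcm that by auto
      show "?u $$ (r, m) = 0" if "Suc (r + c) < n"
        using u key ok ij that by (auto split: if_splits)
      show "?u $$ (r, m) = 0" if "Suc (r + c) = n" "Suc (2 * m) < n"
        using u key ok ij that by (auto split: if_splits)
      show "\<tau> (?u $$ (r, m)) = ?u $$ (r, m)" if "Suc (r + c) = n" "Suc (2 * m) = n"
        using u key ok ij that by (auto split: if_splits simp: \<tau>_zero)
    qed
    show "a \<in> polar e"
      unfolding polar_def
    proof (intro CollectI conjI allI impI aJ)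
      fix i j l assume ij: "i < l" "l < j" "j < n" "e $$ (i, j) \<noteq> 0"
      show "a $$ (i, l) = 0" if "Suc (i + j) < n"
        using that by (intro zero[OF ij] unit_polar[OF ij]) simp
      show "a $$ (i, l) = 0" if "Suc (i + j) = n" "Suc (2 * l) < n"
        using that by (intro zero[OF ij] unit_polar[OF ij]) simp
      show "\<tau> (a $$ (i, l)) = a $$ (i, l)" if n: "Suc (i + j) = n" "Suc (2 * l) = n"
      proof (rule \<theta>_fixed_dual[OF _ nz[OF ij(4), of l]])
        have i': "n - Suc j = i" "n - Suc i = j" "n - Suc l = l" using n ij by auto
        have ss: "s i * s j = 1"
          using s_reflect[of i] s_reflect[of l] ij i' by (simp add: s_sq)
        have ijn: "i < n" "j < n" using ij by auto
        have "\<tau> (e $$ (i, j)) = - e $$ (i, j)" using einv[OF ijn] unfolding i' ss mult_1 .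
        then show "\<tau> (e $$ (i, j) * (s l * s j)) = - (e $$ (i, j) * (s l * s j))"
          by (simp add: \<tau>_mult \<tau>_s)
        fix \<beta> assume \<beta>: "\<tau> \<beta> = \<beta>"
        show "\<theta> (e $$ (i, j) * (s l * s j) * a $$ (i, l) * \<beta>) = 1"
          using test[OF ij unit_polar[OF ij, of \<beta>]] n \<beta> by simp
      qed
    qed
  qed
  have radical: "lam (transpose_mat e) (a * b) = 1"
    if a: "a \<in> polar e" and one: "\<And>c. c \<in> skew \<Longrightarrow> lam (transpose_mat e) (a * c) = 1" and b: "b \<in> strict_upper n" for a b
  proof -
    have ac: "a \<in> carrier_mat n n" by (rule polar_c[OF a])
    \<comment> \<open>u - \<sigma>(u) is skew, so the hypothesis allows \<sigma> to be applied to
      the second factor.\<close>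
    have flip: "lam (transpose_mat e) (a * u) = lam (transpose_mat e) (a * \<sigma> u)" if u: "u \<in> strict_upper n" for u
    proof -
      have uc: "u \<in> carrier_mat n n" by (rule strict_upper_carrier[OF u])
      have "u - \<sigma> u \<in> skew" using skew_symmetrize[OF u] uc \<sigma>_carrier by (simp add: a_minus_mat)
      then have 1: "lam (transpose_mat e) (a * (u - \<sigma> u)) = 1" by (rule one)
      have "a * u = a * (u - \<sigma> u) + a * \<sigma> u"
      proof -
        have "a * (u - \<sigma> u) + a * \<sigma> u = a * ((u - \<sigma> u) + \<sigma> u)"
          using ac uc \<sigma>_carrier by (intro mult_add_distrib_mat[symmetric]) (auto intro: minus_carrier_mat)
        also have "(u - \<sigma> u) + \<sigma> u = u" using uc \<sigma>_carrier[of u] by (intro eq_matI) auto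
        finally show ?thesis by simp
      qed
      then show ?thesis
        using 1 ac uc ec \<sigma>_carrier[of u]
        by (simp add: lam_add mat_mult_closed minus_carrier_mat)
    qed
    \<comment> \<open>Suppose the pivot of column j lies above row l and on or below the
      antidiagonal. Then the reflected unit at (j', l') is used: a pivot (r, l') with r < j' is
      strictly above the antidiagonal, so a vanishes at (r, j'). Otherwise a already vanishes in
      column l at the pivot row of column j.\<close>
    have unit_one: "lam (transpose_mat e) (a * unit_mat l j \<beta>) = 1" if lj: "l < j" "j < n" for l j \<beta>
    proof (cases "\<exists>i<l. e $$ (i, j) \<noteq> 0 \<and> n \<le> Suc (i + j)")
      case True
      then obtain i where i: "i < l" "e $$ (i, j) \<noteq> 0" "n \<le> Suc (i + j)" by blast
      have "lam (transpose_mat e) (a * unit_mat l j \<beta>) =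
          lam (transpose_mat e) (a * unit_mat (n - Suc j) (n - Suc l) (s (n - Suc j) * s (n - Suc l) * \<tau> \<beta>))"
        using flip[OF unit_mat_J[OF lj(1)]] lj by (simp add: \<sigma>_unit_mat)
      also have "\<dots> = \<theta> (\<Sum>r<n. e $$ (r, n - Suc l) * a $$ (r, n - Suc j) * (s (n - Suc j) * s (n - Suc l) * \<tau> \<beta>))"
        using lj by (intro lam_unit[OF ec ac]) auto
      also have "\<dots> = 1"
      proof (rule \<theta>_sum_one)
        fix r assume r: "r \<in> {..<n}"
        have "e $$ (r, n - Suc l) = 0 \<or> a $$ (r, n - Suc j) = 0"
        proof (cases "r < n - Suc j")
          case True
          then show ?thesis
            using polarD(2)[OF a True, of "n - Suc l"] lj i by (cases "e $$ (r, n - Suc l) = 0") auto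
        next
          case False
          then show ?thesis using J0[OF polarD(1)[OF a], of r "n - Suc j"] r lj by simp
        qed
        then show "\<theta> (e $$ (r, n - Suc l) * a $$ (r, n - Suc j) * (s (n - Suc j) * s (n - Suc l) * \<tau> \<beta>)) = 1"
          by (auto simp: \<theta>_zero)
      qed
      finally show ?thesis .
    next
      case False
      have "lam (transpose_mat e) (a * unit_mat l j \<beta>) = \<theta> (\<Sum>i<n. e $$ (i, j) * a $$ (i, l) * \<beta>)"
        using lj by (intro lam_unit[OF ec ac]) auto
      also have "\<dots> = 1"
      proof (rule \<theta>_sum_one)
        fix i assume i: "i \<in> {..<n}"
        have "e $$ (i, j) = 0 \<or> a $$ (i, l) = 0"
        proof (cases "i < l")
          case True
          then show ?thesis
            using polarD(2)[OF a True lj] False by (cases "e $$ (i, j) = 0") auto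
        next
          case False
          then show ?thesis using J0[OF polarD(1)[OF a], of i l] i lj by simp
        qed
        then show "\<theta> (e $$ (i, j) * a $$ (i, l) * \<beta>) = 1" by (auto simp: \<theta>_zero)
      qed
      finally show ?thesis .
    qed
    show ?thesis
    proof (rule lam_product_one[OF ec ac strict_upper_carrier[OF b]])
      fix i j l assume ijl: "i < n" "j < n" "l < n"
      show "\<theta> (e $$ (i, j) * a $$ (i, l) * b $$ (l, j)) = 1"
      proof (cases "e $$ (i, j) \<noteq> 0 \<and> l < j")
        case True
        have "1 = \<theta> (\<Sum>r<n. e $$ (r, j) * a $$ (r, l) * b $$ (l, j))"
          using unit_one[of l j "b $$ (l, j)"] lam_unit[OF ec ac, of l j "b $$ (l, j)"] True ijl by simp
        also have "(\<Sum>r<n. e $$ (r, j) * a $$ (r, l) * b $$ (l, j)) =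
            (\<Sum>r<n. if r = i then e $$ (i, j) * a $$ (i, l) * b $$ (l, j) else 0)"
        proof (intro sum.cong refl)
          fix r assume "r \<in> {..<n}"
          then show "e $$ (r, j) * a $$ (r, l) * b $$ (l, j) =
              (if r = i then e $$ (i, j) * a $$ (i, l) * b $$ (l, j) else 0)"
            using monomial_col[OF mono, of r i j] ijl True by (cases "r = i") auto
        qed
        finally show ?thesis using ijl by simp
      next
        case False
        then show ?thesis using J0[OF b, of l j] ijl by (auto simp: \<theta>_zero not_less)
      qed
    qed
  qed
  \<comment> \<open>Column l of the product uses only columns of a to the left of l. The zeros
    prescribed in a row form an initial segment, so on the antidiagonal the product vanishes even in
    the middle column.\<close>
  have mult: "a * b \<in> polar e" if a: "a \<in> polar e" and b: "b \<in> strict_upper n" for a b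
  proof -
    have c: "a \<in> carrier_mat n n" "b \<in> carrier_mat n n" using polar_c a b strict_upper_carrier by auto
    have z: "(a * b) $$ (i, l) = 0" if il: "i < n" "l < n" and h: "\<And>r. \<lbrakk>i < r; r < l\<rbrakk> \<Longrightarrow> a $$ (i, r) = 0" for i l
    proof -
      have "a $$ (i, r) * b $$ (r, l) = 0" if "r < n" for r
        using h[of r] J0[OF polarD(1)[OF a], of i r] J0[OF b, of r l] il that
        by (cases "i < r"; cases "r < l") auto
      then show ?thesis unfolding mat_mult_entry[OF c il] by (intro sum.neutral) auto
    qed
    show ?thesis
      unfolding polar_def
    proof (intro CollectI conjI allI impI)
      show "a * b \<in> strict_upper n" by (rule strict_upper_mult[OF polarD(1)[OF a] b])
      fix i j l assume ij: "i < l" "l < j" "j < n" "e $$ (i, j) \<noteq> 0"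
      show "(a * b) $$ (i, l) = 0" if "Suc (i + j) < n"
        using ij that by (intro z polarD(2)[OF a _ _ ij(3,4)]) auto
      have *: "(a * b) $$ (i, l) = 0" if "Suc (i + j) = n" "Suc (2 * l) \<le> n"
        using ij that by (intro z polarD(3)[OF a _ _ ij(3,4)]) auto
      then show "(a * b) $$ (i, l) = 0" if "Suc (i + j) = n" "Suc (2 * l) < n" using that by simp
      show "\<tau> ((a * b) $$ (i, l)) = (a * b) $$ (i, l)" if "Suc (i + j) = n" "Suc (2 * l) = n"
        using * that by (simp add: \<tau>_zero)
    qed
  qed
  have zero: "0\<^sub>m n n \<in> polar e"
    by (auto simp: polar_def strict_upper_def \<tau>_zero)
  have add: "a + b \<in> polar e" if a: "a \<in> polar e" and b: "b \<in> polar e" for a b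
  proof -
    have c: "a \<in> carrier_mat n n" "b \<in> carrier_mat n n" using polar_c a b by auto
    have "(a + b) $$ (i, l) = a $$ (i, l) + b $$ (i, l)" if "i < n" "l < n" for i l
      using c that by simp
    moreover have "a + b \<in> strict_upper n" by (rule J_add[OF polarD(1)[OF a] polarD(1)[OF b]])
    ultimately show ?thesis
      using polarD[OF a] polarD[OF b] by (simp add: polar_def \<tau>_add)
  qed
  have neg: "- a \<in> polar e" if a: "a \<in> polar e" for a
  proof -
    have c: "a \<in> carrier_mat n n" using polar_c a by auto
    have "(- a) $$ (i, l) = - a $$ (i, l)" if "i < n" "l < n" for i l
      using c that by simp
    moreover have "- a \<in> strict_upper n" by (rule strict_upper_uminus[OF polarD(1)[OF a]])
    ultimately show ?thesis
      using polarD[OF a] by (simp add: polar_def \<tau>_neg)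
  qed
  have half: "half * a \<in> polar e" if a: "a \<in> polar e" for a
  proof -
    have c: "a \<in> carrier_mat n n" using polar_c a by auto
    have ent: "(half * a) $$ (i, l) = a $$ (i, l) / 2" if "i < l" "l < j" "j < n" for i j l
      using c that by (simp add: half_mult)
    show ?thesis
      unfolding polar_def
    proof (intro CollectI conjI allI impI)
      show "half * a \<in> strict_upper n" by (rule J_half[OF polarD(1)[OF a]])
      fix i j l assume ij: "i < l" "l < j" "j < n" "e $$ (i, j) \<noteq> 0"
      show "(half * a) $$ (i, l) = 0" if "Suc (i + j) < n"
        using polarD(2)[OF a ij that] ent[OF ij(1-3)] by simp
      show "(half * a) $$ (i, l) = 0" if "Suc (i + j) = n" "Suc (2 * l) < n"
        using polarD(3)[OF a ij that] ent[OF ij(1-3)] by simp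
      show "\<tau> ((half * a) $$ (i, l)) = (half * a) $$ (i, l)" if "Suc (i + j) = n" "Suc (2 * l) = n"
        using polarD(4)[OF a ij that] by (simp only: ent[OF ij(1-3)] \<tau>_half)
    qed
  qed
  show ?thesis
  proof (intro polarization.intro[OF E.invariant_character_axioms] polarization_axioms.intro, unfold ring_mat_simps)
    fix a b assume a: "a \<in> polar e"
    show "a \<in> strict_upper n" by (rule polarD(1)[OF a])
    show "half * a \<in> polar e" by (rule half[OF a])
    show "\<ominus>\<^bsub>R\<^esub> a \<in> polar e" using neg[OF a] polar_c[OF a] by (simp add: a_inv_mat)
    show "a + b \<in> polar e" if "b \<in> polar e" by (rule add[OF a that])
    show "lam (transpose_mat e) (a * \<sigma> b) = 1" if "b \<in> polar e" by (rule isotropic[OF a that])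
    show "a * b \<in> polar e" if "b \<in> strict_upper n" by (rule mult[OF a that])
    show "lam (transpose_mat e) (a * b) = 1"
      if "\<And>c. c \<in> skew \<Longrightarrow> lam (transpose_mat e) (a * c) = 1" "b \<in> strict_upper n"
      by (rule radical[OF a that])
  next
    fix a assume "a \<in> strict_upper n" "\<And>b. b \<in> polar e \<Longrightarrow> lam (transpose_mat e) (a * \<sigma> b) = 1"
    then show "a \<in> polar e" by (rule maximal)
  qed (rule zero)
qed

end

section \<open>Orbits of matrices and of linear characters\<close>

lemma monomial_transpose: "monomial_mat n e \<Longrightarrow> monomial_mat n (transpose_mat e)"
  unfolding monomial_upto_def by auto

context canonical_involution
begin

lemma UT_inv:
  assumes "x \<in> UT n"
  shows "inv\<^bsub>R\<^esub> x \<in> UT n" "x * inv\<^bsub>R\<^esub> x = 1\<^sub>m n" "inv\<^bsub>R\<^esub> x * x = 1\<^sub>m n"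
  using assms P_inv P_r_inv P_l_inv by (auto simp: P_UT)

lemma UT_cancel:
  assumes "x \<in> UT n" and "a \<in> carrier_mat n n"
  shows "x * (inv\<^bsub>R\<^esub> x * a) = a" "inv\<^bsub>R\<^esub> x * (x * a) = a"
proof -
  note c = UT_carrier[OF assms(1)] UT_carrier[OF UT_inv(1)[OF assms(1)]] assms(2)
  show "x * (inv\<^bsub>R\<^esub> x * a) = a" "inv\<^bsub>R\<^esub> x * (x * a) = a"
    using c UT_inv[OF assms(1)] by (simp_all add: mat_assoc[where n = n, symmetric] left_mult_one_mat[of _ n n])
qed

lemma UT_J: "\<lbrakk>x \<in> UT n; a \<in> strict_upper n\<rbrakk> \<Longrightarrow> x * a \<in> strict_upper n"
  and J_UT: "\<lbrakk>a \<in> strict_upper n; x \<in> UT n\<rbrakk> \<Longrightarrow> a * x \<in> strict_upper n"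
  and UT_\<sigma>: "x \<in> UT n \<Longrightarrow> \<sigma> x \<in> UT n"
  using PJ JP P_invol by (auto simp: P_UT)

lemma lam_eq_entries:
  assumes m: "m \<in> carrier_mat n n" "m' \<in> carrier_mat n n"
    and eq: "\<And>a. a \<in> strict_upper n \<Longrightarrow> lam m a = lam m' a" and ij: "j < i" "i < n"
  shows "m $$ (i, j) = m' $$ (i, j)"
proof -
  have entry: "lam k (unit_mat j i \<beta>) = \<theta> (k $$ (i, j) * \<beta>)" if k: "k \<in> carrier_mat n n" for k \<beta>
  proof -
    have "trace_form n k (unit_mat j i \<beta>) = (\<Sum>r<n. \<Sum>c<n. if c = j then (if r = i then k $$ (i, j) * \<beta> else 0) else 0)"
      unfolding trace_form_sum[OF k unit_mat_carrier]
      by (intro sum.cong refl) (auto simp: unit_mat_def)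
    then show ?thesis using ij by (simp add: lam_def)
  qed
  have "\<theta> ((m $$ (i, j) - m' $$ (i, j)) * \<beta>) = 1" for \<beta>
  proof -
    have e: "\<theta> (m $$ (i, j) * \<beta>) = \<theta> (m' $$ (i, j) * \<beta>)"
      using eq[OF unit_mat_J[OF ij(1), of \<beta>]] by (simp add: entry m)
    have "\<theta> ((m $$ (i, j) - m' $$ (i, j)) * \<beta>) = \<theta> (m $$ (i, j) * \<beta>) * \<theta> (- (m' $$ (i, j) * \<beta>))"
      unfolding \<theta>_add[symmetric] by (simp add: left_diff_distrib)
    then show ?thesis unfolding e \<theta>_neg .
  qed
  then have "m $$ (i, j) - m' $$ (i, j) = 0" by (rule \<theta>_nondegenerate)
  then show ?thesis by simp
qed

lemma lam_mult:
  "\<lbrakk>m \<in> carrier_mat n n; a \<in> carrier_mat n n; x \<in> carrier_mat n n; y \<in> carrier_mat n n\<rbrakk> \<Longrightarrow>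
    lam m (x * a * y) = lam (y * m * x) a"
  by (simp only: lam_def trace_form_mult)

text \<open>Moving u and v' to the other side leaves two matrices with the same character of J,
  hence by \<open>lam_eq_entries\<close> with the same entries strictly below the diagonal. The
  transposes of e and e' are supported there, so \<open>monomial_unique\<close> applies with this
  region as Z.\<close>

lemma char_orbit_unique:
  assumes e: "e \<in> strict_upper n" "monomial_mat n e" and e': "e' \<in> strict_upper n" "monomial_mat n e'"
    and uv: "u \<in> UT n" "v \<in> UT n" "u' \<in> UT n" "v' \<in> UT n"
    and eq: "\<And>a. a \<in> strict_upper n \<Longrightarrow> lam (transpose_mat e) (u * a * v) = lam (transpose_mat e') (u' * a * v')"
  shows "e = e'"
proof -
  note ec = strict_upper_carrier[OF e(1)] strict_upper_carrier[OF e'(1)]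
  define w where "w = inv\<^bsub>R\<^esub> v' * v"
  define w' where "w' = u' * inv\<^bsub>R\<^esub> u"
  have w: "w \<in> UT n" "w' \<in> UT n" using uv by (auto simp: w_def w'_def UT_mult UT_inv)
  note c = uv[THEN UT_carrier] w[THEN UT_carrier] UT_inv(1)[OF uv(1), THEN UT_carrier] UT_inv(1)[OF uv(4), THEN UT_carrier]
  have te: "transpose_mat e \<in> carrier_mat n n" "transpose_mat e' \<in> carrier_mat n n" using ec by auto
  have "lam (w * transpose_mat e) a = lam (transpose_mat e' * w') a" if a: "a \<in> strict_upper n" for a
  proof -
    note ac = strict_upper_carrier[OF a]
    define b where "b = inv\<^bsub>R\<^esub> u * a * inv\<^bsub>R\<^esub> v'"
    have bJ: "b \<in> strict_upper n" using a uv by (simp add: b_def UT_J J_UT UT_inv)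
    have "u * b * v = 1\<^sub>m n * a * w"
      using c ac uv by (simp add: b_def w_def mat_assoc[where n = n] mat_mult_closed UT_cancel left_mult_one_mat[of _ n n])
    moreover have "u' * b * v' = w' * a * 1\<^sub>m n"
      using c ac uv UT_inv(3)[OF uv(4)] by (simp add: b_def w'_def mat_assoc[where n = n] mat_mult_closed)
    ultimately have "lam (transpose_mat e) (1\<^sub>m n * a * w) = lam (transpose_mat e') (w' * a * 1\<^sub>m n)"
      using eq[OF bJ] by simp
    then show ?thesis
      using c ac te lam_mult[OF te(1) ac one_carrier_mat c(5)] lam_mult[OF te(2) ac c(6) one_carrier_mat]
      by (simp add: mat_mult_closed mat_assoc[where n = n])
  qed
  then have "(w * transpose_mat e) $$ (i, j) = (transpose_mat e' * w') $$ (i, j)" if "j < i" "i < n" for i j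
    using te c that by (intro lam_eq_entries) (auto intro: mat_mult_closed)
  then have "transpose_mat e = transpose_mat e'"
    using e e' w
    by (intro monomial_unique[OF monomial_transpose[OF e(2)] monomial_transpose[OF e'(2)] w, of "{(i, j). j < i}"])
      (auto simp: strict_upper_def not_less[symmetric] intro: ccontr)
  then show ?thesis by (metis transpose_transpose)
qed

lemma double_coset_unique:
  fixes e e' :: "'k mat"
  assumes e: "monomial_mat n e" "monomial_mat n e'"
    and uv: "u \<in> UT n" "v \<in> UT n" "u' \<in> UT n" "v' \<in> UT n"
    and eq: "u * e * v = u' * e' * v'"
  shows "e = e'"
proof -
  have ec: "e \<in> carrier_mat n n" "e' \<in> carrier_mat n n" using e by (auto simp: monomial_upto_def)
  note c = uv[THEN UT_carrier] UT_inv(1)[OF uv(2), THEN UT_carrier] UT_inv(1)[OF uv(3), THEN UT_carrier] ec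
  have "inv\<^bsub>R\<^esub> u' * (u * e * v) * inv\<^bsub>R\<^esub> v = inv\<^bsub>R\<^esub> u' * (u' * e' * v') * inv\<^bsub>R\<^esub> v"
    unfolding eq ..
  moreover have "inv\<^bsub>R\<^esub> u' * (u * e * v) * inv\<^bsub>R\<^esub> v = (inv\<^bsub>R\<^esub> u' * u) * e"
    using c uv UT_inv(2)[OF uv(2)] by (simp add: mat_assoc[where n = n] mat_mult_closed)
  moreover have "inv\<^bsub>R\<^esub> u' * (u' * e' * v') * inv\<^bsub>R\<^esub> v = e' * (v' * inv\<^bsub>R\<^esub> v)"
    using c uv by (simp add: mat_assoc[where n = n] mat_mult_closed UT_cancel)
  ultimately have "(inv\<^bsub>R\<^esub> u' * u) * e = e' * (v' * inv\<^bsub>R\<^esub> v)" by simp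
  then show ?thesis
    by (intro monomial_unique[OF e UT_mult[OF UT_inv(1)[OF uv(3)] uv(1)]
          UT_mult[OF uv(4) UT_inv(1)[OF uv(2)]], where Z = UNIV]) auto
qed

lemma monomial_uminus_\<sigma>:
  assumes e: "monomial_mat n e" shows "monomial_mat n (- \<sigma> e)"
proof -
  have nz: "(- \<sigma> e) $$ (i, j) \<noteq> 0 \<longleftrightarrow> e $$ (n - Suc j, n - Suc i) \<noteq> 0" if "i < n" "j < n" for i j
    using that s_cases[of i] s_cases[of j] \<tau>_\<tau>[of "e $$ (n - Suc j, n - Suc i)"] \<sigma>_carrier[of e]
    by (auto simp: \<sigma>_entry \<tau>_zero)
  have inj: "i = j" if "i < n" "j < n" "n - Suc i = n - Suc j" for i j using that by linarith
  show ?thesis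
    unfolding monomial_upto_def
  proof (intro conjI allI impI)
    fix i j j' assume h: "i < n" "j < n" "j' < n" "(- \<sigma> e) $$ (i, j) \<noteq> 0" "(- \<sigma> e) $$ (i, j') \<noteq> 0"
    then have "n - Suc j = n - Suc j'"
      by (intro monomial_col[OF e, of _ _ "n - Suc i"]) (auto simp: nz)
    then show "j = j'" using inj h by blast
  next
    fix i i' j assume h: "i < n" "i' < n" "j < n" "(- \<sigma> e) $$ (i, j) \<noteq> 0" "(- \<sigma> e) $$ (i', j) \<noteq> 0"
    then have "n - Suc i = n - Suc i'"
      by (intro monomial_row[OF e, of "n - Suc j"]) (auto simp: nz)
    then show "i = i'" using inj h by blast
  qed (simp add: \<sigma>_carrier)
qed

lemma \<sigma>_uminus: "a \<in> carrier_mat n n \<Longrightarrow> \<sigma> (- a) = - \<sigma> a"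
  by (intro eq_matI) (auto simp: \<sigma>_def \<tau>_neg)

lemma uminus_\<sigma>_J: "a \<in> strict_upper n \<Longrightarrow> - \<sigma> a \<in> strict_upper n"
  by (intro strict_upper_uminus \<sigma>_strict_upper)

lemma skew_iff: "a \<in> skew \<longleftrightarrow> a \<in> strict_upper n \<and> \<sigma> a = - a"
  by (auto simp: skew_def a_inv_mat strict_upper_carrier)

lemma uminus_mult3:
  fixes a b c :: "'k mat"
  assumes "a \<in> carrier_mat n n" "b \<in> carrier_mat n n" "c \<in> carrier_mat n n"
  shows "a * (- b) * c = - (a * b * c)"
  using assms by auto

text \<open>A monomial e in the double coset of c is skew automatically: - \<sigma>(e) is monomial
  and in the same double coset because c is skew, so uniqueness gives - \<sigma>(e) = e.\<close>

lemma skew_double_coset: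
  assumes c: "c \<in> skew"
  obtains e x y where "e \<in> B" "x \<in> UT n" "y \<in> UT n" "c = x * e * y"
proof -
  have cJ: "c \<in> strict_upper n" "\<sigma> c = - c" using c by (auto simp: skew_iff)
  note cc = strict_upper_carrier[OF cJ(1)]
  obtain x y where xy: "x \<in> UT n" "y \<in> UT n" and mono: "monomial_mat n (x * c * y)"
    using monomial_form[OF cc] .
  define e where "e = x * c * y"
  have eJ: "e \<in> strict_upper n" using xy cJ by (simp add: e_def UT_J J_UT)
  note ec = strict_upper_carrier[OF eJ]
  note u = UT_inv(1)[OF xy(1)] UT_inv(1)[OF xy(2)]
  note Pc = xy[THEN UT_carrier] u[THEN UT_carrier] UT_\<sigma>[OF xy(1), THEN UT_carrier] UT_\<sigma>[OF xy(2), THEN UT_carrier]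
  have ce: "c = inv\<^bsub>R\<^esub> x * e * inv\<^bsub>R\<^esub> y"
    using Pc cc xy UT_inv(2)[OF xy(2)] by (simp add: e_def mat_assoc[where n = n] mat_mult_closed UT_cancel)
  have "\<sigma> e = - (\<sigma> y * c * \<sigma> x)"
    using Pc cc by (simp add: e_def \<sigma>_mult mat_mult_closed cJ(2) mat_assoc[where n = n])
  then have "- \<sigma> e = \<sigma> y * c * \<sigma> x"
    using Pc cc by (simp add: mat_mult_closed)
  also have "\<dots> = (\<sigma> y * inv\<^bsub>R\<^esub> x) * e * (inv\<^bsub>R\<^esub> y * \<sigma> x)"
    using Pc cc ec by (simp add: ce mat_assoc[where n = n] mat_mult_closed)
  finally have "- \<sigma> e = (\<sigma> y * inv\<^bsub>R\<^esub> x) * e * (inv\<^bsub>R\<^esub> y * \<sigma> x)" .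
  moreover have "1\<^sub>m n * (- \<sigma> e) * 1\<^sub>m n = - \<sigma> e"
    using \<sigma>_carrier[of e] by (simp add: left_mult_one_mat[of _ n n] right_mult_one_mat[of _ n n])
  ultimately have "1\<^sub>m n * (- \<sigma> e) * 1\<^sub>m n = (\<sigma> y * inv\<^bsub>R\<^esub> x) * e * (inv\<^bsub>R\<^esub> y * \<sigma> x)"
    by (rule trans[rotated])
  then have "- \<sigma> e = e"
    by (rule double_coset_unique[OF monomial_uminus_\<sigma> _ UT_one UT_one
        UT_mult[OF UT_\<sigma>[OF xy(2)] u(1)] UT_mult[OF u(2) UT_\<sigma>[OF xy(1)]], rotated -1])
      (simp_all add: mono e_def)
  then have "\<sigma> e = - e" using \<sigma>_carrier[of e] by (metis uminus_uminus_mat)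
  then have "e \<in> B" using eJ mono by (simp add: B_def e_def)
  then show thesis using that ce u by blast
qed

definition Om :: "'k mat \<Rightarrow> ('k mat \<Rightarrow> complex) set" where
  "Om e = {(\<lambda>a\<in>strict_upper n. lam (transpose_mat e) (z * a * \<sigma> z)) | z. z \<in> UT n}"

lemma orbit_facts:
  assumes "e \<in> B"
  shows "Om e \<subseteq> inv_chars"
    and "orbit_char (Om e) \<in> characters C"
    and "\<lbrakk>w \<in> UT n; c \<in> strict_upper n\<rbrakk> \<Longrightarrow> (\<Sum>\<mu>\<in>Om e. \<mu> (w * c * \<sigma> w)) = (\<Sum>\<mu>\<in>Om e. \<mu> c)"
    and "\<lbrakk>x \<in> UT n; y \<in> UT n; \<And>a. a \<in> strict_upper n \<Longrightarrow>
        lam (transpose_mat e) (x * (- \<sigma> a) * y) = lam (transpose_mat e) (x * a * y)\<rbrakk> \<Longrightarrow>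
      (\<lambda>a\<in>strict_upper n. lam (transpose_mat e) (x * a * y)) \<in> Om e"
proof -
  interpret E: polarization R "strict_upper n" \<sigma> half "CHAR('k)" logJ "lam (transpose_mat e)" "polar e"
    rewrites "carrier R = carrier_mat n n"
    and "monoid.mult R = (*)"
    and "add R = (+)"
    and "one R = 1\<^sub>m n"
    and "zero R = 0\<^sub>m n n"
    using polarization_polar[OF assms] by (simp_all add: ring_mat_simps)
  have Om: "Om e = E.\<Omega>"
    by (auto simp: Om_def E.\<Omega>_def E.tw_char_def E.tw_def P_UT)
  show "Om e \<subseteq> inv_chars" unfolding Om by (rule E.\<Omega>_inv_chars)
  show "orbit_char (Om e) \<in> characters C" unfolding Om by (rule E.orbit_char_character)
  show "(\<Sum>\<mu>\<in>Om e. \<mu> (w * c * \<sigma> w)) = (\<Sum>\<mu>\<in>Om e. \<mu> c)" if "w \<in> UT n" "c \<in> strict_upper n"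
    using E.orbit_sum_tw[of w c] that by (simp add: Om E.tw_def P_UT)
  show "(\<lambda>a\<in>strict_upper n. lam (transpose_mat e) (x * a * y)) \<in> Om e"
    if "x \<in> UT n" "y \<in> UT n"
      "\<And>a. a \<in> strict_upper n \<Longrightarrow> lam (transpose_mat e) (x * (- \<sigma> a) * y) = lam (transpose_mat e) (x * a * y)"
    using E.twisted_conj_char[of x y] that by (simp add: Om P_UT a_inv_mat \<sigma>_carrier)
qed

lemma Om_disjoint:
  assumes e: "e \<in> B" "e' \<in> B" and \<mu>: "\<mu> \<in> Om e" "\<mu> \<in> Om e'"
  shows "e = e'"
proof -
  obtain z where z: "z \<in> UT n" "\<mu> = (\<lambda>a\<in>strict_upper n. lam (transpose_mat e) (z * a * \<sigma> z))"
    using \<mu> by (auto simp: Om_def)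
  obtain z' where z': "z' \<in> UT n" "\<mu> = (\<lambda>a\<in>strict_upper n. lam (transpose_mat e') (z' * a * \<sigma> z'))"
    using \<mu> by (auto simp: Om_def)
  have "lam (transpose_mat e) (z * a * \<sigma> z) = lam (transpose_mat e') (z' * a * \<sigma> z')" if "a \<in> strict_upper n" for a
    using fun_cong[OF trans[OF z(2)[symmetric] z'(2)], of a] that by simp
  then show ?thesis
    using e by (intro char_orbit_unique[OF _ _ _ _ z(1) UT_\<sigma>[OF z(1)] z'(1) UT_\<sigma>[OF z'(1)]]) (auto simp: B_def)
qed

text \<open>Entries of the monomial form E on or above the diagonal pair trivially with J and are
  dropped; e is the transpose of the rest. Invariance places the characters of e and - \<sigma>(e)
  in one two-sided orbit, hence e is skew, and the square root argument yields the twisted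
  orbit.\<close>

lemma invariant_lam_orbit:
  assumes m: "m \<in> carrier_mat n n" and inv: "\<And>a. a \<in> strict_upper n \<Longrightarrow> lam m (- \<sigma> a) = lam m a"
  obtains e where "e \<in> B" "(\<lambda>a\<in>strict_upper n. lam m a) \<in> Om e"
proof -
  obtain x y where xy: "x \<in> UT n" "y \<in> UT n" and mono: "monomial_mat n (x * m * y)"
    using monomial_form[OF m] .
  define E where "E = x * m * y"
  define e where "e = mat n n (\<lambda>(i, j). if i < j then E $$ (j, i) else 0)"
  note u = UT_inv(1)[OF xy(1)] UT_inv(1)[OF xy(2)]
  note Pc = xy[THEN UT_carrier] u[THEN UT_carrier]
  have Ec: "E \<in> carrier_mat n n" using Pc m by (simp add: E_def mat_mult_closed)
  have ec: "e \<in> carrier_mat n n" by (simp add: e_def)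
  have eJ: "e \<in> strict_upper n" by (auto simp: e_def strict_upper_def)
  have emono: "monomial_mat n e"
  proof -
    have nz: "E $$ (j, i) \<noteq> 0" if "i < n" "j < n" "e $$ (i, j) \<noteq> 0" for i j
      using that by (auto simp: e_def split: if_splits)
    show ?thesis
      unfolding monomial_upto_def
    proof (intro conjI allI impI)
      fix i j j' assume "i < n" "j < n" "j' < n" "e $$ (i, j) \<noteq> 0" "e $$ (i, j') \<noteq> 0"
      then show "j = j'" using nz[of i j] nz[of i j'] by (intro monomial_col[OF mono[folded E_def], of j j' i])
    next
      fix i i' j assume "i < n" "i' < n" "j < n" "e $$ (i, j) \<noteq> 0" "e $$ (i', j) \<noteq> 0"
      then show "i = i'" using nz[of i j] nz[of i' j] by (intro monomial_row[OF mono[folded E_def], of j i i'])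
    qed (rule ec)
  qed
  have Ee: "lam E a = lam (transpose_mat e) a" if a: "a \<in> strict_upper n" for a
  proof -
    note ac = strict_upper_carrier[OF a]
    have "E $$ (i, j) * a $$ (j, i) = transpose_mat e $$ (i, j) * a $$ (j, i)" if "i < n" "j < n" for i j
      using a that by (auto simp: e_def strict_upper_def)
    moreover have "transpose_mat e \<in> carrier_mat n n" using ec by simp
    ultimately have "trace_form n E a = trace_form n (transpose_mat e) a"
      using Ec ac by (simp only: trace_form_sum) (intro sum.cong refl, simp)
    then show ?thesis by (simp add: lam_def)
  qed
  have me: "lam m a = lam (transpose_mat e) (inv\<^bsub>R\<^esub> y * a * inv\<^bsub>R\<^esub> x)" if a: "a \<in> strict_upper n" for a
  proof -
    note ac = strict_upper_carrier[OF a]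
    define b where "b = inv\<^bsub>R\<^esub> y * a * inv\<^bsub>R\<^esub> x"
    have bJ: "b \<in> strict_upper n" using a u by (simp add: b_def UT_J J_UT)
    have "a = y * b * x"
      using Pc ac xy UT_inv(3)[OF xy(1)] by (simp add: b_def mat_assoc[where n = n] mat_mult_closed UT_cancel)
    then have "lam m a = lam E b"
      using lam_mult[OF m strict_upper_carrier[OF bJ] Pc(2,1)] by (simp add: E_def)
    then show ?thesis using Ee[OF bJ] by (simp add: b_def)
  qed
  have inv': "lam (transpose_mat e) (inv\<^bsub>R\<^esub> y * (- \<sigma> a) * inv\<^bsub>R\<^esub> x) =
      lam (transpose_mat e) (inv\<^bsub>R\<^esub> y * a * inv\<^bsub>R\<^esub> x)" if a: "a \<in> strict_upper n" for a
    using inv[OF a] me[OF a] me[OF uminus_\<sigma>_J[OF a]] by simp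
  have "lam (transpose_mat (- \<sigma> e)) (\<sigma> (inv\<^bsub>R\<^esub> x) * a * \<sigma> (inv\<^bsub>R\<^esub> y)) =
      lam (transpose_mat e) (inv\<^bsub>R\<^esub> y * a * inv\<^bsub>R\<^esub> x)" if a: "a \<in> strict_upper n" for a
  proof -
    note ac = strict_upper_carrier[OF a]
    let ?w = "\<sigma> (inv\<^bsub>R\<^esub> x) * a * \<sigma> (inv\<^bsub>R\<^esub> y)"
    have wc: "?w \<in> carrier_mat n n" using ac by (intro mat_mult_closed \<sigma>_carrier)
    have "\<sigma> ?w = inv\<^bsub>R\<^esub> y * \<sigma> a * inv\<^bsub>R\<^esub> x"
      using Pc ac by (simp add: \<sigma>_mult \<sigma>_carrier mat_mult_closed \<sigma>_\<sigma> mat_assoc[where n = n])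
    then have "inv\<^bsub>R\<^esub> y * (- \<sigma> a) * inv\<^bsub>R\<^esub> x = - \<sigma> ?w"
      using Pc by (simp add: uminus_mult3 \<sigma>_carrier)
    then have "lam (transpose_mat e) (inv\<^bsub>R\<^esub> y * (- \<sigma> a) * inv\<^bsub>R\<^esub> x) = lam (- transpose_mat e) (\<sigma> ?w)"
      using ec \<sigma>_carrier[of ?w] by (simp add: lam_uminus)
    also have "\<dots> = lam (\<sigma> (- transpose_mat e)) ?w"
      using ec wc by (intro lam_\<sigma>) auto
    also have "\<sigma> (- transpose_mat e) = transpose_mat (- \<sigma> e)"
      using ec by (intro eq_matI) (auto simp: \<sigma>_def \<tau>_neg mult.commute)
    finally show ?thesis using inv'[OF a] by simp
  qed
  then have "- \<sigma> e = e"
    by (rule char_orbit_unique[OF uminus_\<sigma>_J[OF eJ] monomial_uminus_\<sigma>[OF emono] eJ emono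
        UT_\<sigma>[OF u(1)] UT_\<sigma>[OF u(2)] u(2) u(1)])
  then have "\<sigma> e = - e" using \<sigma>_carrier[of e] by (metis uminus_uminus_mat)
  then have eB: "e \<in> B" using eJ emono by (simp add: B_def)
  have "(\<lambda>a\<in>strict_upper n. lam m a) = (\<lambda>a\<in>strict_upper n. lam (transpose_mat e) (inv\<^bsub>R\<^esub> y * a * inv\<^bsub>R\<^esub> x))"
    using me by (auto simp: restrict_def fun_eq_iff)
  also have "\<dots> \<in> Om e"
    using inv' u by (intro orbit_facts(4)[OF eB]) auto
  finally show thesis using that eB by blast
qed

section \<open>The group of all invariant characters\<close>

definition all_chars :: "('k mat \<Rightarrow> complex) set" where
  "all_chars = {(\<lambda>a\<in>strict_upper n. lam m a) | m. m \<in> carrier_mat n n \<and>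
     (\<forall>a\<in>strict_upper n. lam m (- \<sigma> a) = lam m a)}"

text \<open>Joins two descriptions: with matrices, products of characters are sums of matrices and
  stay in the set; with orbits, the total of all orbit sums is a sum over this set.\<close>

lemma all_chars_Om: "all_chars = (\<Union>e\<in>B. Om e)"
proof
  show "all_chars \<subseteq> (\<Union>e\<in>B. Om e)"
  proof
    fix \<mu> assume "\<mu> \<in> all_chars"
    then obtain m where m: "m \<in> carrier_mat n n" "\<And>a. a \<in> strict_upper n \<Longrightarrow> lam m (- \<sigma> a) = lam m a"
      and \<mu>: "\<mu> = (\<lambda>a\<in>strict_upper n. lam m a)" unfolding all_chars_def by blast
    obtain e where "e \<in> B" "\<mu> \<in> Om e" unfolding \<mu> by (rule invariant_lam_orbit[OF m])
    then show "\<mu> \<in> (\<Union>e\<in>B. Om e)" by blast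
  qed
  show "(\<Union>e\<in>B. Om e) \<subseteq> all_chars"
  proof
    fix \<mu> assume "\<mu> \<in> (\<Union>e\<in>B. Om e)"
    then obtain e z where e: "e \<in> B" and z: "z \<in> UT n"
      and \<mu>: "\<mu> = (\<lambda>a\<in>strict_upper n. lam (transpose_mat e) (z * a * \<sigma> z))" and \<mu>Om: "\<mu> \<in> Om e"
      by (auto simp: Om_def)
    have ec: "transpose_mat e \<in> carrier_mat n n" using e by (simp add: B_def strict_upper_carrier)
    define m where "m = \<sigma> z * transpose_mat e * z"
    have mc: "m \<in> carrier_mat n n" using ec z by (simp add: m_def mat_mult_closed \<sigma>_carrier UT_carrier)
    have \<mu>m: "\<mu> = (\<lambda>a\<in>strict_upper n. lam m a)"
      unfolding \<mu> m_def using ec z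
      by (auto simp: restrict_def fun_eq_iff lam_mult strict_upper_carrier UT_carrier \<sigma>_carrier)
    have "\<mu> \<in> inv_chars" using orbit_facts(1)[OF e] \<mu>Om by blast
    then have \<mu>inv: "\<mu> (\<ominus>\<^bsub>R\<^esub> \<sigma> a) = \<mu> a" if "a \<in> strict_upper n" for a
      using that unfolding inv_chars_def by blast
    have "lam m (- \<sigma> a) = lam m a" if a: "a \<in> strict_upper n" for a
      using \<mu>inv[OF a] a uminus_\<sigma>_J[OF a] by (simp add: \<mu>m a_inv_mat \<sigma>_carrier)
    then show "\<mu> \<in> all_chars" using mc \<mu>m by (auto simp: all_chars_def)
  qed
qed

lemma all_chars_inv: "all_chars \<subseteq> inv_chars"
  using orbit_facts(1) by (auto simp: all_chars_Om)

lemma finite_all_chars: "finite all_chars"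
proof -
  have "all_chars \<subseteq> (\<lambda>m. \<lambda>a\<in>strict_upper n. lam m a) ` carrier_mat n n"
    by (auto simp: all_chars_def)
  then show ?thesis using finite_carrier_mat finite_surj by blast
qed

lemma lam_add_left:
  "\<lbrakk>m \<in> carrier_mat n n; m' \<in> carrier_mat n n; a \<in> carrier_mat n n\<rbrakk> \<Longrightarrow> lam (m + m') a = lam m a * lam m' a"
  by (simp add: lam_def trace_form_sum distrib_right sum.distrib \<theta>_add)

lemma all_chars_mult:
  assumes "\<mu> \<in> all_chars" "\<nu> \<in> all_chars"
  shows "(\<lambda>a\<in>strict_upper n. \<nu> a * \<mu> a) \<in> all_chars"
proof -
  obtain m where m: "m \<in> carrier_mat n n" "\<mu> = (\<lambda>a\<in>strict_upper n. lam m a)"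
    "\<And>a. a \<in> strict_upper n \<Longrightarrow> lam m (- \<sigma> a) = lam m a" using assms by (auto simp: all_chars_def)
  obtain m' where m': "m' \<in> carrier_mat n n" "\<nu> = (\<lambda>a\<in>strict_upper n. lam m' a)"
    "\<And>a. a \<in> strict_upper n \<Longrightarrow> lam m' (- \<sigma> a) = lam m' a" using assms by (auto simp: all_chars_def)
  have "(\<lambda>a\<in>strict_upper n. \<nu> a * \<mu> a) = (\<lambda>a\<in>strict_upper n. lam (m' + m) a)"
    using m m' by (auto simp: restrict_def fun_eq_iff lam_add_left strict_upper_carrier)
  moreover have "lam (m' + m) (- \<sigma> a) = lam (m' + m) a" if a: "a \<in> strict_upper n" for a
    using m m' a strict_upper_carrier[OF a] strict_upper_carrier[OF uminus_\<sigma>_J[OF a]] by (simp add: lam_add_left)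
  ultimately show ?thesis
    using m(1) m'(1) unfolding all_chars_def by (intro CollectI exI[of _ "m' + m"]) auto
qed

text \<open>The matrix k - \<sigma>(k) always gives an invariant character. As c is skew, both parts
  contribute equally, which is the origin of the factor 2 in the choice of \<beta>.\<close>

lemma all_chars_separate:
  assumes c: "c \<in> skew" "c \<noteq> 0\<^sub>m n n"
  obtains \<nu> where "\<nu> \<in> all_chars" "\<nu> c \<noteq> 1"
proof -
  have cJ: "c \<in> strict_upper n" "\<sigma> c = - c" using c by (auto simp: skew_iff)
  note cc = strict_upper_carrier[OF cJ(1)]
  have "\<exists>i j. i < n \<and> j < n \<and> c $$ (i, j) \<noteq> 0"
    using c(2) cc eq_matI[of "0\<^sub>m n n" c] by force
  then obtain i j where ij: "i < n" "j < n" "c $$ (i, j) \<noteq> 0" by blast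
  then have "2 * c $$ (i, j) \<noteq> 0" using two by simp
  then obtain \<beta> where \<beta>: "\<theta> (2 * c $$ (i, j) * \<beta>) \<noteq> 1" using \<theta>_nondegenerate by blast
  define k where "k = unit_mat j i \<beta>"
  have kc: "k \<in> carrier_mat n n" by (simp add: k_def unit_mat_carrier)
  define m where "m = k + (- \<sigma> k)"
  have mc: "m \<in> carrier_mat n n" using kc by (simp add: m_def \<sigma>_carrier)
  have "trace_form n k c = (\<Sum>r<n. \<Sum>q<n. if q = i then (if r = j then \<beta> * c $$ (i, j) else 0) else 0)"
    unfolding trace_form_sum[OF kc cc] by (intro sum.cong refl) (auto simp: k_def unit_mat_def)
  also have "\<dots> = \<beta> * c $$ (i, j)" using ij by simp
  finally have kc': "lam k c = \<theta> (\<beta> * c $$ (i, j))" by (simp add: lam_def)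
  have flip: "lam (- \<sigma> k) a = lam k (- \<sigma> a)" if a: "a \<in> carrier_mat n n" for a
  proof -
    have "lam (- \<sigma> k) a = lam (\<sigma> k) (- a)" using a by (simp add: lam_uminus \<sigma>_carrier)
    also have "\<dots> = lam k (\<sigma> (- a))" using a kc by (simp add: lam_\<sigma>)
    also have "\<sigma> (- a) = - \<sigma> a" using a by (rule \<sigma>_uminus)
    finally show ?thesis .
  qed
  have minv: "lam m (- \<sigma> a) = lam m a" if a: "a \<in> strict_upper n" for a
  proof -
    note ac = strict_upper_carrier[OF a]
    have "- \<sigma> (- \<sigma> a) = a"
      using ac by (simp add: \<sigma>_uminus \<sigma>_carrier \<sigma>_\<sigma>)
    then show ?thesis
      using kc ac \<sigma>_carrier[of k] \<sigma>_carrier[of a]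
      by (simp add: m_def lam_add_left flip mult.commute)
  qed
  have "lam m c = lam k c * lam (- \<sigma> k) c"
    unfolding m_def using kc cc \<sigma>_carrier[of k] by (intro lam_add_left) auto
  also have "lam (- \<sigma> k) c = lam k c"
    unfolding flip[OF cc] cJ(2) by (simp only: uminus_uminus_mat)
  finally have "lam m c = lam k c * lam k c" .
  also have "\<dots> = \<theta> (2 * c $$ (i, j) * \<beta>)"
    unfolding kc' \<theta>_add[symmetric]
    by (rule arg_cong[of _ _ \<theta>]) (simp only: mult_2 distrib_right mult.commute[of \<beta>])
  finally have "lam m c \<noteq> 1" using \<beta> by simp
  moreover have "(\<lambda>a\<in>strict_upper n. lam m a) \<in> all_chars"
    using mc minv by (auto simp: all_chars_def)
  ultimately show thesis using that[of "\<lambda>a\<in>strict_upper n. lam m a"] cJ by simp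
qed

section \<open>Superclasses and the supercharacter theory\<close>

definition K :: "'k mat \<Rightarrow> 'k mat set" where
  "K e = cay ` {x * e * y | x y. x \<in> UT n \<and> y \<in> UT n} \<inter> fixed"

lemma K_iff:
  assumes e: "e \<in> B"
  shows "x \<in> K e \<longleftrightarrow> x \<in> fixed \<and> (\<exists>u\<in>UT n. \<exists>v\<in>UT n. cay_inv x = u * e * v)"
proof -
  have eJ: "e \<in> strict_upper n" using e by (simp add: B_def)
  have "cay (u * e * v) = x \<longleftrightarrow> cay_inv x = u * e * v" if "x \<in> fixed" "u \<in> UT n" "v \<in> UT n" for u v
    using cay_cay_inv_iff[of x "u * e * v"] that eJ by (auto simp: fixed_iff UT_J J_UT)
  then show ?thesis unfolding K_def by blast
qed

theorem supercharacter_theory_orbits: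
  "supercharacter_theory C ((\<lambda>e. orbit_char (Om e)) ` B) (K ` B)"
proof (rule supercharacter_theoryI[OF group_C finite_C, where I = B and K = K and \<sigma> = "\<lambda>e. orbit_char (Om e)"])
  show finB: "finite B"
    by (rule finite_subset[OF _ finite_carrier_mat[of n n]]) (auto simp: B_def strict_upper_carrier)
  have nonempty: "cay e \<in> K e" if e: "e \<in> B" for e
  proof -
    have s: "e \<in> skew" using e by (simp add: B_def skew_iff)
    have "cay_inv (cay e) = 1\<^sub>m n * e * 1\<^sub>m n"
      using cay_inv_cay[of e] e by (simp add: B_def strict_upper_carrier)
    then show ?thesis using cay_fixed[OF s] UT_one K_iff[OF e] by blast
  qed
  have disj: "e = e'" if "e \<in> B" "e' \<in> B" "x \<in> K e" "x \<in> K e'" for e e' x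
    using that K_iff[OF that(1)] K_iff[OF that(2)] double_coset_unique[of e e'] unfolding B_def by fastforce
  show "partition_on (carrier C) (K ` B)"
  proof (rule partition_onI)
    show "\<Union> (K ` B) = carrier C"
    proof
      show "carrier C \<subseteq> \<Union> (K ` B)"
      proof
        fix x assume "x \<in> carrier C"
        then have x: "x \<in> fixed" by simp
        obtain e u v where "e \<in> B" "u \<in> UT n" "v \<in> UT n" "cay_inv x = u * e * v"
          using skew_double_coset[OF cay_inv_skew[OF x]] .
        then show "x \<in> \<Union> (K ` B)" using x K_iff by blast
      qed
    qed (auto simp: K_def)
  next
    fix p q assume "p \<in> K ` B" "q \<in> K ` B" "p \<noteq> q"
    then show "disjnt p q" using disj by (fastforce simp: disjnt_def)
  next
    show "{} \<notin> K ` B" using nonempty by auto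
  qed
  show "inj_on K B"
  proof
    fix e e' assume "e \<in> B" "e' \<in> B" "K e = K e'"
    then show "e = e'" using nonempty[of e] disj[of e e' "cay e"] by simp
  qed
  show "orbit_char (Om e) \<in> characters C" if "e \<in> B" for e
    by (rule orbit_facts(2)[OF that])
  show "char_inner C (orbit_char (Om e)) (orbit_char (Om e')) = 0" if "e \<in> B" "e' \<in> B" "e \<noteq> e'" for e e'
    using that Om_disjoint by (intro orbit_char_inner orbit_facts(1)) auto
  have total: "(\<Sum>e\<in>B. orbit_char (Om e) x) = (\<Sum>\<mu>\<in>all_chars. \<mu> (cay_inv x))" if x: "x \<in> fixed" for x
  proof -
    have fin: "\<forall>e\<in>B. finite (Om e)"
      using finite_subset[OF _ finite_all_chars] by (auto simp: all_chars_Om)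
    show ?thesis
      unfolding all_chars_Om using fin finB Om_disjoint x
      by (subst sum.UNION_disjoint) (auto simp: orbit_char_def)
  qed
  show "(\<Sum>e\<in>B. orbit_char (Om e) x) = 0" if "x \<in> carrier C" "x \<noteq> \<one>\<^bsub>C\<^esub>" for x
  proof -
    have x: "x \<in> fixed" "x \<noteq> 1\<^sub>m n" using that by auto
    have c: "cay_inv x \<in> skew" by (rule cay_inv_skew[OF x(1)])
    have "cay_inv x \<noteq> 0\<^sub>m n n"
    proof
      assume "cay_inv x = 0\<^sub>m n n"
      then have "x = cay (0\<^sub>m n n)" using cay_cay_inv[of x] x by (simp add: fixed_iff)
      moreover have "1\<^sub>m n \<ominus>\<^bsub>R\<^esub> 0\<^sub>m n n = 1\<^sub>m n"
        unfolding a_minus_mat[OF one_carrier_mat zero_carrier_mat] by (intro eq_matI) auto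
      ultimately have "x = 1\<^sub>m n"
        using UT_inv(3)[OF UT_one] UT_inv(1)[OF UT_one, THEN UT_carrier] by (simp add: cay_def)
      then show False using x by simp
    qed
    then obtain \<nu> where "\<nu> \<in> all_chars" "\<nu> (cay_inv x) \<noteq> 1"
      using all_chars_separate[OF c] by blast
    then have "(\<Sum>\<mu>\<in>all_chars. \<mu> (cay_inv x)) = 0"
      using c all_chars_mult skew_J by (intro inv_chars_sum[OF finite_all_chars all_chars_inv]) auto
    then show ?thesis using total[OF x(1)] by simp
  qed
  show "(\<Sum>e\<in>B. orbit_char (Om e) \<one>\<^bsub>C\<^esub>) \<noteq> 0"
  proof -
    interpret G: group C by (rule group_C)
    have one: "1\<^sub>m n \<in> fixed" using G.one_closed by simp
    have "cay_inv (1\<^sub>m n) = 0\<^sub>m n n"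
    proof -
      have "1\<^sub>m n \<ominus>\<^bsub>R\<^esub> 1\<^sub>m n = 0\<^sub>m n n" by (simp add: a_minus_mat)
      then show ?thesis
        using cay_inv_iff[OF one_P J_zero] by simp
    qed
    then have "(\<Sum>e\<in>B. orbit_char (Om e) (1\<^sub>m n)) = (\<Sum>\<mu>\<in>all_chars. 1)"
      unfolding total[OF one] using all_chars_inv by (intro sum.cong refl) (auto simp: inv_chars_def)
    moreover have "(\<lambda>a\<in>strict_upper n. lam (0\<^sub>m n n) a) \<in> all_chars"
    proof -
      have "lam (0\<^sub>m n n) a = 1" if "a \<in> carrier_mat n n" for a
        using that by (simp add: lam_def trace_form_sum \<theta>_zero)
      then show ?thesis
        using \<sigma>_carrier strict_upper_carrier unfolding all_chars_def
        by (intro CollectI exI[of _ "0\<^sub>m n n"]) auto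
    qed
    ultimately show ?thesis using finite_all_chars by auto
  qed
  fix e e' x y assume e: "e \<in> B" "e' \<in> B" and xy: "x \<in> K e'" "y \<in> K e'"
  have e': "e' \<in> skew" using e(2) by (simp add: B_def skew_iff)
  \<comment> \<open>The double coset of e' meets \<open>skew\<close> in a single twisted orbit,
    along which the orbit sum is constant; so every x in the class gives the value at e'.\<close>
  have val: "orbit_char (Om e) x = (\<Sum>\<mu>\<in>Om e. \<mu> e')" if x: "x \<in> K e'" for x
  proof -
    obtain u v where uv: "u \<in> UT n" "v \<in> UT n" "cay_inv x = u * e' * v" and xf: "x \<in> fixed"
      using x K_iff[OF e(2)] by blast
    have "u * e' * v \<in> skew" using cay_inv_skew[OF xf] uv by simp
    then obtain z where z: "z \<in> UT n" "u * e' * v = z * e' * \<sigma> z"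
      using twisted_conj_J[OF e', of u v] uv by (auto simp: P_UT)
    have "orbit_char (Om e) x = (\<Sum>\<mu>\<in>Om e. \<mu> (z * e' * \<sigma> z))"
      using xf uv z by (simp add: orbit_char_def)
    then show ?thesis using orbit_facts(3)[OF e(1) z(1) skew_J[OF e']] by simp
  qed
  show "orbit_char (Om e) x = orbit_char (Om e) y" using val xy by simp
qed

end

section \<open>The canonical data\<close>

text \<open>An extension by a vector v outside E multiplies the order by |K|: if k v + u = k' v +
  u', then (k - k') v lies in E, which forces k = k'.\<close>

lemma (in ring) dimension_card:
  assumes K: "subfield K R" and "dimension n K E"
  shows "card E = card K ^ n"
  using assms(2,1)
proof (induction rule: dimension.induct)
  case (Suc_dim v E n K)
  note E = space_subgroup_props[OF Suc_dim.prems Suc_dim.hyps(3)]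
  have KR: "k \<in> carrier R" if "k \<in> K" for k
    using subringE(1)[OF subfieldE(1)[OF Suc_dim.prems]] that by auto
  have "inj_on (\<lambda>(k, u). k \<otimes> v \<oplus> u) (K \<times> E)"
  proof (rule inj_onI, clarify)
    fix k u k' u'
    assume k: "k \<in> K" "k' \<in> K" and u: "u \<in> E" "u' \<in> E" and eq: "k \<otimes> v \<oplus> u = k' \<otimes> v \<oplus> u'"
    note cl = KR[OF k(1)] KR[OF k(2)] subsetD[OF E(1) u(1)] subsetD[OF E(1) u(2)] Suc_dim.hyps(1)
    have "(k \<ominus> k') \<otimes> v = (k \<otimes> v \<oplus> u) \<ominus> u \<ominus> k' \<otimes> v"
      using cl by algebra
    also have "\<dots> = u' \<oplus> \<ominus> u"
      unfolding eq using cl by algebra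
    finally have "(k \<ominus> k') \<otimes> v \<in> E" using E(3,4) u by simp
    moreover have "k \<ominus> k' \<in> K"
      using subringE(5,7)[OF subfieldE(1)[OF Suc_dim.prems]] k by (simp add: a_minus_def)
    ultimately have "k \<ominus> k' = \<zero>"
      using E(6)[of "k \<ominus> k'" v] Suc_dim.hyps(1,2) by blast
    then have "k = k'" using cl by simp
    then show "k = k' \<and> u = u'" using eq cl by simp
  qed
  moreover have "line_extension K v E = (\<lambda>(k, u). k \<otimes> v \<oplus> u) ` (K \<times> E)"
    by (force simp: line_extension_mem_iff)
  ultimately show ?case
    using Suc_dim.IH[OF Suc_dim.prems] by (simp add: card_image card_cartesian_product)
qed simp

text \<open>The field has |F|^2 elements, so |F| is a power of the characteristic and raising to it
  is additive. Doing so twice raises to the order of the field, which is the identity.\<close>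

lemma quadratic_subfield_power:
  fixes F :: "'k::{field,finite} set"
  assumes "subfield F class_ring" and "ring.dimension class_ring 2 F UNIV"
  shows "(\<alpha> + \<beta>) ^ card F = \<alpha> ^ card F + \<beta> ^ card F" and "(\<alpha> ^ card F) ^ card F = (\<alpha> :: 'k)"
proof -
  have c: "card (UNIV :: 'k set) = card F * card F"
    using ring.dimension_card[OF class_ring.ring_axioms assms] by (simp add: power2_eq_square)
  obtain N where "card (UNIV :: 'k set) = CHAR('k) ^ N" by (rule finite_field_card)
  then have "card F dvd CHAR('k) ^ N" using c by (metis dvd_triv_left)
  then obtain r where "card F = CHAR('k) ^ r"
    using divides_primepow_nat[OF finite_field_char_prime] by blast
  then show "(\<alpha> + \<beta>) ^ card F = \<alpha> ^ card F + \<beta> ^ card F"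
    by (rule freshmans_dream'[OF finite_field_char_prime])
  show "(\<alpha> ^ card F) ^ card F = \<alpha>"
    using finite_field_power_card[of \<alpha>] by (simp add: c power_mult)
qed

definition conj_scalar :: "involution_kind \<Rightarrow> 'k::field set \<Rightarrow> 'k \<Rightarrow> 'k" where
  "conj_scalar t F \<alpha> = (if t = Unitary then \<alpha> ^ card F else \<alpha>)"

definition form_sign :: "involution_kind \<Rightarrow> nat \<Rightarrow> nat \<Rightarrow> 'k::field" where
  "form_sign t n i = (if t = Symplectic \<and> n div 2 \<le> i then - 1 else 1)"

definition form_type :: "involution_kind \<Rightarrow> 'k::field" where
  "form_type t = (if t = Symplectic then - 1 else 1)"

lemma form_mat_eq:
  assumes "canonical_data t n F"
  shows "form_mat t n = mat n n (\<lambda>(i, j). if Suc (i + j) = n then form_sign t n i else 0)"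
proof (cases t)
  case Symplectic
  then have "even n" using assms by simp
  then obtain m where n: "n = m + m" by (metis evenE mult_2)
  show ?thesis
    unfolding Symplectic
    by (intro eq_matI) (auto simp: n antidiag_def form_sign_def Let_def)
qed (auto simp: antidiag_def form_sign_def intro!: eq_matI)

lemma star_entry:
  assumes "a \<in> carrier_mat n n" "i < n" "j < n"
  shows "star t F a $$ (i, j) = conj_scalar t F (a $$ (j, i))"
  using assms by (cases t) (auto simp: conj_scalar_def)

lemma star_carrier: "a \<in> carrier_mat n n \<Longrightarrow> star t F a \<in> carrier_mat n n"
  by (cases t) auto

locale canonical_case =
  fixes t :: involution_kind and n :: nat and F :: "'k::{field,finite} set" and \<theta> :: "'k \<Rightarrow> complex"
  assumes odd: "odd CHAR('k)"
    and data: "canonical_data t n F"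
    and \<theta>: "nontrivial_additive_character \<theta>"
    and \<theta>_F: "\<theta> (\<alpha> ^ card F) = \<theta> \<alpha>"
begin

sublocale canonical_involution n "form_sign t n" "conj_scalar t F" "form_type t" \<theta>
proof
  fix \<alpha> \<beta> :: 'k and i
  show "odd CHAR('k)" by (rule odd)
  show "form_sign t n i = (1 :: 'k) \<or> form_sign t n i = - (1 :: 'k)" by (simp add: form_sign_def)
  show "form_sign t n i * form_sign t n (n - Suc i) = (form_type t :: 'k)" if "i < n"
  proof (cases t)
    case Symplectic
    then have "even n" using data by simp
    \<comment> \<open>Exactly one of i and its reflection lies in the lower half, hence the product
      of the signs is -1.\<close>
    then obtain m where "n = m + m" by (metis evenE mult_2)
    then show ?thesis using that by (auto simp: Symplectic form_sign_def form_type_def)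
  qed (auto simp: form_sign_def form_type_def)
  have q: "(\<alpha> + \<beta>) ^ card F = \<alpha> ^ card F + \<beta> ^ card F \<and> (\<alpha> ^ card F) ^ card F = \<alpha>" if "t = Unitary"
    using that data quadratic_subfield_power[of F] by auto
  show "conj_scalar t F (\<alpha> + \<beta>) = conj_scalar t F \<alpha> + conj_scalar t F \<beta>"
    using q by (auto simp: conj_scalar_def)
  show "conj_scalar t F (\<alpha> * \<beta>) = conj_scalar t F \<alpha> * conj_scalar t F \<beta>"
    by (auto simp: conj_scalar_def power_mult_distrib)
  show "conj_scalar t F (conj_scalar t F \<alpha>) = \<alpha>"
    using q by (auto simp: conj_scalar_def)
  show "nontrivial_additive_character \<theta>" by (rule \<theta>)
  show "\<theta> (conj_scalar t F \<alpha>) = \<theta> \<alpha>" by (simp add: conj_scalar_def \<theta>_F)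
qed

text \<open>The entries of the form matrix are signs on the antidiagonal, so its inverse is its
  transpose: the sign is taken from the column.\<close>

lemma inv_form_mat:
  "inv\<^bsub>R\<^esub> (form_mat t n) = mat n n (\<lambda>(i, j). if Suc (i + j) = n then form_sign t n j else (0 :: 'k))"
proof -
  let ?u = "mat n n (\<lambda>(i, j). if Suc (i + j) = n then form_sign t n i else (0 :: 'k))"
  let ?v = "mat n n (\<lambda>(i, j). if Suc (i + j) = n then form_sign t n j else (0 :: 'k))"
  have "?u * ?v = 1\<^sub>m n"
  proof (rule eq_matI)
    fix i j assume "i < dim_row (1\<^sub>m n :: 'k mat)" "j < dim_col (1\<^sub>m n :: 'k mat)"
    then have ij: "i < n" "j < n" by auto
    have "(?u * ?v) $$ (i, j) = (\<Sum>l<n. ?u $$ (i, l) * ?v $$ (l, j))"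
      using ij by (intro mat_mult_entry) auto
    also have "\<dots> = (\<Sum>l<n. if l = n - Suc i then (if i = j then 1 else 0) else 0)"
      using ij s_sq by (intro sum.cong refl) auto
    also have "\<dots> = 1\<^sub>m n $$ (i, j)" using ij by simp
    finally show "(?u * ?v) $$ (i, j) = 1\<^sub>m n $$ (i, j)" .
  qed auto
  moreover have "?v * ?u = 1\<^sub>m n"
  proof (rule eq_matI)
    fix i j assume "i < dim_row (1\<^sub>m n :: 'k mat)" "j < dim_col (1\<^sub>m n :: 'k mat)"
    then have ij: "i < n" "j < n" by auto
    have "(?v * ?u) $$ (i, j) = (\<Sum>l<n. ?v $$ (i, l) * ?u $$ (l, j))"
      using ij by (intro mat_mult_entry) auto
    also have "\<dots> = (\<Sum>l<n. if l = n - Suc i then (if i = j then 1 else 0) else 0)"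
      using ij s_sq by (intro sum.cong refl) auto
    also have "\<dots> = 1\<^sub>m n $$ (i, j)" using ij by simp
    finally show "(?v * ?u) $$ (i, j) = 1\<^sub>m n $$ (i, j)" .
  qed auto
  ultimately show ?thesis
    unfolding form_mat_eq[OF data]
    using monoid.inv_unique'[OF ring.is_monoid[OF ring_mat[where n = n and b = "()"]], of ?u ?v, THEN sym]
    by (simp add: ring_mat_simps)
qed

text \<open>The antidiagonal factors reflect both indices and contribute the signs of the reflected
  indices; their product is unchanged by reflection (\<open>s_reflect2\<close>).\<close>

lemma invol_eq: assumes a: "a \<in> carrier_mat n n" shows "invol t n F a = \<sigma> a"
proof (rule eq_matI)
  let ?u = "mat n n (\<lambda>(i, j). if Suc (i + j) = n then form_sign t n i else (0 :: 'k))"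
  let ?v = "mat n n (\<lambda>(i, j). if Suc (i + j) = n then form_sign t n j else (0 :: 'k))"
  have inv: "invol t n F a = ?v * star t F a * ?u"
    unfolding invol_def inv_form_mat unfolding form_mat_eq[OF data] ..
  note st = star_carrier[OF a, of t F]
  show "dim_row (invol t n F a) = dim_row (\<sigma> a)" "dim_col (invol t n F a) = dim_col (\<sigma> a)"
    using \<sigma>_carrier[of a] by (simp_all add: inv)
  fix i j assume "i < dim_row (\<sigma> a)" "j < dim_col (\<sigma> a)"
  then have ij: "i < n" "j < n" using \<sigma>_carrier[of a] by auto
  have left: "(?v * star t F a) $$ (i, l) = form_sign t n (n - Suc i) * star t F a $$ (n - Suc i, l)" if l: "l < n" for l
  proof -
    have "(?v * star t F a) $$ (i, l) =
        (\<Sum>r<n. if r = n - Suc i then form_sign t n (n - Suc i) * star t F a $$ (n - Suc i, l) else 0)"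
      unfolding mat_mult_entry[OF mat_carrier st ij(1) l]
      using ij by (intro sum.cong refl) auto
    then show ?thesis using ij by simp
  qed
  have "invol t n F a $$ (i, j) = (\<Sum>l<n. (?v * star t F a) $$ (i, l) * ?u $$ (l, j))"
    unfolding inv using ij st by (intro mat_mult_entry) (auto intro: mat_mult_closed)
  also have "\<dots> = (\<Sum>l<n. if l = n - Suc j then
      form_sign t n (n - Suc i) * star t F a $$ (n - Suc i, n - Suc j) * form_sign t n (n - Suc j) else 0)"
    using ij by (intro sum.cong refl) (auto simp: left)
  also have "\<dots> = (form_sign t n (n - Suc i) * form_sign t n (n - Suc j)) * star t F a $$ (n - Suc i, n - Suc j)"
    using ij by simp
  also have "\<dots> = \<sigma> a $$ (i, j)"
    using ij a by (simp add: s_reflect2 \<sigma>_entry star_entry)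
  finally show "invol t n F a $$ (i, j) = \<sigma> a $$ (i, j)" .
qed

section \<open>Translation of the defining data\<close>

lemma carrier_fixed_group: "carrier (fixed_group t n F) = fixed"
  unfolding fixed_group_def fixed_def
  using UT_inv(1) by (auto simp: act_P_def P_UT invol_eq UT_carrier)

lemma fixed_group_eq: "fixed_group t n F = C"
proof -
  have "{x \<in> UT n. act_P t n F x = x} = fixed"
    using carrier_fixed_group by (simp add: fixed_group_def)
  then show ?thesis by (simp add: fixed_group_def C_def)
qed

lemma cayley_eq: "a \<in> carrier_mat n n \<Longrightarrow> cayley n a = cay a"
  by (simp add: cayley_def cay_def a_minus_mat)

lemma cayley_inv_eq: "x \<in> carrier_mat n n \<Longrightarrow> cayley_inv n x = cay_inv x"
  by (simp add: cayley_inv_def cay_inv_def a_minus_mat)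

text \<open>A pair is recovered from the matrix as its support and the values there; invariance of
  the pair is skewness of the matrix.\<close>

lemma basic_elem_B:
  "(\<lambda>(D, \<phi>). basic_elem n D \<phi>) ` invariant_basic_pairs t n F = B"
proof (intro equalityI subsetI)
  fix e assume "e \<in> (\<lambda>(D, \<phi>). basic_elem n D \<phi>) ` invariant_basic_pairs t n F"
  then obtain D and \<phi> :: "nat \<times> nat \<Rightarrow> 'k" where e: "e = basic_elem n D \<phi>"
    and D: "basic_subset n D" and inv: "act_J t n F e = e"
    by (auto simp: invariant_basic_pairs_def basic_pairs_def)
  have ec: "e \<in> carrier_mat n n" by (simp add: e basic_elem_def)
  have nz: "(i, j) \<in> D" if "i < n" "j < n" "e $$ (i, j) \<noteq> 0" for i j
    using that by (auto simp: e basic_elem_def split: if_splits)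
  have "e \<in> strict_upper n"
    using D ec by (auto simp: strict_upper_def e basic_elem_def basic_subset_def)
  moreover have "monomial_mat n e"
    unfolding monomial_upto_def
  proof (intro conjI allI impI)
    fix i j j' assume "i < n" "j < n" "j' < n" "e $$ (i, j) \<noteq> 0" "e $$ (i, j') \<noteq> 0"
    then have "(i, j) \<in> D" "(i, j') \<in> D" using nz by auto
    then show "j = j'" using D unfolding basic_subset_def by blast
  next
    fix i i' j assume "i < n" "i' < n" "j < n" "e $$ (i, j) \<noteq> 0" "e $$ (i', j) \<noteq> 0"
    then have "(i, j) \<in> D" "(i', j) \<in> D" using nz by auto
    then show "i = i'" using D unfolding basic_subset_def by blast
  qed (rule ec)
  moreover have "\<sigma> e = - e"
  proof -
    have "- \<sigma> e = e" using inv by (simp add: act_J_def invol_eq[OF ec])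
    then show ?thesis by (metis uminus_uminus_mat)
  qed
  ultimately show "e \<in> B" by (simp add: B_def)
next
  fix e assume e: "e \<in> B"
  then have eJ: "e \<in> strict_upper n" and mono: "monomial_mat n e" and \<sigma>e: "\<sigma> e = - e" by (auto simp: B_def)
  have ec: "e \<in> carrier_mat n n" by (rule strict_upper_carrier[OF eJ])
  define D where "D = {(i, j). i < n \<and> j < n \<and> e $$ (i, j) \<noteq> 0}"
  define \<phi> where "\<phi> = restrict (\<lambda>ij. e $$ ij) D"
  have be: "basic_elem n D \<phi> = e"
    using ec by (intro eq_matI) (auto simp: basic_elem_def \<phi>_def D_def)
  have "basic_subset n D"
    unfolding basic_subset_def
  proof (intro conjI allI impI)
    show "D \<subseteq> {(i, j). i < j \<and> j < n}" using eJ by (auto simp: D_def strict_upper_def not_le[symmetric])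
    fix i j j' assume "(i, j) \<in> D" "(i, j') \<in> D"
    then show "j = j'" using monomial_row[OF mono, of i j j'] by (simp add: D_def)
  next
    fix i i' j assume "(i, j) \<in> D" "(i', j) \<in> D"
    then show "i = i'" using monomial_col[OF mono, of i i' j] by (simp add: D_def)
  qed
  moreover have "\<phi> \<in> D \<rightarrow>\<^sub>E UNIV - {0}" by (auto simp: \<phi>_def D_def)
  moreover have "act_J t n F e = e" using ec by (simp add: act_J_def invol_eq \<sigma>e)
  ultimately have "(D, \<phi>) \<in> invariant_basic_pairs t n F"
    by (simp add: invariant_basic_pairs_def basic_pairs_def be)
  then show "e \<in> (\<lambda>(D, \<phi>). basic_elem n D \<phi>) ` invariant_basic_pairs t n F"
    using be by (auto intro!: image_eqI[of _ _ "(D, \<phi>)"])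
qed

lemma superclass_eq: "superclass t n F D \<phi> = K (basic_elem n D \<phi>)"
proof -
  have "cayley n ` {x * basic_elem n D \<phi> * y | x y. x \<in> UT n \<and> y \<in> UT n} =
      cay ` {x * basic_elem n D \<phi> * y | x y. x \<in> UT n \<and> y \<in> UT n}"
  proof (intro image_cong refl cayley_eq)
    fix z assume "z \<in> {x * basic_elem n D \<phi> * y | x y. x \<in> UT n \<and> y \<in> UT n}"
    moreover have "basic_elem n D \<phi> \<in> carrier_mat n n" by (simp add: basic_elem_def)
    ultimately show "z \<in> carrier_mat n n"
      using mat_mult_closed[OF mat_mult_closed[OF UT_carrier] UT_carrier] by auto
  qed
  then show ?thesis by (simp add: superclass_def K_def carrier_fixed_group)
qed

lemma basic_lin_char_eq:
  assumes D: "basic_subset n D" and a: "a \<in> strict_upper n"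
  shows "basic_lin_char n \<theta> D \<phi> a = lam (transpose_mat (basic_elem n D \<phi>)) a"
proof -
  have Dsub: "D \<subseteq> {..<n} \<times> {..<n}" using D by (auto simp: basic_subset_def)
  have fin: "finite D" using finite_subset[OF Dsub] by simp
  have prod: "(\<Prod>ij\<in>A. \<theta> (f ij)) = \<theta> (\<Sum>ij\<in>A. f ij)" if "finite A" for A and f :: "nat \<times> nat \<Rightarrow> 'k"
    using that by (induction A) (simp_all add: \<theta>_zero \<theta>_add)
  have "(\<Sum>i<n. \<Sum>j<n. basic_elem n D \<phi> $$ (i, j) * a $$ (i, j)) =
      (\<Sum>ij\<in>{..<n} \<times> {..<n}. basic_elem n D \<phi> $$ ij * a $$ ij)"
    by (simp add: sum.cartesian_product case_prod_unfold)
  also have "\<dots> = (\<Sum>ij\<in>D. \<phi> ij * a $$ ij)"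
    using Dsub by (intro sum.mono_neutral_cong_right) (auto simp: basic_elem_def)
  finally have "lam (transpose_mat (basic_elem n D \<phi>)) a = \<theta> (\<Sum>ij\<in>D. \<phi> ij * a $$ ij)"
    using strict_upper_carrier[OF a] by (simp add: lam_transpose basic_elem_def)
  then show ?thesis
    using a prod[OF fin] by (simp add: basic_lin_char_def)
qed

text \<open>Inverses cancel in pairs: the left action of the inverse of x evaluates at x a, and the
  right action of the inverse of \<sigma>(x) evaluates at a \<sigma>(x).\<close>

lemma twisted_orbit_eq:
  assumes D: "basic_subset n D"
  shows "twisted_orbit t n F \<theta> D \<phi> = Om (basic_elem n D \<phi>)"
proof -
  have "right_act n (left_act n (mat_inv n x) (basic_lin_char n \<theta> D \<phi>)) (act_P t n F x) =
      (\<lambda>a\<in>strict_upper n. lam (transpose_mat (basic_elem n D \<phi>)) (x * a * \<sigma> x))" if x: "x \<in> UT n" for x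
  proof -
    have xP: "x \<in> P" using x by (simp add: P_UT)
    have ii: "mat_inv n (mat_inv n x) = x"
      using P_inv_eq[OF P_inv[OF xP] xP] P_r_inv[OF xP] by simp
    have "act_P t n F x = mat_inv n (\<sigma> x)"
      using UT_inv(1)[OF x] by (simp add: act_P_def invol_eq UT_carrier invol_m_inv[OF xP])
    moreover have "mat_inv n (mat_inv n (\<sigma> x)) = \<sigma> x"
      using P_inv_eq[OF P_inv[OF P_invol[OF xP]] P_invol[OF xP]] P_r_inv[OF P_invol[OF xP]] by simp
    moreover have "a * \<sigma> x \<in> strict_upper n" "x * (a * \<sigma> x) \<in> strict_upper n" if "a \<in> strict_upper n" for a
      using x that by (simp_all add: UT_J J_UT UT_\<sigma>)
    moreover have "x * (a * \<sigma> x) = x * a * \<sigma> x" if "a \<in> strict_upper n" for a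
      using x that by (simp add: mat_assoc[where n = n] UT_carrier strict_upper_carrier \<sigma>_carrier)
    ultimately show ?thesis
      using ii by (auto simp: right_act_def left_act_def basic_lin_char_eq[OF D] restrict_def fun_eq_iff)
  qed
  then show ?thesis
    unfolding twisted_orbit_def Om_def by (intro Collect_cong) (metis (no_types, lifting))
qed

lemma supercharacter_eq:
  assumes D: "basic_subset n D"
  shows "supercharacter t n F \<theta> D \<phi> = orbit_char (Om (basic_elem n D \<phi>))"
  unfolding supercharacter_def orbit_char_def twisted_orbit_eq[OF D] carrier_fixed_group
  by (intro restrict_ext sum.cong refl) (simp add: cayley_inv_eq fixed_iff P_carrier)

end

theorem theorem6p4:
  fixes t :: involution_kind
    and n :: nat
    and F :: "'k::{field,finite} set"
    and \<theta> :: "'k \<Rightarrow> complex"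
  assumes "odd CHAR('k)"
    and "0 < n"
    and "canonical_data t n F"
    and "nontrivial_additive_character \<theta>"
    and "\<And>\<alpha>. \<theta> (\<alpha> ^ card F) = \<theta> \<alpha>"
  shows "supercharacter_theory (fixed_group t n F)
           {supercharacter t n F \<theta> D \<phi> | D \<phi>. (D, \<phi>) \<in> invariant_basic_pairs t n F}
           {superclass t n F D \<phi> | D \<phi>. (D, \<phi>) \<in> invariant_basic_pairs t n F}"
proof -
  interpret canonical_case t n F \<theta> using assms by unfold_locales
  let ?I = "invariant_basic_pairs t n F"
  have D: "basic_subset n D" if "(D, \<phi>) \<in> ?I" for D and \<phi> :: "nat \<times> nat \<Rightarrow> 'k"
    using that by (auto simp: invariant_basic_pairs_def basic_pairs_def)
  have "{supercharacter t n F \<theta> D \<phi> | D \<phi>. (D, \<phi>) \<in> ?I} = (\<lambda>(D, \<phi>). orbit_char (Om (basic_elem n D \<phi>))) ` ?I"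
    using supercharacter_eq[OF D] by force
  also have "\<dots> = (\<lambda>e. orbit_char (Om e)) ` B"
    unfolding basic_elem_B[symmetric] image_image by (simp add: case_prod_unfold)
  finally have X: "{supercharacter t n F \<theta> D \<phi> | D \<phi>. (D, \<phi>) \<in> ?I} = (\<lambda>e. orbit_char (Om e)) ` B" .
  have "{superclass t n F D \<phi> | D \<phi>. (D, \<phi>) \<in> ?I} = (\<lambda>(D, \<phi>). K (basic_elem n D \<phi>)) ` ?I"
    using superclass_eq by force
  also have "\<dots> = K ` B"
    unfolding basic_elem_B[symmetric] image_image by (simp add: case_prod_unfold)
  finally have Y: "{superclass t n F D \<phi> | D \<phi>. (D, \<phi>) \<in> ?I} = K ` B" .
  show ?thesis
    unfolding X Y fixed_group_eq by (rule supercharacter_theory_orbits)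
qed

end
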